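(* Let $\mathcal T$ be a compactly generated triangulated category with a compact silting generator $M$ and heart $\mathcal H_M$. (1) $\mathrm{FPD}(\mathcal T,M)\le\mathrm{silp}\,\mathcal T\le\mathrm{gpd}(\mathcal T,M)$. If $\mathrm{gpd}(\mathcal T,M)<\infty$, then $\mathrm{FPD}(\mathcal T,M)=\mathrm{gpd}(\mathcal T,M)$. Here $\mathrm{silp}\,\mathcal T:=\sup\{\mathrm{injdim}_{\mathcal T}P: P\in\mathrm{Add}(M)\}$. (2) $\mathrm{FPD}(\mathcal T,M)\le\mathrm{Findim}(\mathcal T,M)\le\max\{0,\mathrm{FPD}(\mathcal T,M)\}\le\mathrm{FPD}(\mathcal T,M)-\inf M$. (3) If $M$ is tilting, then $$\mathrm{Findim}(\mathcal T,M)=\mathrm{FPD}(\mathcal T,M)=\mathrm{FPD}(\mathcal H_M)=\sup\{\mathrm{projdim}_{\mathcal H_M}H: H\in\mathcal H_M,\ \mathrm{projdim}_{\mathcal H_M}H<\infty\}.$$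
   Context: **Setting.** $\mathcal T$ is a triangulated category with arbitrary coproducts and shift $[1]$, compactly generated; $\mathcal T^c$ denotes its compact objects. A compact generator $M$ is a compact object such that $\mathrm{Hom}_{\mathcal T}(M,X[i])=0$ for all $i$ implies $X=0$. A $t$-structure is a pair $(\mathcal U,\mathcal V)$ of full subcategories with $\mathcal V=\mathcal U^\perp$, $\mathcal U={}^\perp\mathcal V$, every object $X$ fitting in a triangle $U\to X\to V\to U[1]$ with $U\in\mathcal U,V\in\mathcal V$, and $\mathcal U[1]\subseteq\mathcal U$. $\mathrm{Add}(M)$ is the class of direct summands of coproducts of copies of $M$. $M$ is silting if $(M^{\perp_{>0}},M^{\perp_{\le0}})$ is a $t$-structure, where $M^{\perp_{>n}}=\{Y:\mathrm{Hom}(M,Y[i])=0\ \forall i>n\}$ and $M^{\perp_{\le n}}=\{Y:\mathrm{Hom}(M,Y[i])=0\ \forall i\le n\}$; $M$ is tilting if moreover $\mathrm{Hom}(P,P'[i])=0$ for $P,P'\in\mathrm{Add}(M)$, $i\neq0$. For $n\in\mathbb Z$: $\mathcal T^{\le n}=M^{\perp_{>n}}$, $\mathcal T^{\ge n+1}=M^{\perp_{\le n}}$; $\mathcal T^-=\bigcup_{n>0}\mathcal T^{\le n}$, $\mathcal T^+=\bigcup_{n>0}\mathcal T^{\ge-n}$, $\mathcal T^{\mathrm b}=\mathcal T^-\cap\mathcal T^+$. $\mathcal H_M=\mathcal T^{\le0}\cap\mathcal T^{\ge0}$ is the abelian heart with cohomological functor $\mathcal H^0_M$, $\mathcal H^\ell_M(X)=\mathcal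 H^0_M(X[\ell])$; $\sup X=\sup\{\ell:\mathcal H^\ell_M(X)\ne0\}$, $\inf X=\inf\{\ell:\mathcal H^\ell_M(X)\neq0\}$. **Dimensions.** $\mathrm{projdim}_{\mathcal T}X=\inf\{n\in\mathbb Z:\mathrm{Hom}_{\mathcal T}(X,U[i])=0\ \forall U\in\mathcal T^-,\ i>n+\sup U\}$. $\mathrm{injdim}_{\mathcal T}Y=\inf\{n\in\mathbb Z:\mathrm{Hom}_{\mathcal T}(V[i],Y)=0\ \forall V\in\mathcal T^+,\ i<-n+\inf V\}$. $\mathrm{FPD}(\mathcal T,M)=\sup\{\mathrm{projdim}_{\mathcal T}X:X\in\mathcal T^{\mathrm b}\cap\mathcal T^{\ge0},\ \mathrm{projdim}_{\mathcal T}X<\infty\}$. $\mathrm{gpd}(\mathcal T,M)=\sup\{\mathrm{projdim}_{\mathcal T}X:X\in\mathcal T^{\mathrm b}\cap\mathcal T^{\ge0}\}$. $\mathrm{Findim}(\mathcal T,M)=\inf\{n\in\mathbb N:\mathcal T^{\ge0}\cap\mathcal T^{\mathrm{sb}}\subseteq\bigcup_{m\ge0}\overline{\langle M\rangle}^{[0,m]}[n]\}$, where $\overline{\langle M\rangle}^{[s,t]}=\mathrm{smd}(\mathrm{Coprod}\{M[-i]:s\le i\le t\})$, $\mathcal T^{\mathrm{sb}}=\bigcup_{i\ge0}\overline{\langle M\rangle}^{[-i,i]}$, $\mathrm{Coprod}(\mathcal A)$ is the smallest full subcategory containing $\mathcal A$ and closed under coproducts and extensions, and $\mathrm{smd}$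 is closure under direct summands. $\mathrm{projdim}_{\mathcal H_M}$ is projective dimension in the abelian category $\mathcal H_M$; $\mathrm{FPD}(\mathcal H_M)$ is by definition the last supremum in (3).
   Formalization: The last inequality of (2) and all of (3) are stated for M ≠ 0 (equivalently 𝒯 ≠ 0), since for 𝒯 = 0 one has FPD(𝒯,M) = −∞, Findim(𝒯,M) = 0 and inf M = +∞ and they fail; in (2), −∞ − (−∞) is read as +∞. *)

theory Defs
  imports Complex_Main "HOL-Library.Extended_Real" "HOL-Algebra.FiniteProduct"
    "HOL-Algebra.Product_Groups"
begin

unbundle cardinal_syntax

section \<open>Additive categories\<close>

text \<open>
  Arrows carry no domain and codomain: every notion below is relative to the objects it mentions,
  so the hom-sets of different pairs of objects need not be disjoint.
\<close>

record ('o, 'm) precat =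
  Ob :: "'o set"
  Hom :: "'o \<Rightarrow> 'o \<Rightarrow> 'm set"
  Id :: "'o \<Rightarrow> 'm"
  Comp :: "'m \<Rightarrow> 'm \<Rightarrow> 'm" (infixl "\<cdot>\<index>" 70)
  Add :: "'m \<Rightarrow> 'm \<Rightarrow> 'm"
  Null :: "'o \<Rightarrow> 'o \<Rightarrow> 'm"

definition hom_group :: "('o, 'm, 'z) precat_scheme \<Rightarrow> 'o \<Rightarrow> 'o \<Rightarrow> 'm monoid" where
  "hom_group C X Y = \<lparr>carrier = Hom C X Y, monoid.mult = Add C, one = Null C X Y\<rparr>"

definition Neg :: "('o, 'm, 'z) precat_scheme \<Rightarrow> 'o \<Rightarrow> 'o \<Rightarrow> 'm \<Rightarrow> 'm" where
  "Neg C X Y f = m_inv (hom_group C X Y) f"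

definition is_zero :: "('o, 'm, 'z) precat_scheme \<Rightarrow> 'o \<Rightarrow> bool" where
  "is_zero C Z \<longleftrightarrow> Z \<in> Ob C \<and> (\<forall>X\<in>Ob C. (\<exists>!f. f \<in> Hom C Z X) \<and> (\<exists>!f. f \<in> Hom C X Z))"

definition iso_arrow :: "('o, 'm, 'z) precat_scheme \<Rightarrow> 'o \<Rightarrow> 'o \<Rightarrow> 'm \<Rightarrow> bool" where
  "iso_arrow C X Y f \<longleftrightarrow> f \<in> Hom C X Y \<and>
     (\<exists>g\<in>Hom C Y X. g \<cdot>\<^bsub>C\<^esub> f = Id C X \<and> f \<cdot>\<^bsub>C\<^esub> g = Id C Y)"

definition is_coproduct ::
  "('o, 'm, 'z) precat_scheme \<Rightarrow> 'i set \<Rightarrow> ('i \<Rightarrow> 'o) \<Rightarrow> 'o \<Rightarrow> ('i \<Rightarrow> 'm) \<Rightarrow> bool" where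
  "is_coproduct C I X S \<iota> \<longleftrightarrow>
     S \<in> Ob C \<and> (\<forall>i\<in>I. X i \<in> Ob C \<and> \<iota> i \<in> Hom C (X i) S) \<and>
     (\<forall>Y\<in>Ob C. \<forall>f. (\<forall>i\<in>I. f i \<in> Hom C (X i) Y) \<longrightarrow>
        (\<exists>!h. h \<in> Hom C S Y \<and> (\<forall>i\<in>I. h \<cdot>\<^bsub>C\<^esub> \<iota> i = f i)))"

text \<open>\<open>S = P \<oplus> Q\<close>; in an additive category binary coproducts are biproducts.\<close>

definition is_direct_sum ::
  "('o, 'm, 'z) precat_scheme \<Rightarrow> 'o \<Rightarrow> 'o \<Rightarrow> 'o \<Rightarrow> bool" where
  "is_direct_sum C P Q S \<longleftrightarrow> (\<exists>\<iota>. is_coproduct C (UNIV :: bool set) (\<lambda>b. if b then P else Q) S \<iota>)"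

definition direct_summand :: "('o, 'm, 'z) precat_scheme \<Rightarrow> 'o \<Rightarrow> 'o \<Rightarrow> bool" where
  "direct_summand C P S \<longleftrightarrow> (\<exists>Q. is_direct_sum C P Q S)"

locale preadditive_category =
  fixes C :: "('o, 'm, 'z) precat_scheme" (structure)
  assumes Id_Hom: "X \<in> Ob C \<Longrightarrow> Id C X \<in> Hom C X X"
    and Comp_Hom: "\<lbrakk>X \<in> Ob C; Y \<in> Ob C; Z \<in> Ob C; f \<in> Hom C X Y; g \<in> Hom C Y Z\<rbrakk>
          \<Longrightarrow> g \<cdot> f \<in> Hom C X Z"
    and Comp_Id: "\<lbrakk>X \<in> Ob C; Y \<in> Ob C; f \<in> Hom C X Y\<rbrakk> \<Longrightarrow> f \<cdot> Id C X = f"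
    and Id_Comp: "\<lbrakk>X \<in> Ob C; Y \<in> Ob C; f \<in> Hom C X Y\<rbrakk> \<Longrightarrow> Id C Y \<cdot> f = f"
    and Comp_assoc: "\<lbrakk>W \<in> Ob C; X \<in> Ob C; Y \<in> Ob C; Z \<in> Ob C;
            f \<in> Hom C W X; g \<in> Hom C X Y; h \<in> Hom C Y Z\<rbrakk> \<Longrightarrow> (h \<cdot> g) \<cdot> f = h \<cdot> (g \<cdot> f)"
    and comm_group_Hom: "\<lbrakk>X \<in> Ob C; Y \<in> Ob C\<rbrakk> \<Longrightarrow> comm_group (hom_group C X Y)"
    and Comp_Add_left: "\<lbrakk>X \<in> Ob C; Y \<in> Ob C; Z \<in> Ob C; f \<in> Hom C X Y; f' \<in> Hom C X Y;
            g \<in> Hom C Y Z\<rbrakk> \<Longrightarrow> g \<cdot> Add C f f' = Add C (g \<cdot> f) (g \<cdot> f')"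
    and Comp_Add_right: "\<lbrakk>X \<in> Ob C; Y \<in> Ob C; Z \<in> Ob C; f \<in> Hom C X Y; g \<in> Hom C Y Z;
            g' \<in> Hom C Y Z\<rbrakk> \<Longrightarrow> Add C g g' \<cdot> f = Add C (g \<cdot> f) (g' \<cdot> f)"

locale additive_category = preadditive_category +
  assumes ex_zero: "\<exists>Z. is_zero C Z"
    and ex_direct_sum: "\<lbrakk>X \<in> Ob C; Y \<in> Ob C\<rbrakk> \<Longrightarrow> \<exists>S. is_direct_sum C X Y S"


section \<open>Projective dimension in an abelian category\<close>

definition epi :: "('o, 'm, 'z) precat_scheme \<Rightarrow> 'o \<Rightarrow> 'o \<Rightarrow> 'm \<Rightarrow> bool" where
  "epi C X Y e \<longleftrightarrow> e \<in> Hom C X Y \<and>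
     (\<forall>Z\<in>Ob C. \<forall>u\<in>Hom C Y Z. \<forall>v\<in>Hom C Y Z. u \<cdot>\<^bsub>C\<^esub> e = v \<cdot>\<^bsub>C\<^esub> e \<longrightarrow> u = v)"

definition is_kernel ::
  "('o, 'm, 'z) precat_scheme \<Rightarrow> 'o \<Rightarrow> 'o \<Rightarrow> 'o \<Rightarrow> 'm \<Rightarrow> 'm \<Rightarrow> bool" where
  "is_kernel C K X Y k g \<longleftrightarrow>
     K \<in> Ob C \<and> k \<in> Hom C K X \<and> g \<cdot>\<^bsub>C\<^esub> k = Null C K Y \<and>
     (\<forall>Z\<in>Ob C. \<forall>t\<in>Hom C Z X. g \<cdot>\<^bsub>C\<^esub> t = Null C Z Y \<longrightarrow>
        (\<exists>!s. s \<in> Hom C Z K \<and> k \<cdot>\<^bsub>C\<^esub> s = t))"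

text \<open>
  Exactness of \<open>W \<rightarrow> X \<rightarrow> Y\<close> at \<open>X\<close>: the image of \<open>f\<close> is the kernel of \<open>g\<close>.
\<close>

definition exact_at ::
  "('o, 'm, 'z) precat_scheme \<Rightarrow> 'o \<Rightarrow> 'o \<Rightarrow> 'o \<Rightarrow> 'm \<Rightarrow> 'm \<Rightarrow> bool" where
  "exact_at C W X Y f g \<longleftrightarrow> f \<in> Hom C W X \<and> g \<in> Hom C X Y \<and>
     (\<exists>K k e. is_kernel C K X Y k g \<and> epi C W K e \<and> f = k \<cdot>\<^bsub>C\<^esub> e)"

definition projective :: "('o, 'm, 'z) precat_scheme \<Rightarrow> 'o \<Rightarrow> bool" where
  "projective C P \<longleftrightarrow> P \<in> Ob C \<and>
     (\<forall>X\<in>Ob C. \<forall>Y\<in>Ob C. \<forall>e f. epi C X Y e \<and> f \<in> Hom C P Y \<longrightarrow>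
        (\<exists>g\<in>Hom C P X. e \<cdot>\<^bsub>C\<^esub> g = f))"

text \<open>The resolution \<open>\<dots> \<rightarrow> P 1 \<rightarrow> P 0 \<rightarrow> X \<rightarrow> 0\<close> with differentials \<open>d i : P (i + 1) \<rightarrow> P i\<close>.\<close>

definition proj_resolution ::
  "('o, 'm, 'z) precat_scheme \<Rightarrow> 'o \<Rightarrow> (nat \<Rightarrow> 'o) \<Rightarrow> (nat \<Rightarrow> 'm) \<Rightarrow> 'm \<Rightarrow> bool" where
  "proj_resolution C X P d \<epsilon> \<longleftrightarrow>
     (\<forall>i. projective C (P i)) \<and> epi C (P 0) X \<epsilon> \<and> exact_at C (P 1) (P 0) X (d 0) \<epsilon> \<and>
     (\<forall>i. exact_at C (P (i + 2)) (P (i + 1)) (P i) (d (i + 1)) (d i))"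

text \<open>
  The infimum is \<open>\<infinity>\<close> if there is no finite resolution.  The zero object gets dimension \<open>0\<close>.
\<close>

definition projdim_ab :: "('o, 'm, 'z) precat_scheme \<Rightarrow> 'o \<Rightarrow> ereal" where
  "projdim_ab C X = Inf {ereal (real n) | n :: nat.
     \<exists>P d \<epsilon>. proj_resolution C X P d \<epsilon> \<and> (\<forall>i>n. is_zero C (P i))}"

definition FPD_ab :: "('o, 'm, 'z) precat_scheme \<Rightarrow> ereal" where
  "FPD_ab C = Sup {projdim_ab C X | X. X \<in> Ob C \<and> projdim_ab C X < \<infinity>}"


section \<open>Triangulated categories\<close>

text \<open>
  The shift is a strict action of the integers, \<open>X[i] = Sh T i X\<close> and \<open>f[i] = ShM T i f\<close>;
  equivalently, \<open>[1]\<close> is an automorphism.  \<open>Tri T X Y Z f g h\<close> says that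
  \<open>X \<rightarrow> Y \<rightarrow> Z \<rightarrow> X[1]\<close>, with arrows \<open>f\<close>, \<open>g\<close>, \<open>h\<close>, is a distinguished triangle.
\<close>

record ('o, 'm) tricat = "('o, 'm) precat" +
  Sh :: "int \<Rightarrow> 'o \<Rightarrow> 'o"
  ShM :: "int \<Rightarrow> 'm \<Rightarrow> 'm"
  Tri :: "'o \<Rightarrow> 'o \<Rightarrow> 'o \<Rightarrow> 'm \<Rightarrow> 'm \<Rightarrow> 'm \<Rightarrow> bool"

locale triangulated_category = additive_category T
  for T :: "('o, 'm, 'z) tricat_scheme" (structure) +
  assumes Sh_Ob: "X \<in> Ob T \<Longrightarrow> Sh T i X \<in> Ob T"
    and Sh_zero: "X \<in> Ob T \<Longrightarrow> Sh T 0 X = X"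
    and Sh_Sh: "X \<in> Ob T \<Longrightarrow> Sh T i (Sh T j X) = Sh T (i + j) X"
    and ShM_Hom: "\<lbrakk>X \<in> Ob T; Y \<in> Ob T; f \<in> Hom T X Y\<rbrakk>
          \<Longrightarrow> ShM T i f \<in> Hom T (Sh T i X) (Sh T i Y)"
    and ShM_zero: "\<lbrakk>X \<in> Ob T; Y \<in> Ob T; f \<in> Hom T X Y\<rbrakk> \<Longrightarrow> ShM T 0 f = f"
    and ShM_ShM: "\<lbrakk>X \<in> Ob T; Y \<in> Ob T; f \<in> Hom T X Y\<rbrakk>
          \<Longrightarrow> ShM T i (ShM T j f) = ShM T (i + j) f"
    and ShM_Id: "X \<in> Ob T \<Longrightarrow> ShM T i (Id T X) = Id T (Sh T i X)"
    and ShM_Comp: "\<lbrakk>X \<in> Ob T; Y \<in> Ob T; Z \<in> Ob T; f \<in> Hom T X Y; g \<in> Hom T Y Z\<rbrakk>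
          \<Longrightarrow> ShM T i (g \<cdot> f) = ShM T i g \<cdot> ShM T i f"
    and ShM_Add: "\<lbrakk>X \<in> Ob T; Y \<in> Ob T; f \<in> Hom T X Y; g \<in> Hom T X Y\<rbrakk>
          \<Longrightarrow> ShM T i (Add T f g) = Add T (ShM T i f) (ShM T i g)"
    and Tri_arrows: "Tri T X Y Z f g h \<Longrightarrow> X \<in> Ob T \<and> Y \<in> Ob T \<and> Z \<in> Ob T \<and>
          f \<in> Hom T X Y \<and> g \<in> Hom T Y Z \<and> h \<in> Hom T Z (Sh T 1 X)"
    and TR1_iso: "\<lbrakk>Tri T X Y Z f g h; X' \<in> Ob T; Y' \<in> Ob T; Z' \<in> Ob T;
          f' \<in> Hom T X' Y'; g' \<in> Hom T Y' Z'; h' \<in> Hom T Z' (Sh T 1 X');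
          iso_arrow T X X' \<alpha>; iso_arrow T Y Y' \<beta>; iso_arrow T Z Z' \<gamma>;
          \<beta> \<cdot> f = f' \<cdot> \<alpha>; \<gamma> \<cdot> g = g' \<cdot> \<beta>; ShM T 1 \<alpha> \<cdot> h = h' \<cdot> \<gamma>\<rbrakk>
          \<Longrightarrow> Tri T X' Y' Z' f' g' h'"
    and TR1_Id: "\<lbrakk>X \<in> Ob T; is_zero T Z\<rbrakk>
          \<Longrightarrow> Tri T X X Z (Id T X) (Null T X Z) (Null T Z (Sh T 1 X))"
    and TR1_cone: "\<lbrakk>X \<in> Ob T; Y \<in> Ob T; f \<in> Hom T X Y\<rbrakk> \<Longrightarrow> \<exists>Z g h. Tri T X Y Z f g h"
    and TR2: "\<lbrakk>X \<in> Ob T; Y \<in> Ob T; Z \<in> Ob T;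
          f \<in> Hom T X Y; g \<in> Hom T Y Z; h \<in> Hom T Z (Sh T 1 X)\<rbrakk>
          \<Longrightarrow> Tri T X Y Z f g h \<longleftrightarrow>
              Tri T Y Z (Sh T 1 X) g h (Neg T (Sh T 1 X) (Sh T 1 Y) (ShM T 1 f))"
    and TR3: "\<lbrakk>Tri T X Y Z f g h; Tri T X' Y' Z' f' g' h';
          \<alpha> \<in> Hom T X X'; \<beta> \<in> Hom T Y Y'; \<beta> \<cdot> f = f' \<cdot> \<alpha>\<rbrakk>
          \<Longrightarrow> \<exists>\<gamma>\<in>Hom T Z Z'. \<gamma> \<cdot> g = g' \<cdot> \<beta> \<and> ShM T 1 \<alpha> \<cdot> h = h' \<cdot> \<gamma>"
    and TR4: "\<lbrakk>Tri T X Y Z' f u u'; Tri T Y Z X' g v v'; Tri T X Z Y' (g \<cdot> f) w w'\<rbrakk>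
          \<Longrightarrow> \<exists>a b. Tri T Z' Y' X' a b (ShM T 1 u \<cdot> v') \<and>
                a \<cdot> u = w \<cdot> g \<and> w' \<cdot> a = u' \<and> b \<cdot> w = v \<and> v' \<cdot> b = ShM T 1 f \<cdot> w'"


section \<open>Coproducts, compactness, compact generation\<close>

text \<open>
  ``Arbitrary coproducts'' means coproducts indexed by all sets of the ambient universe.  The
  universe enters as a cardinal \<open>\<kappa>\<close>: small sets are those of cardinality less than \<open>\<kappa>\<close>.
\<close>

definition universe_card :: "'u rel \<Rightarrow> bool" where
  "universe_card \<kappa> \<longleftrightarrow> Cinfinite \<kappa> \<and> regularCard \<kappa> \<and> natLeq <o \<kappa>"

definition has_coproducts :: "'u rel \<Rightarrow> ('o, 'm, 'z) precat_scheme \<Rightarrow> bool" where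
  "has_coproducts \<kappa> C \<longleftrightarrow>
     (\<forall>(I :: 'u set) X. |I| <o \<kappa> \<and> X ` I \<subseteq> Ob C \<longrightarrow> (\<exists>S \<iota>. is_coproduct C I X S \<iota>))"

text \<open>
  \<open>C\<close> is compact if the canonical map from the direct sum of the groups \<open>Hom(C, X i)\<close> to
  \<open>Hom(C, S)\<close>, where \<open>S\<close> is the coproduct of the \<open>X i\<close>, is an isomorphism.  Hom-groups are
  written multiplicatively by HOL-Algebra, so \<^const>\<open>finprod\<close> is a finite sum of arrows.
\<close>

definition compact_object :: "'u rel \<Rightarrow> ('o, 'm, 'z) precat_scheme \<Rightarrow> 'o \<Rightarrow> bool" where
  "compact_object \<kappa> T C \<longleftrightarrow> C \<in> Ob T \<and>
     (\<forall>(I :: 'u set) X S \<iota>. |I| <o \<kappa> \<and> is_coproduct T I X S \<iota> \<longrightarrow>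
        (\<lambda>\<phi>. finprod (hom_group T C S) (\<lambda>i. \<iota> i \<cdot>\<^bsub>T\<^esub> \<phi> i) {i \<in> I. \<phi> i \<noteq> Null T C (X i)})
          \<in> iso (sum_group I (\<lambda>i. hom_group T C (X i))) (hom_group T C S))"

definition Hom_vanishes :: "('o, 'm, 'z) precat_scheme \<Rightarrow> 'o \<Rightarrow> 'o \<Rightarrow> bool" where
  "Hom_vanishes C X Y \<longleftrightarrow> Hom C X Y = {Null C X Y}"

definition generates :: "('o, 'm, 'z) tricat_scheme \<Rightarrow> 'o set \<Rightarrow> bool" where
  "generates T G \<longleftrightarrow>
     (\<forall>X\<in>Ob T. (\<forall>C\<in>G. \<forall>i. Hom_vanishes T C (Sh T i X)) \<longrightarrow> is_zero T X)"

definition compact_generator :: "'u rel \<Rightarrow> ('o, 'm, 'z) tricat_scheme \<Rightarrow> 'o \<Rightarrow> bool" where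
  "compact_generator \<kappa> T M \<longleftrightarrow> compact_object \<kappa> T M \<and> generates T {M}"

text \<open>
  The assumption \<open>Hom_small\<close> is a consequence of all hom-sets being small, which is part of the
  usual definition of a category relative to a universe.  Smallness of all hom-sets would force
  \<open>\<kappa>\<close> to be inaccessible as soon as \<open>T\<close> is nonzero, since \<open>Hom(\<Coprod>\<^sub>I X, X)\<close> is a power of
  \<open>Hom(X, X)\<close>; with compact sources only, every regular uncountable \<open>\<kappa>\<close> has nonzero examples,
  so that the hypotheses are satisfiable in HOL.
\<close>

locale compactly_generated_tricat = triangulated_category T
  for \<kappa> :: "'u rel" and T :: "('o, 'm, 'z) tricat_scheme" (structure) +
  assumes universe: "universe_card \<kappa>"
    and coproducts: "has_coproducts \<kappa> T"
    and Hom_small: "\<lbrakk>compact_object \<kappa> T C; X \<in> Ob T\<rbrakk> \<Longrightarrow> |Hom T C X| <o \<kappa>"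
    and compactly_generated:
      "\<exists>G. |G| <o \<kappa> \<and> (\<forall>C\<in>G. compact_object \<kappa> T C) \<and> generates T G"


section \<open>Silting and tilting objects\<close>

definition t_structure :: "('o, 'm, 'z) tricat_scheme \<Rightarrow> 'o set \<Rightarrow> 'o set \<Rightarrow> bool" where
  "t_structure T U V \<longleftrightarrow>
     V = {Y \<in> Ob T. \<forall>X\<in>U. Hom_vanishes T X Y} \<and>
     U = {X \<in> Ob T. \<forall>Y\<in>V. Hom_vanishes T X Y} \<and>
     (\<forall>X\<in>Ob T. \<exists>A\<in>U. \<exists>B\<in>V. \<exists>f g h. Tri T A X B f g h) \<and>
     Sh T 1 ` U \<subseteq> U"

definition perp_gt :: "('o, 'm, 'z) tricat_scheme \<Rightarrow> 'o \<Rightarrow> int \<Rightarrow> 'o set" where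
  "perp_gt T M n = {Y \<in> Ob T. \<forall>i>n. Hom_vanishes T M (Sh T i Y)}"

definition perp_le :: "('o, 'm, 'z) tricat_scheme \<Rightarrow> 'o \<Rightarrow> int \<Rightarrow> 'o set" where
  "perp_le T M n = {Y \<in> Ob T. \<forall>i\<le>n. Hom_vanishes T M (Sh T i Y)}"

definition Add_cls :: "'u rel \<Rightarrow> ('o, 'm, 'z) precat_scheme \<Rightarrow> 'o \<Rightarrow> 'o set" where
  "Add_cls \<kappa> T M = {P \<in> Ob T. \<exists>(I :: 'u set) S \<iota>. |I| <o \<kappa> \<and>
     is_coproduct T I (\<lambda>_. M) S \<iota> \<and> direct_summand T P S}"

definition silting :: "('o, 'm, 'z) tricat_scheme \<Rightarrow> 'o \<Rightarrow> bool" where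
  "silting T M \<longleftrightarrow> M \<in> Ob T \<and> t_structure T (perp_gt T M 0) (perp_le T M 0)"

definition tilting :: "'u rel \<Rightarrow> ('o, 'm, 'z) tricat_scheme \<Rightarrow> 'o \<Rightarrow> bool" where
  "tilting \<kappa> T M \<longleftrightarrow> silting T M \<and>
     (\<forall>P\<in>Add_cls \<kappa> T M. \<forall>P'\<in>Add_cls \<kappa> T M. \<forall>i. i \<noteq> 0 \<longrightarrow> Hom_vanishes T P (Sh T i P'))"

definition T_le :: "('o, 'm, 'z) tricat_scheme \<Rightarrow> 'o \<Rightarrow> int \<Rightarrow> 'o set" where
  "T_le T M n = perp_gt T M n"

definition T_ge :: "('o, 'm, 'z) tricat_scheme \<Rightarrow> 'o \<Rightarrow> int \<Rightarrow> 'o set" where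
  "T_ge T M n = perp_le T M (n - 1)"

definition T_minus :: "('o, 'm, 'z) tricat_scheme \<Rightarrow> 'o \<Rightarrow> 'o set" where
  "T_minus T M = (\<Union>n\<in>{0<..}. T_le T M n)"

definition T_plus :: "('o, 'm, 'z) tricat_scheme \<Rightarrow> 'o \<Rightarrow> 'o set" where
  "T_plus T M = (\<Union>n\<in>{0<..}. T_ge T M (- n))"

definition T_bd :: "('o, 'm, 'z) tricat_scheme \<Rightarrow> 'o \<Rightarrow> 'o set" where
  "T_bd T M = T_minus T M \<inter> T_plus T M"

text \<open>The heart, as the full subcategory on its objects.\<close>

definition heart :: "('o, 'm, 'z) tricat_scheme \<Rightarrow> 'o \<Rightarrow> ('o, 'm, 'z) tricat_scheme" where
  "heart T M = T\<lparr>Ob := T_le T M 0 \<inter> T_ge T M 0\<rparr>"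

text \<open>
  Truncations are unique up to isomorphism only, hence so are the cohomology objects
  \<open>coh T M l X = \<tau>\<^sup>\<ge>\<^sup>0 \<tau>\<^sup>\<le>\<^sup>0 (X[l])\<close>; they only enter through their vanishing.
\<close>

definition tau_le :: "('o, 'm, 'z) tricat_scheme \<Rightarrow> 'o \<Rightarrow> int \<Rightarrow> 'o \<Rightarrow> 'o" where
  "tau_le T M n X =
     (SOME A. A \<in> T_le T M n \<and> (\<exists>B\<in>T_ge T M (n + 1). \<exists>f g h. Tri T A X B f g h))"

definition tau_ge :: "('o, 'm, 'z) tricat_scheme \<Rightarrow> 'o \<Rightarrow> int \<Rightarrow> 'o \<Rightarrow> 'o" where
  "tau_ge T M n X =
     (SOME B. B \<in> T_ge T M n \<and> (\<exists>A\<in>T_le T M (n - 1). \<exists>f g h. Tri T A X B f g h))"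

definition coh :: "('o, 'm, 'z) tricat_scheme \<Rightarrow> 'o \<Rightarrow> int \<Rightarrow> 'o \<Rightarrow> 'o" where
  "coh T M l X = tau_ge T M 0 (tau_le T M 0 (Sh T l X))"

definition coh_sup :: "('o, 'm, 'z) tricat_scheme \<Rightarrow> 'o \<Rightarrow> 'o \<Rightarrow> ereal" where
  "coh_sup T M X = Sup {ereal (of_int l) | l. \<not> is_zero T (coh T M l X)}"

definition coh_inf :: "('o, 'm, 'z) tricat_scheme \<Rightarrow> 'o \<Rightarrow> 'o \<Rightarrow> ereal" where
  "coh_inf T M X = Inf {ereal (of_int l) | l. \<not> is_zero T (coh T M l X)}"


section \<open>Dimensions\<close>

text \<open>
  Values are extended reals, with \<open>Inf {} = \<infinity>\<close> and \<open>Sup {} = -\<infinity>\<close>; in particular the zero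
  object has \<open>projdim\<close> equal to \<open>-\<infinity>\<close>.  If \<open>inf M = -\<infinity>\<close> then \<open>FPD - inf M\<close> is \<open>\<infinity>\<close>, also
  when \<open>FPD = -\<infinity>\<close>, because \<open>-\<infinity> + \<infinity> = \<infinity>\<close> for \<^typ>\<open>ereal\<close>.
\<close>

definition projdim :: "('o, 'm, 'z) tricat_scheme \<Rightarrow> 'o \<Rightarrow> 'o \<Rightarrow> ereal" where
  "projdim T M X = Inf {ereal (of_int n) | n :: int.
     \<forall>U\<in>T_minus T M. \<forall>i :: int. ereal (of_int i) > ereal (of_int n) + coh_sup T M U \<longrightarrow>
       Hom_vanishes T X (Sh T i U)}"

definition injdim :: "('o, 'm, 'z) tricat_scheme \<Rightarrow> 'o \<Rightarrow> 'o \<Rightarrow> ereal" where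
  "injdim T M Y = Inf {ereal (of_int n) | n :: int.
     \<forall>V\<in>T_plus T M. \<forall>i :: int. ereal (of_int i) < - ereal (of_int n) + coh_inf T M V \<longrightarrow>
       Hom_vanishes T (Sh T i V) Y}"

definition silp :: "'u rel \<Rightarrow> ('o, 'm, 'z) tricat_scheme \<Rightarrow> 'o \<Rightarrow> ereal" where
  "silp \<kappa> T M = Sup {injdim T M P | P. P \<in> Add_cls \<kappa> T M}"

definition FPD :: "('o, 'm, 'z) tricat_scheme \<Rightarrow> 'o \<Rightarrow> ereal" where
  "FPD T M = Sup {projdim T M X | X. X \<in> T_bd T M \<inter> T_ge T M 0 \<and> projdim T M X < \<infinity>}"

definition gpd :: "('o, 'm, 'z) tricat_scheme \<Rightarrow> 'o \<Rightarrow> ereal" where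
  "gpd T M = Sup {projdim T M X | X. X \<in> T_bd T M \<inter> T_ge T M 0}"

inductive_set Coprod :: "'u rel \<Rightarrow> ('o, 'm, 'z) tricat_scheme \<Rightarrow> 'o set \<Rightarrow> 'o set"
  for \<kappa> :: "'u rel" and T :: "('o, 'm, 'z) tricat_scheme" and \<A> :: "'o set" where
  base: "X \<in> \<A> \<Longrightarrow> X \<in> Coprod \<kappa> T \<A>"
| coproduct: "\<lbrakk>|I :: 'u set| <o \<kappa>; \<And>i. i \<in> I \<Longrightarrow> X i \<in> Coprod \<kappa> T \<A>; is_coproduct T I X S \<iota>\<rbrakk>
    \<Longrightarrow> S \<in> Coprod \<kappa> T \<A>"
| extension: "\<lbrakk>X \<in> Coprod \<kappa> T \<A>; Z \<in> Coprod \<kappa> T \<A>; Tri T X Y Z f g h\<rbrakk> \<Longrightarrow> Y \<in> Coprod \<kappa> T \<A>"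

definition smd :: "('o, 'm, 'z) precat_scheme \<Rightarrow> 'o set \<Rightarrow> 'o set" where
  "smd T \<A> = {X \<in> Ob T. \<exists>S\<in>\<A>. direct_summand T X S}"

definition gen_interval ::
  "'u rel \<Rightarrow> ('o, 'm, 'z) tricat_scheme \<Rightarrow> 'o \<Rightarrow> int \<Rightarrow> int \<Rightarrow> 'o set" where
  "gen_interval \<kappa> T M s t = smd T (Coprod \<kappa> T {Sh T (- i) M | i. s \<le> i \<and> i \<le> t})"

definition T_sb :: "'u rel \<Rightarrow> ('o, 'm, 'z) tricat_scheme \<Rightarrow> 'o \<Rightarrow> 'o set" where
  "T_sb \<kappa> T M = (\<Union>i\<in>{0..}. gen_interval \<kappa> T M (- i) i)"

definition Findim :: "'u rel \<Rightarrow> ('o, 'm, 'z) tricat_scheme \<Rightarrow> 'o \<Rightarrow> ereal" where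
  "Findim \<kappa> T M = Inf {ereal (real n) | n :: nat.
     T_ge T M 0 \<inter> T_sb \<kappa> T M \<subseteq> (\<Union>m\<in>{0..}. Sh T (int n) ` gen_interval \<kappa> T M 0 m)}"

end

theory Submission
  imports Defs
begin

text \<open>
  All dimensions are governed by vanishing of \<open>Hom\<close>: \<open>projdim X \<le> n\<close> iff \<open>Hom(X, U[j]) = 0\<close> for
  \<open>U \<in> \<T>\<^sup>\<le>\<^sup>0\<close> and \<open>j > n\<close>, and dually for \<open>injdim\<close>.  Covering \<open>X \<in> \<T>\<^sup>\<le>\<^sup>m\<close> by a coproduct of copies of
  \<open>M[-m]\<close> leaves a cone in \<open>\<T>\<^sup>\<le>\<^sup>m\<^sup>-\<^sup>1\<close>.  Iterating this until the remaining map \<open>X \<rightarrow> X\<^sub>k\<close> vanishes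
  exhibits an \<open>X\<close> of finite projective dimension as a summand of a finite extension of such
  coproducts, which gives (2).  Iterating it on the target, \<open>Hom(X, U[j])\<close> embeds into
  \<open>Hom(X, U'[j + k])\<close> with \<open>U' \<in> \<T>\<^sup>\<le>\<^sup>0\<close>, up to terms \<open>Hom(X, P[i])\<close> with \<open>P \<in> Add(M)\<close>, which gives
  \<open>FPD \<le> silp\<close>.  For \<open>silp \<le> gpd\<close>, an object of \<open>\<T>\<^sup>\<ge>\<^sup>0\<close> is the homotopy colimit of its bounded
  truncations because \<open>M\<close> is a compact generator.  For (3), the coproducts of copies of \<open>M\<close> lie in
  the heart when \<open>M\<close> is tilting; projective resolutions in the heart are then iterated covers,
  and every bounded \<open>X \<in> \<T>\<^sup>\<ge>\<^sup>0\<close> differs from an object of the heart by an extension of objects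
  \<open>M[-i]\<close> with \<open>i \<ge> 1\<close>.
\<close>

text \<open>Inequalities between dimensions are mostly proved in the form: every real upper bound
  \<open>r\<close> of the right side bounds the left side. The dimensions of single objects are
  infima over integers, so \<open>r\<close> may be replaced by its floor, and the values \<infinity>
  and -\<infinity> need no separate arithmetic. Aisle and coaisle behave asymmetrically. Closure of
  \<open>LE n\<close> under coproducts is formal from orthogonality; closure of \<open>GE n\<close>
  under coproducts uses compactness of \<open>M\<close>. Conversely, cohomology detects
  \<open>GE n\<close> for every object, because \<open>M\<close> generates, but detects
  \<open>LE n\<close> only among objects already bounded above. The homotopy colimit argument
  reaches only degrees above n + 1, since its coproduct enters twice, once shifted; the missing
  degree is recovered by splitting off a truncation at 0. In the tilting case \<open>projdim\<close>
  may be negative on the test objects of \<open>FPD\<close>, whereas \<open>Findim\<close> and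
  dimensions in the heart may not. A nonzero \<open>M\<close> in the heart forces \<open>FPD\<close>
  to be at least 0 and removes the discrepancy.\<close>

lemma is_coproduct_cong:
  "(\<And>i. i \<in> I \<Longrightarrow> X i = X' i) \<Longrightarrow> is_coproduct C I X S \<iota> \<longleftrightarrow> is_coproduct C I X' S \<iota>"
  unfolding is_coproduct_def by simp

text \<open>Coproducts and compactness speak of index sets in the type of \<open>\<kappa>\<close>. A
  set of cardinality below \<open>\<kappa>\<close> embeds into \<open>Field \<kappa>\<close>, so
  other index sets, such as Hom-sets or the naturals, can be moved there.\<close>

lemma small_copy:
  fixes \<kappa> :: "'u rel" and J :: "'j set"
  assumes "|J| <o \<kappa>"
  shows "\<exists>(I :: 'u set) b. |I| <o \<kappa> \<and> bij_betw b J I"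
proof -
  have "|J| \<le>o |Field \<kappa>|"
    using card_of_mono2[OF ordLess_imp_ordLeq[OF assms]] by (simp add: Field_card_of)
  then obtain b :: "'j \<Rightarrow> 'u" where b: "inj_on b J" using card_of_ordLeq[of J "Field \<kappa>"] by auto
  then have bb: "bij_betw b J (b ` J)" by (simp add: bij_betw_def)
  then have "|b ` J| =o |J|" using card_of_ordIso ordIso_symmetric by blast
  then have "|b ` J| <o \<kappa>" using assms ordIso_ordLess_trans by blast
  with bb show ?thesis by blast
qed

text \<open>An upward closed set of integers with infimum at most \<open>r\<close> has an element
  strictly below floor(r) + 1, hence contains floor(r). This includes the infimum -\<infinity>,
  where \<open>Q\<close> holds everywhere.\<close>

lemma Inf_of_int_le_iff:
  assumes "\<And>m n :: int. \<lbrakk>Q m; m \<le> n\<rbrakk> \<Longrightarrow> Q n"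
  shows "Inf {ereal (of_int n) | n :: int. Q n} \<le> ereal r \<longleftrightarrow> Q \<lfloor>r\<rfloor>"
proof
  assume "Inf {ereal (of_int n) | n :: int. Q n} \<le> ereal r"
  also have "ereal r < ereal (of_int (\<lfloor>r\<rfloor> + 1))" by simp
  finally obtain n where "Q n" "ereal (of_int n) < ereal (of_int (\<lfloor>r\<rfloor> + 1))" by (auto simp: Inf_less_iff)
  then have "n \<le> \<lfloor>r\<rfloor>" by simp
  then show "Q \<lfloor>r\<rfloor>" using assms \<open>Q n\<close> by blast
next
  assume "Q \<lfloor>r\<rfloor>"
  then have "Inf {ereal (of_int n) | n :: int. Q n} \<le> ereal (of_int \<lfloor>r\<rfloor>)" by (intro Inf_lower) blast
  also have "\<dots> \<le> ereal r" by simp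
  finally show "Inf {ereal (of_int n) | n :: int. Q n} \<le> ereal r" .
qed

section \<open>Preadditive categories\<close>

context preadditive_category
begin

text \<open>Arrows do not determine their endpoints, so typing is a relation that also records that
  both endpoints are objects.\<close>

definition arr :: "'m \<Rightarrow> 'o \<Rightarrow> 'o \<Rightarrow> bool" where
  "arr f X Y \<longleftrightarrow> X \<in> Ob C \<and> Y \<in> Ob C \<and> f \<in> Hom C X Y"

lemma arrI: "\<lbrakk>X \<in> Ob C; Y \<in> Ob C; f \<in> Hom C X Y\<rbrakk> \<Longrightarrow> arr f X Y"
  by (simp add: arr_def)

lemma arrD: "arr f X Y \<Longrightarrow> X \<in> Ob C" "arr f X Y \<Longrightarrow> Y \<in> Ob C" "arr f X Y \<Longrightarrow> f \<in> Hom C X Y"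
  by (simp_all add: arr_def)

lemma arr_Id: "X \<in> Ob C \<Longrightarrow> arr (Id C X) X X"
  by (simp add: arr_def Id_Hom)

lemma arr_Comp: "\<lbrakk>arr f X Y; arr g Y Z\<rbrakk> \<Longrightarrow> arr (g \<cdot> f) X Z"
  unfolding arr_def using Comp_Hom by blast

lemma comp_Id: "arr f X Y \<Longrightarrow> f \<cdot> Id C X = f"
  unfolding arr_def using Comp_Id by blast

lemma Id_comp: "arr f X Y \<Longrightarrow> Id C Y \<cdot> f = f"
  unfolding arr_def using Id_Comp by blast

lemma comp_assoc: "\<lbrakk>arr f W X; arr g X Y; arr h Y Z\<rbrakk> \<Longrightarrow> (h \<cdot> g) \<cdot> f = h \<cdot> (g \<cdot> f)"
  unfolding arr_def using Comp_assoc by blast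

lemma arr_Null: "\<lbrakk>X \<in> Ob C; Y \<in> Ob C\<rbrakk> \<Longrightarrow> arr (Null C X Y) X Y"
  using monoid.one_closed[of "hom_group C X Y"] comm_group_Hom[of X Y]
  by (simp add: arr_def hom_group_def comm_group_def group_def)

lemma arr_Add: "\<lbrakk>arr f X Y; arr g X Y\<rbrakk> \<Longrightarrow> arr (Add C f g) X Y"
  using monoid.m_closed[of "hom_group C X Y" f g] comm_group_Hom[of X Y]
  by (simp add: arr_def hom_group_def comm_group_def group_def)

lemma arr_Neg: "arr f X Y \<Longrightarrow> arr (Neg C X Y f) X Y"
  using group.inv_closed[of "hom_group C X Y" f] comm_group_Hom[of X Y]
  by (simp add: arr_def hom_group_def comm_group_def Neg_def)

lemma Add_assoc: "\<lbrakk>arr f X Y; arr g X Y; arr h X Y\<rbrakk> \<Longrightarrow> Add C (Add C f g) h = Add C f (Add C g h)"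
  using monoid.m_assoc[of "hom_group C X Y" f g h] comm_group_Hom[of X Y]
  by (simp add: arr_def hom_group_def comm_group_def group_def)

lemma Add_commute: "\<lbrakk>arr f X Y; arr g X Y\<rbrakk> \<Longrightarrow> Add C f g = Add C g f"
  using comm_monoid.m_comm[of "hom_group C X Y" f g] comm_group_Hom[of X Y]
  by (simp add: arr_def hom_group_def comm_group_def)

lemma Add_Null: "arr f X Y \<Longrightarrow> Add C f (Null C X Y) = f"
  using monoid.r_one[of "hom_group C X Y" f] comm_group_Hom[of X Y]
  by (simp add: arr_def hom_group_def comm_group_def group_def)

lemma Null_Add: "arr f X Y \<Longrightarrow> Add C (Null C X Y) f = f"
  using monoid.l_one[of "hom_group C X Y" f] comm_group_Hom[of X Y]
  by (simp add: arr_def hom_group_def comm_group_def group_def)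

lemma Add_Neg: "arr f X Y \<Longrightarrow> Add C f (Neg C X Y f) = Null C X Y"
  using group.r_inv[of "hom_group C X Y" f] comm_group_Hom[of X Y]
  by (simp add: arr_def hom_group_def comm_group_def Neg_def)

lemma Neg_Add: "arr f X Y \<Longrightarrow> Add C (Neg C X Y f) f = Null C X Y"
  by (simp add: Add_commute[OF arr_Neg] Add_Neg)

lemma Add_right_cancel:
  assumes "arr f X Y" "arr g X Y" "arr h X Y" "Add C f h = Add C g h" shows "f = g"
proof -
  have "f = Add C (Add C f h) (Neg C X Y h)"
    by (simp only: Add_assoc[OF assms(1,3) arr_Neg[OF assms(3)]] Add_Neg[OF assms(3)] Add_Null[OF assms(1)])
  also have "\<dots> = g" unfolding assms(4)
    by (simp only: Add_assoc[OF assms(2,3) arr_Neg[OF assms(3)]] Add_Neg[OF assms(3)] Add_Null[OF assms(2)])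
  finally show ?thesis .
qed

lemma Neg_unique: assumes "arr f X Y" "arr g X Y" "Add C f g = Null C X Y" shows "f = Neg C X Y g"
  by (rule Add_right_cancel[OF assms(1) arr_Neg[OF assms(2)] assms(2)]) (simp add: assms Neg_Add)

lemma Neg_Neg: "arr f X Y \<Longrightarrow> Neg C X Y (Neg C X Y f) = f"
  using Neg_unique[of f X Y "Neg C X Y f"] by (simp add: arr_Neg Add_Neg)

lemma Neg_Null: "\<lbrakk>X \<in> Ob C; Y \<in> Ob C\<rbrakk> \<Longrightarrow> Neg C X Y (Null C X Y) = Null C X Y"
  using Neg_unique[of "Null C X Y" X Y "Null C X Y"] by (simp add: arr_Null Add_Null)

lemma Add_idem: "\<lbrakk>arr f X Y; Add C f f = f\<rbrakk> \<Longrightarrow> f = Null C X Y"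
  using Add_right_cancel[of f X Y "Null C X Y" f] by (simp add: arr_Null Null_Add arrD)

lemma comp_Add: "\<lbrakk>arr f X Y; arr f' X Y; arr g Y Z\<rbrakk> \<Longrightarrow> g \<cdot> Add C f f' = Add C (g \<cdot> f) (g \<cdot> f')"
  unfolding arr_def using Comp_Add_left by blast

lemma Add_comp: "\<lbrakk>arr f X Y; arr g Y Z; arr g' Y Z\<rbrakk> \<Longrightarrow> Add C g g' \<cdot> f = Add C (g \<cdot> f) (g' \<cdot> f)"
  unfolding arr_def using Comp_Add_right by blast

text \<open>By bilinearity the composite is idempotent for addition, and 0 is the only idempotent of
  a group.\<close>

lemma comp_Null: assumes "arr g Y Z" "X \<in> Ob C" shows "g \<cdot> Null C X Y = Null C X Z"
proof -
  have n: "arr (Null C X Y) X Y" using assms by (simp add: arr_Null arrD)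
  show ?thesis using comp_Add[OF n n assms(1)] Add_Null[OF n]
    by (intro Add_idem[OF arr_Comp[OF n assms(1)]]) simp
qed

lemma Null_comp: assumes "arr f X Y" "Z \<in> Ob C" shows "Null C Y Z \<cdot> f = Null C X Z"
proof -
  have n: "arr (Null C Y Z) Y Z" using assms by (simp add: arr_Null arrD)
  show ?thesis using Add_comp[OF assms(1) n n] Add_Null[OF n]
    by (intro Add_idem[OF arr_Comp[OF assms(1) n]]) simp
qed

lemma comp_Neg: assumes "arr f X Y" "arr g Y Z" shows "g \<cdot> Neg C X Y f = Neg C X Z (g \<cdot> f)"
  by (rule Neg_unique[OF arr_Comp[OF arr_Neg[OF assms(1)] assms(2)] arr_Comp[OF assms]])
    (use comp_Add[OF arr_Neg[OF assms(1)] assms] comp_Null[OF assms(2)] assms in \<open>simp add: Neg_Add arrD\<close>)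

lemma Neg_comp: assumes "arr f X Y" "arr g Y Z" shows "Neg C Y Z g \<cdot> f = Neg C X Z (g \<cdot> f)"
  by (rule Neg_unique[OF arr_Comp[OF assms(1) arr_Neg[OF assms(2)]] arr_Comp[OF assms]])
    (use Add_comp[OF assms(1) arr_Neg[OF assms(2)] assms(2)] Null_comp[OF assms(1)] assms in \<open>simp add: Neg_Add arrD\<close>)

definition diff :: "'o \<Rightarrow> 'o \<Rightarrow> 'm \<Rightarrow> 'm \<Rightarrow> 'm" where
  "diff X Y f g = Add C f (Neg C X Y g)"

lemma arr_diff: "\<lbrakk>arr f X Y; arr g X Y\<rbrakk> \<Longrightarrow> arr (diff X Y f g) X Y"
  by (simp add: diff_def arr_Add arr_Neg)

lemma diff_Add: "\<lbrakk>arr f X Y; arr g X Y\<rbrakk> \<Longrightarrow> Add C (diff X Y f g) g = f"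
  by (simp add: diff_def Add_assoc[OF _ arr_Neg] Neg_Add Add_Null)

lemma diff_eq_Null: "\<lbrakk>arr f X Y; arr g X Y\<rbrakk> \<Longrightarrow> diff X Y f g = Null C X Y \<longleftrightarrow> f = g"
  using Neg_unique[of f X Y "Neg C X Y g"] by (auto simp: diff_def arr_Neg Neg_Neg Add_Neg)

lemma comp_diff: "\<lbrakk>arr f X Y; arr f' X Y; arr g Y Z\<rbrakk> \<Longrightarrow> g \<cdot> diff X Y f f' = diff X Z (g \<cdot> f) (g \<cdot> f')"
  unfolding diff_def by (subst comp_Add[OF _ arr_Neg]) (auto simp: comp_Neg)

lemma diff_comp: "\<lbrakk>arr f X Y; arr g Y Z; arr g' Y Z\<rbrakk> \<Longrightarrow> diff Y Z g g' \<cdot> f = diff X Z (g \<cdot> f) (g' \<cdot> f)"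
  unfolding diff_def by (subst Add_comp[OF _ _ arr_Neg]) (auto simp: Neg_comp)

lemma diff_Null: "arr f X Y \<Longrightarrow> diff X Y f (Null C X Y) = f"
  by (simp add: diff_def Neg_Null arrD Add_Null)

lemma van_iff: "\<lbrakk>X \<in> Ob C; Y \<in> Ob C\<rbrakk> \<Longrightarrow> Hom_vanishes C X Y \<longleftrightarrow> (\<forall>f. arr f X Y \<longrightarrow> f = Null C X Y)"
  unfolding Hom_vanishes_def using arr_Null by (auto simp: arr_def)

lemma vanD: "\<lbrakk>Hom_vanishes C X Y; arr f X Y\<rbrakk> \<Longrightarrow> f = Null C X Y"
  by (auto simp: Hom_vanishes_def arr_def)

lemma is_zero_Ob: "is_zero C Z \<Longrightarrow> Z \<in> Ob C"
  by (simp add: is_zero_def)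

lemma zero_van: assumes "is_zero C Z" "X \<in> Ob C"
  shows "Hom_vanishes C Z X" "Hom_vanishes C X Z"
proof -
  have Z: "Z \<in> Ob C" and u: "\<exists>!f. f \<in> Hom C Z X" "\<exists>!f. f \<in> Hom C X Z"
    using assms by (auto simp: is_zero_def)
  show "Hom_vanishes C Z X" "Hom_vanishes C X Z"
    using u arr_Null[OF Z assms(2)] arr_Null[OF assms(2) Z] unfolding Hom_vanishes_def arr_def by blast+
qed

lemma zero_iff_Id: "Z \<in> Ob C \<Longrightarrow> is_zero C Z \<longleftrightarrow> Id C Z = Null C Z Z"
proof
  assume Z: "Z \<in> Ob C"
  show "Id C Z = Null C Z Z" if "is_zero C Z" using vanD[OF zero_van(1)[OF that Z] arr_Id[OF Z]] .
  assume e: "Id C Z = Null C Z Z"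
  have "f = Null C Z X" if "X \<in> Ob C" "f \<in> Hom C Z X" for f X
    using comp_Id[OF arrI[OF Z that]] comp_Null[OF arrI[OF Z that] Z] e by simp
  moreover have "f = Null C X Z" if "X \<in> Ob C" "f \<in> Hom C X Z" for f X
    using Id_comp[OF arrI[OF that(1) Z that(2)]] Null_comp[OF arrI[OF that(1) Z that(2)] Z] e by simp
  ultimately show "is_zero C Z" unfolding is_zero_def
    using Z arrD(3)[OF arr_Null[OF Z]] arrD(3)[OF arr_Null[OF _ Z]] by blast
qed

lemma zero_if_van: "\<lbrakk>Z \<in> Ob C; Hom_vanishes C Z Z\<rbrakk> \<Longrightarrow> is_zero C Z"
  using zero_iff_Id vanD arr_Id by blast

text \<open>A split monomorphism without a chosen complement. It is easier to produce than a
  decomposition, and in a triangulated category the complement exists automatically.\<close>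

definition retract :: "'o \<Rightarrow> 'o \<Rightarrow> bool" where
  "retract X Y \<longleftrightarrow> (\<exists>s a. arr s X Y \<and> arr a Y X \<and> a \<cdot> s = Id C X)"

lemma retractI: "\<lbrakk>arr s X Y; arr a Y X; a \<cdot> s = Id C X\<rbrakk> \<Longrightarrow> retract X Y"
  by (auto simp: retract_def)

lemma retract_refl: "X \<in> Ob C \<Longrightarrow> retract X X"
  using retractI arr_Id comp_Id by blast

lemma retract_Ob: "retract X Y \<Longrightarrow> X \<in> Ob C" "retract X Y \<Longrightarrow> Y \<in> Ob C"
  by (auto simp: retract_def arr_def)

lemma retract_van1: assumes "retract X Y" "Hom_vanishes C Y W" "W \<in> Ob C" shows "Hom_vanishes C X W"
proof -
  obtain s a where *: "arr s X Y" "arr a Y X" "a \<cdot> s = Id C X" using assms by (auto simp: retract_def)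
  have "f = Null C X W" if f: "arr f X W" for f
  proof -
    have "f \<cdot> a = Null C Y W" using vanD[OF assms(2) arr_Comp[OF *(2) f]] .
    then have "f \<cdot> (a \<cdot> s) = Null C X W" using comp_assoc[OF *(1,2) f] Null_comp[OF *(1) assms(3)] by simp
    then show ?thesis using * comp_Id[OF f] by simp
  qed
  then show ?thesis using van_iff[OF retract_Ob(1)[OF assms(1)] assms(3)] by blast
qed

section \<open>Universal property of coproducts\<close>

lemma coprod_Ob: "is_coproduct C I X S \<iota> \<Longrightarrow> S \<in> Ob C"
  by (simp add: is_coproduct_def)

lemma coprod_inj: "\<lbrakk>is_coproduct C I X S \<iota>; i \<in> I\<rbrakk> \<Longrightarrow> arr (\<iota> i) (X i) S"
  by (simp add: is_coproduct_def arr_def)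

lemma coprod_desc:
  assumes "is_coproduct C I X S \<iota>" "Y \<in> Ob C" "\<And>i. i \<in> I \<Longrightarrow> arr (f i) (X i) Y"
  shows "\<exists>h. arr h S Y \<and> (\<forall>i\<in>I. h \<cdot> \<iota> i = f i)"
proof -
  have "\<forall>i\<in>I. f i \<in> Hom C (X i) Y" using assms(3) by (simp add: arr_def)
  then have "\<exists>h. h \<in> Hom C S Y \<and> (\<forall>i\<in>I. h \<cdot> \<iota> i = f i)"
    using assms(1,2) unfolding is_coproduct_def by blast
  then show ?thesis using arrI[OF coprod_Ob[OF assms(1)] assms(2)] by blast
qed

lemma coprod_eqI:
  assumes c: "is_coproduct C I X S \<iota>" and h: "arr h S Y" "arr k S Y" "\<And>i. i \<in> I \<Longrightarrow> h \<cdot> \<iota> i = k \<cdot> \<iota> i"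
  shows "h = k"
proof -
  have "\<exists>!l. l \<in> Hom C S Y \<and> (\<forall>i\<in>I. l \<cdot> \<iota> i = k \<cdot> \<iota> i)"
  proof -
    have "\<forall>i\<in>I. k \<cdot> \<iota> i \<in> Hom C (X i) Y" using arr_Comp[OF coprod_inj[OF c] h(2)] arrD(3) by blast
    with c arrD(2)[OF h(1)] show ?thesis unfolding is_coproduct_def by (elim conjE) simp
  qed
  moreover have "h \<in> Hom C S Y \<and> (\<forall>i\<in>I. h \<cdot> \<iota> i = k \<cdot> \<iota> i)" using h arrD(3)[OF h(1)] by simp
  moreover have "k \<in> Hom C S Y \<and> (\<forall>i\<in>I. k \<cdot> \<iota> i = k \<cdot> \<iota> i)" using arrD(3)[OF h(2)] by simp
  ultimately show ?thesis by (elim ex1E) metis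
qed

lemma coproductI:
  assumes "S \<in> Ob C" "\<And>i. i \<in> I \<Longrightarrow> arr (\<iota> i) (X i) S"
    "\<And>Y f. \<lbrakk>Y \<in> Ob C; \<And>i. i \<in> I \<Longrightarrow> arr (f i) (X i) Y\<rbrakk> \<Longrightarrow> \<exists>h. arr h S Y \<and> (\<forall>i\<in>I. h \<cdot> \<iota> i = f i)"
    "\<And>Y h k. \<lbrakk>arr h S Y; arr k S Y; \<And>i. i \<in> I \<Longrightarrow> h \<cdot> \<iota> i = k \<cdot> \<iota> i\<rbrakk> \<Longrightarrow> h = k"
  shows "is_coproduct C I X S \<iota>"
  unfolding is_coproduct_def
proof (intro conjI ballI allI impI)
  fix Y f assume Y: "Y \<in> Ob C" "\<forall>i\<in>I. f i \<in> Hom C (X i) Y"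
  then have "\<And>i. i \<in> I \<Longrightarrow> arr (f i) (X i) Y" using assms(2) by (simp add: arr_def)
  then obtain h where h: "arr h S Y" "\<forall>i\<in>I. h \<cdot> \<iota> i = f i" using assms(3)[OF Y(1)] by blast
  show "\<exists>!h. h \<in> Hom C S Y \<and> (\<forall>i\<in>I. h \<cdot> \<iota> i = f i)"
  proof (rule ex1I)
    show "h \<in> Hom C S Y \<and> (\<forall>i\<in>I. h \<cdot> \<iota> i = f i)" using h by (simp add: arr_def)
  next
    fix k assume k: "k \<in> Hom C S Y \<and> (\<forall>i\<in>I. k \<cdot> \<iota> i = f i)"
    then have "arr k S Y" using assms(1) Y(1) by (simp add: arr_def)
    then show "k = h" by (rule assms(4)[OF _ h(1)]) (use k h in auto)
  qed
qed (use assms(1,2) in \<open>auto simp: arr_def\<close>)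

lemma coprod_van:
  assumes c: "is_coproduct C I X S \<iota>" and W: "W \<in> Ob C" "\<And>i. i \<in> I \<Longrightarrow> Hom_vanishes C (X i) W"
  shows "Hom_vanishes C S W"
proof -
  have S: "S \<in> Ob C" using coprod_Ob[OF c] .
  have "f = Null C S W" if f: "arr f S W" for f
  proof (rule coprod_eqI[OF c f arr_Null[OF S W(1)]])
    fix i assume i: "i \<in> I"
    show "f \<cdot> \<iota> i = Null C S W \<cdot> \<iota> i"
      using vanD[OF W(2)[OF i] arr_Comp[OF coprod_inj[OF c i] f]] Null_comp[OF coprod_inj[OF c i] W(1)] by simp
  qed
  then show ?thesis using van_iff[OF S W(1)] by blast
qed

lemma coprod_reindex:
  assumes c: "is_coproduct C I X S \<iota>" and b: "bij_betw b J I"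
  shows "is_coproduct C J (\<lambda>j. X (b j)) S (\<lambda>j. \<iota> (b j))"
proof (rule coproductI)
  have bJ: "\<And>j. j \<in> J \<Longrightarrow> b j \<in> I" using b by (auto simp: bij_betw_def)
  define b' where "b' = inv_into J b"
  have b': "\<And>i. i \<in> I \<Longrightarrow> b' i \<in> J \<and> b (b' i) = i" "\<And>j. j \<in> J \<Longrightarrow> b' (b j) = j"
    using b by (auto simp: bij_betw_def b'_def f_inv_into_f inv_into_into)
  show "S \<in> Ob C" using coprod_Ob[OF c] .
  show "arr (\<iota> (b i)) (X (b i)) S" if "i \<in> J" for i using coprod_inj[OF c bJ[OF that]] .
  show "\<exists>h. arr h S Y \<and> (\<forall>i\<in>J. h \<cdot> \<iota> (b i) = f i)"
    if Y: "Y \<in> Ob C" and f: "\<And>i. i \<in> J \<Longrightarrow> arr (f i) (X (b i)) Y" for Y f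
  proof -
    have "\<And>i. i \<in> I \<Longrightarrow> arr (f (b' i)) (X i) Y" using f b'(1) by metis
    then obtain h where "arr h S Y" "\<And>i. i \<in> I \<Longrightarrow> h \<cdot> \<iota> i = f (b' i)"
      using coprod_desc[OF c Y, of "\<lambda>i. f (b' i)"] by blast
    then show ?thesis using bJ b' by (intro exI[of _ h]) auto
  qed
  show "h = k" if "arr h S Y" "arr k S Y" "\<And>i. i \<in> J \<Longrightarrow> h \<cdot> \<iota> (b i) = k \<cdot> \<iota> (b i)" for h k Y
  proof (rule coprod_eqI[OF c that(1,2)])
    show "h \<cdot> \<iota> i = k \<cdot> \<iota> i" if "i \<in> I" for i
      using \<open>\<And>i. i \<in> J \<Longrightarrow> h \<cdot> \<iota> (b i) = k \<cdot> \<iota> (b i)\<close>[of "b' i"] b'(1)[OF that] by simp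
  qed
qed

lemma direct_summand_retract: assumes "direct_summand C P S" shows "retract P S"
proof -
  obtain Q \<iota> where c: "is_coproduct C (UNIV :: bool set) (\<lambda>b. if b then P else Q) S \<iota>"
    using assms by (auto simp: direct_summand_def is_direct_sum_def)
  have P: "P \<in> Ob C" and Q: "Q \<in> Ob C"
    using arrD(1)[OF coprod_inj[OF c, of True]] arrD(1)[OF coprod_inj[OF c, of False]] by auto
  have "\<And>b. arr (if b then Id C P else Null C Q P) (if b then P else Q) P"
    using arr_Id[OF P] arr_Null[OF Q P] by simp
  from coprod_desc[OF c P this] obtain h where "arr h S P" "h \<cdot> \<iota> True = Id C P" by auto
  then show ?thesis using coprod_inj[OF c, of True] by (intro retractI[of "\<iota> True" _ _ h]) auto
qed

end

section \<open>Triangles\<close>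

context triangulated_category
begin

abbreviation van :: "'o \<Rightarrow> 'o \<Rightarrow> bool" where "van \<equiv> Hom_vanishes T"

lemma Tri_arr:
  assumes "Tri T X Y Z f g h"
  shows "arr f X Y" "arr g Y Z" "arr h Z (Sh T 1 X)"
  using Tri_arrows[OF assms] by (simp_all add: arr_def Sh_Ob)

lemma Tri_Ob: assumes "Tri T X Y Z f g h" shows "X \<in> Ob T" "Y \<in> Ob T" "Z \<in> Ob T"
  using Tri_arrows[OF assms] by simp_all

lemma arr_ShM: "arr f X Y \<Longrightarrow> arr (ShM T i f) (Sh T i X) (Sh T i Y)"
  by (simp add: arr_def Sh_Ob ShM_Hom)

lemma Sh_inverse: "X \<in> Ob T \<Longrightarrow> Sh T i (Sh T (-i) X) = X" "X \<in> Ob T \<Longrightarrow> Sh T (-i) (Sh T i X) = X"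
  by (simp_all add: Sh_Sh Sh_zero)

lemma ShM_inverse: assumes "arr f X Y" shows "ShM T i (ShM T (-i) f) = f" "ShM T (-i) (ShM T i f) = f"
  using ShM_ShM[OF arrD[OF assms]] ShM_zero[OF arrD[OF assms]] by simp_all

lemma ShM_eq_iff: assumes "arr f X Y" "arr g X' Y'" shows "ShM T i f = ShM T i g \<longleftrightarrow> f = g"
  using ShM_inverse(2)[OF assms(1), of i] ShM_inverse(2)[OF assms(2), of i] by metis

lemma ShM_comp: "\<lbrakk>arr f X Y; arr g Y Z\<rbrakk> \<Longrightarrow> ShM T i (g \<cdot> f) = ShM T i g \<cdot> ShM T i f"
  unfolding arr_def using ShM_Comp by blast

lemma ShM_add: "\<lbrakk>arr f X Y; arr g X Y\<rbrakk> \<Longrightarrow> ShM T i (Add T f g) = Add T (ShM T i f) (ShM T i g)"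
  unfolding arr_def using ShM_Add by blast

lemma ShM_Null: assumes "X \<in> Ob T" "Y \<in> Ob T"
  shows "ShM T i (Null T X Y) = Null T (Sh T i X) (Sh T i Y)"
proof -
  have n: "arr (Null T X Y) X Y" using arr_Null[OF assms] .
  show ?thesis using ShM_add[OF n n, of i] Add_Null[OF n] by (intro Add_idem[OF arr_ShM[OF n]]) simp
qed

lemma ShM_Neg: assumes "arr f X Y"
  shows "ShM T i (Neg T X Y f) = Neg T (Sh T i X) (Sh T i Y) (ShM T i f)"
  by (rule Neg_unique[OF arr_ShM[OF arr_Neg[OF assms]] arr_ShM[OF assms]])
    (use ShM_add[OF arr_Neg[OF assms] assms, of i] in \<open>simp add: Neg_Add[OF assms] ShM_Null arrD[OF assms]\<close>)

lemma van_Sh: assumes "X \<in> Ob T" "Y \<in> Ob T" shows "van (Sh T i X) (Sh T i Y) \<longleftrightarrow> van X Y"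
proof -
  have *: "van (Sh T i X) (Sh T i Y)" if "X \<in> Ob T" "Y \<in> Ob T" "van X Y" for X Y i
  proof -
    have "f = Null T (Sh T i X) (Sh T i Y)" if f: "arr f (Sh T i X) (Sh T i Y)" for f
    proof -
      have "arr (ShM T (-i) f) X Y" using arr_ShM[OF f, of "-i"] by (simp add: Sh_inverse that \<open>X \<in> Ob T\<close> \<open>Y \<in> Ob T\<close>)
      then have "ShM T (-i) f = Null T X Y" using vanD \<open>van X Y\<close> by blast
      then show ?thesis using ShM_inverse(1)[OF f, of i] ShM_Null[OF \<open>X \<in> Ob T\<close> \<open>Y \<in> Ob T\<close>] by simp
    qed
    then show ?thesis using van_iff[OF Sh_Ob[OF \<open>X \<in> Ob T\<close>] Sh_Ob[OF \<open>Y \<in> Ob T\<close>]] by blast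
  qed
  show ?thesis using *[OF assms, of i] *[OF Sh_Ob[OF assms(1)] Sh_Ob[OF assms(2)], of i i "-i"]
    by (auto simp: Sh_inverse assms)
qed

lemma van_Sh_left: assumes "X \<in> Ob T" "Y \<in> Ob T" shows "van (Sh T i X) Y \<longleftrightarrow> van X (Sh T (-i) Y)"
  using van_Sh[OF assms(1) Sh_Ob[OF assms(2)], of i "-i"] by (simp add: Sh_inverse assms)

lemma zero_Sh: assumes "X \<in> Ob T" shows "is_zero T (Sh T i X) \<longleftrightarrow> is_zero T X"
  using van_Sh[OF assms assms, of i] zero_if_van[OF assms] zero_if_van[OF Sh_Ob[OF assms]]
    zero_van(1)[OF _ assms] zero_van(1)[OF _ Sh_Ob[OF assms]] by blast

lemma Tri_rot: assumes "Tri T X Y Z f g h"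
  shows "Tri T Y Z (Sh T 1 X) g h (Neg T (Sh T 1 X) (Sh T 1 Y) (ShM T 1 f))"
  using TR2[of X Y Z f g h] Tri_arrows[OF assms] assms by simp

lemma Tri_rot_back: assumes "Tri T X Y Z f g h"
  shows "Tri T (Sh T (-1) Z) X Y (Neg T (Sh T (-1) Z) X (ShM T (-1) h)) f g"
proof -
  note ob = Tri_Ob[OF assms] and ar = Tri_arr[OF assms]
  have h': "arr (ShM T (-1) h) (Sh T (-1) Z) X" using arr_ShM[OF ar(3), of "-1"] by (simp add: Sh_Sh Sh_zero ob)
  have s: "Sh T 1 (Sh T (-1) Z) = Z" by (simp add: Sh_Sh Sh_zero ob)
  have "Neg T Z (Sh T 1 X) (ShM T 1 (Neg T (Sh T (-1) Z) X (ShM T (-1) h))) = h"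
    by (simp add: ShM_Neg[OF h'] s ShM_inverse(1)[OF ar(3)] Neg_Neg[OF ar(3)])
  then show ?thesis using TR2[of "Sh T (-1) Z" X Y "Neg T (Sh T (-1) Z) X (ShM T (-1) h)" f g]
      assms arr_Neg[OF h'] ar s by (simp add: arr_def)
qed

text \<open>\<open>TR3\<close>, applied to the map out of the triangle on \<open>Id T X\<close> with
  components \<open>Id T X\<close> and \<open>f\<close>, factors \<open>g \<cdot> f\<close> through
  a zero object.\<close>

lemma Tri_comp: assumes "Tri T X Y Z f g h" shows "g \<cdot> f = Null T X Z" 
proof -
  obtain N where N: "is_zero T N" using ex_zero by blast
  note ob = Tri_Ob[OF assms] and ar = Tri_arr[OF assms]
  obtain \<gamma> where "\<gamma> \<in> Hom T N Z" "\<gamma> \<cdot> Null T X N = g \<cdot> f"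
    using TR3[OF TR1_Id[OF ob(1) N] assms, of "Id T X" f] arrD(3)[OF ar(1)] arrD(3)[OF arr_Id[OF ob(1)]] by auto
  moreover have "arr \<gamma> N Z" using calculation ob is_zero_Ob[OF N] by (simp add: arr_def)
  ultimately show ?thesis using comp_Null ob(1) by metis
qed

lemma Tri_comp2: assumes "Tri T X Y Z f g h" shows "h \<cdot> g = Null T Y (Sh T 1 X)" 
  using Tri_comp[OF Tri_rot[OF assms]] .

lemma Tri_comp3: assumes "Tri T X Y Z f g h" shows "ShM T 1 f \<cdot> h = Null T Z (Sh T 1 Y)"
proof -
  note ob = Tri_Ob[OF assms] and h = Tri_arr(3)[OF assms] and f1 = arr_ShM[OF Tri_arr(1)[OF assms], of 1]
  have "Neg T (Sh T 1 X) (Sh T 1 Y) (ShM T 1 f) \<cdot> h = Null T Z (Sh T 1 Y)"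
    using Tri_comp[OF Tri_rot[OF Tri_rot[OF assms]]] .
  then show ?thesis
    using Neg_comp[OF h f1] Neg_Neg[OF arr_Comp[OF h f1]] Neg_Null[OF ob(3) Sh_Ob[OF ob(2)]] by metis
qed

text \<open>Exactness of Hom(W, -) at Y. \<open>TR3\<close> produces the third component of a map of
  triangles, so W -> 0 -> W[1] is mapped to the rotated triangle Y -> Z -> X[1], and the resulting
  arrow W[1] -> X[1] is shifted back. The two signs cancel.\<close>

lemma Tri_lift: assumes t: "Tri T X Y Z f g h" and p: "arr p W Y" "g \<cdot> p = Null T W Z"
  shows "\<exists>q. arr q W X \<and> f \<cdot> q = p"
proof -
  obtain N where N: "is_zero T N" using ex_zero by blast
  note ob = Tri_Ob[OF t] and ar = Tri_arr[OF t] and Oo = is_zero_Ob[OF N] and W = arrD(1)[OF p(1)]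
  let ?W = "Sh T 1 W"
  have 1: "Tri T W N ?W (Null T W N) (Null T N ?W) (Neg T ?W ?W (ShM T 1 (Id T W)))"
    using Tri_rot[OF TR1_Id[OF W N]] .
  have n: "arr (Null T N Z) N Z" using arr_Null[OF Oo ob(3)] .
  have "Null T N Z \<cdot> Null T W N = g \<cdot> p" using Null_comp[OF arr_Null[OF W Oo] ob(3)] p(2) by simp
  then obtain \<gamma> where \<gamma>: "\<gamma> \<in> Hom T ?W (Sh T 1 X)"
    "ShM T 1 p \<cdot> Neg T ?W ?W (ShM T 1 (Id T W)) = Neg T (Sh T 1 X) (Sh T 1 Y) (ShM T 1 f) \<cdot> \<gamma>"
    using TR3[OF 1 Tri_rot[OF t] arrD(3)[OF p(1)] arrD(3)[OF n]] by blast
  have \<gamma>a: "arr \<gamma> ?W (Sh T 1 X)" using \<gamma>(1) W ob by (simp add: arr_def Sh_Ob)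
  have p1: "arr (ShM T 1 p) ?W (Sh T 1 Y)" and f1: "arr (ShM T 1 f) (Sh T 1 X) (Sh T 1 Y)"
    using arr_ShM p(1) ar(1) by blast+
  have "Neg T ?W (Sh T 1 Y) (ShM T 1 p) = Neg T ?W (Sh T 1 Y) (ShM T 1 f \<cdot> \<gamma>)"
    using \<gamma>(2) comp_Neg[OF arr_Id[OF Sh_Ob[OF W]] p1] Neg_comp[OF \<gamma>a f1] comp_Id[OF p1] by (simp add: ShM_Id W)
  then have e: "ShM T 1 p = ShM T 1 f \<cdot> \<gamma>" using Neg_Neg[OF p1] Neg_Neg[OF arr_Comp[OF \<gamma>a f1]] by metis
  define q where "q = ShM T (-1) \<gamma>"
  have q: "arr q W X" using arr_ShM[OF \<gamma>a, of "-1"] by (simp add: q_def Sh_Sh Sh_zero W ob)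
  have "ShM T 1 q = \<gamma>" using ShM_inverse(1)[OF \<gamma>a, of 1] by (simp add: q_def)
  then have "ShM T 1 (f \<cdot> q) = ShM T 1 p" using e ShM_comp[OF q ar(1), of 1] by simp
  then show ?thesis using ShM_eq_iff[OF arr_Comp[OF q ar(1)] p(1)] q by blast
qed

text \<open>Dually, \<open>p\<close> extends to a map into the triangle 0 -> W -> W, and its third
  component is already the required arrow out of \<open>Z\<close>.\<close>

lemma Tri_desc: assumes t: "Tri T X Y Z f g h" and p: "arr p Y W" "p \<cdot> f = Null T X W"
  shows "\<exists>q. arr q Z W \<and> q \<cdot> g = p"
proof -
  obtain N where N: "is_zero T N" using ex_zero by blast
  note ob = Tri_Ob[OF t] and ar = Tri_arr[OF t] and Oo = is_zero_Ob[OF N] and W = arrD(2)[OF p(1)]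
  have O1: "is_zero T (Sh T 1 N)" using N zero_Sh[OF Oo] by blast
  have n: "arr (Null T N W) N W" "arr (Null T W (Sh T 1 N)) W (Sh T 1 N)"
    using arr_Null[OF Oo W] arr_Null[OF W Sh_Ob[OF Oo]] by auto
  have "Neg T (Sh T 1 N) (Sh T 1 W) (ShM T 1 (Null T N W)) = Null T (Sh T 1 N) (Sh T 1 W)"
    using Neg_Null[OF Sh_Ob[OF Oo] Sh_Ob[OF W]] ShM_Null[OF Oo W] by simp
  then have 1: "Tri T N W W (Null T N W) (Id T W) (Null T W (Sh T 1 N))"
    using TR2[OF Oo W W arrD(3)[OF n(1)] arrD(3)[OF arr_Id[OF W]] arrD(3)[OF n(2)]] TR1_Id[OF W O1] by simp
  have m: "arr (Null T X N) X N" using arr_Null[OF ob(1) Oo] .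
  have "p \<cdot> f = Null T N W \<cdot> Null T X N" using Null_comp[OF m W] p(2) by simp
  then obtain q where q: "q \<in> Hom T Z W" "q \<cdot> g = Id T W \<cdot> p"
    using TR3[OF t 1 arrD(3)[OF m] arrD(3)[OF p(1)]] by blast
  then show ?thesis using Id_comp[OF p(1)] ob W by (auto simp: arr_def)
qed

lemma Tri_lift2: "\<lbrakk>Tri T X Y Z f g h; arr p W Z; h \<cdot> p = Null T W (Sh T 1 X)\<rbrakk> \<Longrightarrow> \<exists>q. arr q W Y \<and> g \<cdot> q = p"
  using Tri_lift[OF Tri_rot] by blast

lemma Tri_van_mid: assumes t: "Tri T X Y Z f g h" and W: "van W X" "van W Z" "W \<in> Ob T" shows "van W Y"
proof -
  note ob = Tri_Ob[OF t] and ar = Tri_arr[OF t]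
  have "p = Null T W Y" if p: "arr p W Y" for p
  proof -
    obtain q where q: "arr q W X" "f \<cdot> q = p" using Tri_lift[OF t p vanD[OF W(2) arr_Comp[OF p ar(2)]]] by blast
    then show ?thesis using vanD[OF W(1) q(1)] comp_Null[OF ar(1) W(3)] by simp
  qed
  then show ?thesis using van_iff[OF W(3) ob(2)] by blast
qed

lemma Tri_van_right: assumes "Tri T X Y Z f g h" "van W Y" "van W (Sh T 1 X)" "W \<in> Ob T" shows "van W Z"
  using Tri_van_mid[OF Tri_rot[OF assms(1)]] assms by blast

lemma Tri_nav_mid: assumes t: "Tri T X Y Z f g h" and W: "van X W" "van Z W" "W \<in> Ob T" shows "van Y W"
proof -
  note ob = Tri_Ob[OF t] and ar = Tri_arr[OF t]
  have "p = Null T Y W" if p: "arr p Y W" for p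
  proof -
    obtain q where q: "arr q Z W" "q \<cdot> g = p" using Tri_desc[OF t p vanD[OF W(1) arr_Comp[OF ar(1) p]]] by blast
    then show ?thesis using vanD[OF W(2) q(1)] Null_comp[OF ar(2) W(3)] by simp
  qed
  then show ?thesis using van_iff[OF ob(2) W(3)] by blast
qed

lemma Tri_nav_right: assumes "Tri T X Y Z f g h" "van Y W" "van (Sh T 1 X) W" "W \<in> Ob T" shows "van Z W"
  using Tri_nav_mid[OF Tri_rot[OF assms(1)]] assms by blast

text \<open>The signs that rotation introduces are irrelevant here: only the objects matter.\<close>

lemma Tri_Sh: assumes "Tri T X Y Z f g h" shows "\<exists>f' g' h'. Tri T (Sh T i X) (Sh T i Y) (Sh T i Z) f' g' h'"
proof (induction i rule: int_induct[where k=0])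
  case base
  then show ?case using assms Tri_Ob[OF assms] by (auto simp: Sh_zero)
next
  case (step1 i)
  then obtain f' g' h' where "Tri T (Sh T i X) (Sh T i Y) (Sh T i Z) f' g' h'" by blast
  from Tri_rot[OF Tri_rot[OF Tri_rot[OF this]]] show ?case
    using Tri_Ob[OF assms] by (auto simp: Sh_Sh add.commute)
next
  case (step2 i)
  then obtain f' g' h' where "Tri T (Sh T i X) (Sh T i Y) (Sh T i Z) f' g' h'" by blast
  from Tri_rot_back[OF Tri_rot_back[OF Tri_rot_back[OF this]]] show ?case
    using Tri_Ob[OF assms] by (auto simp: Sh_Sh)
qed

section \<open>Splittings, shifted coproducts and cancellation\<close>

lemma ex_cocone: assumes "arr g Y Z" shows "\<exists>X f h. Tri T X Y Z f g h"
proof -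
  obtain W u v where "Tri T Y Z W g u v" using TR1_cone[OF arrD[OF assms]] by blast
  from Tri_rot_back[OF this] show ?thesis by blast
qed

lemma ex_cone: assumes "arr f X Y" shows "\<exists>Z g h. Tri T X Y Z f g h"
  using TR1_cone[OF arrD[OF assms]] by blast

text \<open>The section \<open>s\<close> of \<open>a\<close> kills the connecting arrow,
  \<open>b\<close> = \<open>(b \<cdot> a) \<cdot> s\<close> = 0, so the cocone \<open>Q\<close> of
  \<open>a\<close> is a complement of \<open>X\<close>.\<close>

lemma retract_direct_summand: assumes "retract X Y" shows "direct_summand T X Y"
proof -
  obtain s a where s: "arr s X Y" and a: "arr a Y X" and as: "a \<cdot> s = Id T X"
    using assms by (auto simp: retract_def)
  obtain Q q b where t: "Tri T Q Y X q a b" using ex_cocone[OF a] by blast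
  note ob = Tri_Ob[OF t] and q = Tri_arr(1)[OF t] and b = Tri_arr(3)[OF t]
  have "b = (b \<cdot> a) \<cdot> s" using comp_assoc[OF s a b] as comp_Id[OF b] by simp
  then have b0: "b = Null T X (Sh T 1 Q)" using Tri_comp2[OF t] Null_comp[OF s Sh_Ob[OF ob(1)]] by simp
  have aq: "a \<cdot> q = Null T Q X" using Tri_comp[OF t] .
  let ?\<iota> = "\<lambda>c :: bool. if c then s else q"
  have "is_coproduct T UNIV (\<lambda>c. if c then X else Q) Y ?\<iota>"
  proof (rule coproductI)
    show "Y \<in> Ob T" using ob(2) .
    show "arr (?\<iota> c) (if c then X else Q) Y" for c using s q by simp
  next
    fix W f assume W: "W \<in> Ob T" and f: "\<And>c. c \<in> UNIV \<Longrightarrow> arr (f c) (if c then X else Q) W"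
    have f1: "arr (f True) X W" and f2: "arr (f False) Q W" using f[of True] f[of False] by auto
    note tb = Tri_rot_back[OF t]
    have "Neg T (Sh T (-1) X) Q (ShM T (-1) b) = Null T (Sh T (-1) X) Q"
      using ob b0 by (simp add: ShM_Null Sh_Ob Sh_Sh Sh_zero Neg_Null)
    then obtain h0 where h0: "arr h0 Y W" "h0 \<cdot> q = f False"
      using Tri_desc[OF tb f2] comp_Null[OF f2 Sh_Ob[OF ob(3)]] by auto
    \<comment> \<open>\<open>h0\<close> has the right restriction to \<open>Q\<close>. Adding
      \<open>d \<cdot> a\<close> corrects it on \<open>X\<close> without changing it on
      \<open>Q\<close>, since \<open>a \<cdot> q\<close> = 0.\<close>
    define d where "d = diff X W (f True) (h0 \<cdot> s)"
    have h0s: "arr (h0 \<cdot> s) X W" and d: "arr d X W" using arr_Comp[OF s h0(1)] arr_diff[OF f1] by (auto simp: d_def)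
    define h where "h = Add T (d \<cdot> a) h0"
    have da: "arr (d \<cdot> a) Y W" using arr_Comp[OF a d] .
    have h: "arr h Y W" using arr_Add[OF da h0(1)] by (simp add: h_def)
    have "h \<cdot> s = Add T d (h0 \<cdot> s)"
      using Add_comp[OF s da h0(1)] comp_assoc[OF s a d] as comp_Id[OF d] by (simp add: h_def)
    then have 1: "h \<cdot> s = f True" using diff_Add[OF f1 h0s] by (simp add: d_def)
    have "h \<cdot> q = Add T (Null T Q W) (f False)"
      using Add_comp[OF q da h0(1)] comp_assoc[OF q a d] aq comp_Null[OF d ob(1)] h0 by (simp add: h_def)
    then have "h \<cdot> q = f False" using Null_Add[OF f2] by simp
    with 1 h show "\<exists>h. arr h Y W \<and> (\<forall>c\<in>UNIV. h \<cdot> ?\<iota> c = f c)" by (intro exI[of _ h]) auto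
  next
    fix W h k assume h: "arr h Y W" and k: "arr k Y W" and e: "\<And>c. c \<in> UNIV \<Longrightarrow> h \<cdot> ?\<iota> c = k \<cdot> ?\<iota> c"
    have W: "W \<in> Ob T" using arrD(2)[OF h] .
    let ?d = "diff Y W h k"
    have d: "arr ?d Y W" using arr_diff[OF h k] .
    have ds: "?d \<cdot> s = Null T X W" and dq: "?d \<cdot> q = Null T Q W"
      using diff_comp[OF s h k] diff_comp[OF q h k] e[of True] e[of False]
        diff_eq_Null[OF arr_Comp[OF s h] arr_Comp[OF s k]] diff_eq_Null[OF arr_Comp[OF q h] arr_Comp[OF q k]] by auto
    obtain r where r: "arr r X W" "r \<cdot> a = ?d" using Tri_desc[OF t d dq] by blast
    have "r = ?d \<cdot> s" using comp_assoc[OF s a r(1)] r as comp_Id[OF r(1)] by simp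
    then have "?d = Null T Y W" using ds r Null_comp[OF a W] by simp
    then show "h = k" using diff_eq_Null[OF h k] by simp
  qed
  then show ?thesis unfolding direct_summand_def is_direct_sum_def by blast
qed

lemma direct_summand_iff: "direct_summand T X Y \<longleftrightarrow> retract X Y"
  using retract_direct_summand direct_summand_retract by blast

lemma Sh_coprod: assumes c: "is_coproduct T I X S \<iota>"
  shows "is_coproduct T I (\<lambda>i. Sh T n (X i)) (Sh T n S) (\<lambda>i. ShM T n (\<iota> i))"
proof (rule coproductI)
  have S: "S \<in> Ob T" using coprod_Ob[OF c] .
  have X: "X i \<in> Ob T" if "i \<in> I" for i using arrD(1)[OF coprod_inj[OF c that]] .
  show "Sh T n S \<in> Ob T" using Sh_Ob[OF S] .
  show "arr (ShM T n (\<iota> i)) (Sh T n (X i)) (Sh T n S)" if "i \<in> I" for i using arr_ShM[OF coprod_inj[OF c that]] .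
  show "\<exists>h. arr h (Sh T n S) Y \<and> (\<forall>i\<in>I. h \<cdot> ShM T n (\<iota> i) = f i)"
    if Y: "Y \<in> Ob T" and f: "\<And>i. i \<in> I \<Longrightarrow> arr (f i) (Sh T n (X i)) Y" for Y f
  proof -
    have g: "arr (ShM T (-n) (f i)) (X i) (Sh T (-n) Y)" if "i \<in> I" for i
      using arr_ShM[OF f[OF that], of "-n"] by (simp add: Sh_inverse X that)
    obtain h where h: "arr h S (Sh T (-n) Y)" "\<forall>i\<in>I. h \<cdot> \<iota> i = ShM T (-n) (f i)"
      using coprod_desc[OF c Sh_Ob[OF Y] g] by blast
    have "ShM T n h \<cdot> ShM T n (\<iota> i) = f i" if "i \<in> I" for i
      using ShM_comp[OF coprod_inj[OF c that] h(1), of n] h(2) that ShM_inverse(1)[OF f[OF that], of n] by simp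
    moreover have "arr (ShM T n h) (Sh T n S) Y" using arr_ShM[OF h(1), of n] by (simp add: Sh_inverse Y)
    ultimately show ?thesis by blast
  qed
  show "h = k" if h: "arr h (Sh T n S) Y" and k: "arr k (Sh T n S) Y"
    and e: "\<And>i. i \<in> I \<Longrightarrow> h \<cdot> ShM T n (\<iota> i) = k \<cdot> ShM T n (\<iota> i)" for h k Y
  proof -
    have h': "arr (ShM T (-n) h) S (Sh T (-n) Y)" and k': "arr (ShM T (-n) k) S (Sh T (-n) Y)"
      using arr_ShM[OF h, of "-n"] arr_ShM[OF k, of "-n"] by (simp_all add: Sh_inverse S)
    have "ShM T (-n) h = ShM T (-n) k"
    proof (rule coprod_eqI[OF c h' k'])
      fix i assume i: "i \<in> I"
      note \<iota> = coprod_inj[OF c i] and \<iota>n = arr_ShM[OF coprod_inj[OF c i], of n]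
      show "ShM T (-n) h \<cdot> \<iota> i = ShM T (-n) k \<cdot> \<iota> i"
        using ShM_comp[OF \<iota>n h, of "-n"] ShM_comp[OF \<iota>n k, of "-n"] e[OF i] ShM_inverse(2)[OF \<iota>, of n] by simp
    qed
    then show ?thesis using ShM_eq_iff[OF h k] by blast
  qed
qed

lemma Tri_eq_left:
  assumes t: "Tri T X Y Z f g h" and p: "arr p W X" "arr q W X" "f \<cdot> p = f \<cdot> q" and v: "van W (Sh T (-1) Z)"
  shows "p = q"
proof -
  note ar = Tri_arr[OF t] and tb = Tri_rot_back[OF t] and d = arr_diff[OF p(1,2)]
  have "f \<cdot> diff W X p q = Null T W Y"
    using comp_diff[OF p(1,2) ar(1)] p(3) diff_eq_Null[OF arr_Comp[OF p(2) ar(1)] arr_Comp[OF p(2) ar(1)]] by simp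
  then obtain r where "arr r W (Sh T (-1) Z)" "Neg T (Sh T (-1) Z) X (ShM T (-1) h) \<cdot> r = diff W X p q"
    using Tri_lift[OF tb d] by blast
  then have "diff W X p q = Null T W X" using vanD[OF v] comp_Null[OF Tri_arr(1)[OF tb] arrD(1)[OF p(1)]] by metis
  then show ?thesis using diff_eq_Null[OF p(1,2)] by simp
qed

lemma Tri_eq_right:
  assumes t: "Tri T X Y Z f g h" and p: "arr p Y W" "arr q Y W" "p \<cdot> f = q \<cdot> f" and v: "van Z W"
  shows "p = q"
proof -
  note ar = Tri_arr[OF t] and d = arr_diff[OF p(1,2)]
  have "diff Y W p q \<cdot> f = Null T X W"
    using diff_comp[OF ar(1) p(1,2)] p(3) diff_eq_Null[OF arr_Comp[OF ar(1) p(2)] arr_Comp[OF ar(1) p(2)]] by simp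
  then obtain r where "arr r Z W" "r \<cdot> g = diff Y W p q" using Tri_desc[OF t d] by blast
  then have "diff Y W p q = Null T Y W" using vanD[OF v] Null_comp[OF ar(2) arrD(2)[OF p(1)]] by metis
  then show ?thesis using diff_eq_Null[OF p(1,2)] by simp
qed

lemma Tri_zero_left: assumes N: "is_zero T N" and W: "W \<in> Ob T"
  shows "\<exists>h. Tri T N W W (Null T N W) (Id T W) h"
proof -
  note No = is_zero_Ob[OF N]
  have N1: "is_zero T (Sh T 1 N)" using N zero_Sh[OF No] by blast
  note t = Tri_rot_back[OF TR1_Id[OF W N1]]
  have "Sh T (-1) (Sh T 1 N) = N" by (rule Sh_inverse(2)[OF No])
  then show ?thesis using t vanD[OF zero_van(1)[OF N W] ] Tri_arr(1)[OF t] by metis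
qed

end

section \<open>Compact objects and coproducts\<close>

context compactly_generated_tricat
begin

lemma finite_small: fixes A :: "'a set" assumes "finite A" shows "|A| <o \<kappa>"
proof (rule finite_ordLess_infinite[OF card_of_Well_order])
  show "Well_order \<kappa>" "infinite (Field \<kappa>)"
    using universe by (auto simp: universe_card_def cinfinite_def card_order_on_def)
qed (simp add: Field_card_of assms)

lemma nat_small: "|UNIV :: nat set| <o \<kappa>"
  using universe card_of_nat ordIso_ordLess_trans unfolding universe_card_def by blast

lemma small_coproduct:
  fixes J :: "'j set"
  assumes "|J| <o \<kappa>" "\<And>j. j \<in> J \<Longrightarrow> X j \<in> Ob T"
  shows "\<exists>S \<iota>. is_coproduct T J X S \<iota>"
proof -
  obtain I :: "'u set" and b where I: "|I| <o \<kappa>" and b: "bij_betw b J I" using small_copy[OF assms(1)] by blast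
  let ?X = "\<lambda>i. X (inv_into J b i)"
  have "?X ` I \<subseteq> Ob T" using b assms(2) by (auto simp: bij_betw_def inv_into_into)
  then obtain S \<iota> where "is_coproduct T I ?X S \<iota>"
    using coproducts I unfolding has_coproducts_def by blast
  from coprod_reindex[OF this b] have "is_coproduct T J (\<lambda>j. ?X (b j)) S (\<lambda>j. \<iota> (b j))" .
  moreover have "?X (b j) = X j" if "j \<in> J" for j using b that by (simp add: bij_betw_def)
  ultimately show ?thesis using is_coproduct_cong[of J "\<lambda>j. ?X (b j)" X] by blast
qed

text \<open>Surjectivity of the canonical map writes \<open>p\<close> as a finite sum of arrows
  through the injections; \<open>P\<close> is then carried along an induction over the
  support.\<close>

lemma compact_induct_small:
  fixes I :: "'u set"
  assumes C: "compact_object \<kappa> T C" and c: "is_coproduct T I X S \<iota>" and I: "|I| <o \<kappa>" and p: "arr p C S"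
    and N: "P (Null T C S)" and S: "\<And>i q. \<lbrakk>i \<in> I; arr q C (X i)\<rbrakk> \<Longrightarrow> P (\<iota> i \<cdot> q)"
    and A: "\<And>f g. \<lbrakk>arr f C S; arr g C S; P f; P g\<rbrakk> \<Longrightarrow> P (Add T f g)"
  shows "P p"
proof -
  let ?G = "hom_group T C S"
  have Co: "C \<in> Ob T" and So: "S \<in> Ob T" using C coprod_Ob[OF c] by (auto simp: compact_object_def)
  interpret G: comm_group ?G using comm_group_Hom[OF Co So] .
  have G_simps: "\<one>\<^bsub>?G\<^esub> = Null T C S" "monoid.mult ?G = Add T" by (simp_all add: hom_group_def)
  let ?F = "\<lambda>q. finprod ?G (\<lambda>i. \<iota> i \<cdot> q i) {i \<in> I. q i \<noteq> Null T C (X i)}"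
  have "?F \<in> iso (sum_group I (\<lambda>i. hom_group T C (X i))) ?G"
    using C c I unfolding compact_object_def by blast
  then have "bij_betw ?F (carrier (sum_group I (\<lambda>i. hom_group T C (X i)))) (Hom T C S)"
    by (simp add: iso_def hom_group_def)
  moreover have "p \<in> Hom T C S" using arrD(3)[OF p] .
  ultimately obtain q where q: "q \<in> carrier (sum_group I (\<lambda>i. hom_group T C (X i)))" "p = ?F q"
    by (auto simp: bij_betw_def)
  have gr: "group (hom_group T C (X i))" if "i \<in> I" for i
    using comm_group_Hom[OF Co arrD(1)[OF coprod_inj[OF c that]]] by (simp add: comm_group_def)
  have qi: "arr (q i) C (X i)" if "i \<in> I" for i
    using q(1) that carrier_sum_group[of I "\<lambda>i. hom_group T C (X i)"] gr Co arrD(1)[OF coprod_inj[OF c that]]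
    by (auto simp: arr_def hom_group_def PiE_iff)
  have fin: "finite {i \<in> I. q i \<noteq> Null T C (X i)}"
    using q(1) carrier_sum_group[of I "\<lambda>i. hom_group T C (X i)"] gr by (auto simp: hom_group_def)
  have "arr (finprod ?G (\<lambda>i. \<iota> i \<cdot> q i) K) C S \<and> P (finprod ?G (\<lambda>i. \<iota> i \<cdot> q i) K)"
    if "finite K" "K \<subseteq> I" for K
    using that
  proof (induction K rule: finite_induct)
    case empty
    then show ?case using N arr_Null[OF Co So] by (simp add: G_simps)
  next
    case (insert i K)
    have m: "arr (\<iota> j \<cdot> q j) C S" if "j \<in> insert i K" for j
      using arr_Comp[OF qi coprod_inj[OF c]] insert.prems that by blast
    then have "(\<lambda>j. \<iota> j \<cdot> q j) \<in> K \<rightarrow> carrier ?G" "\<iota> i \<cdot> q i \<in> carrier ?G"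
      by (auto simp: hom_group_def arr_def)
    then have e: "finprod ?G (\<lambda>j. \<iota> j \<cdot> q j) (insert i K) = Add T (\<iota> i \<cdot> q i) (finprod ?G (\<lambda>j. \<iota> j \<cdot> q j) K)"
      using G.finprod_insert[OF insert.hyps] by (simp add: G_simps)
    have i: "arr (\<iota> i \<cdot> q i) C S" "P (\<iota> i \<cdot> q i)" using m S qi insert.prems by auto
    show ?case unfolding e using arr_Add[OF i(1)] A[OF i(1) _ i(2)] insert by simp
  qed
  from this[OF fin] show ?thesis unfolding q(2) by blast
qed

text \<open>
  Compactness of \<open>C\<close> as an induction principle: every arrow from \<open>C[n]\<close> to a coproduct is a finite sum
  of arrows that factor through the injections.
\<close>

lemma compact_induct:
  fixes J :: "'j set"
  assumes C: "compact_object \<kappa> T C" and c: "is_coproduct T J X S \<iota>" and J: "|J| <o \<kappa>"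
    and p: "arr p (Sh T n C) S"
    and N: "P (Null T (Sh T n C) S)" and S: "\<And>i q. \<lbrakk>i \<in> J; arr q (Sh T n C) (X i)\<rbrakk> \<Longrightarrow> P (\<iota> i \<cdot> q)"
    and A: "\<And>f g. \<lbrakk>arr f (Sh T n C) S; arr g (Sh T n C) S; P f; P g\<rbrakk> \<Longrightarrow> P (Add T f g)"
  shows "P p"
proof -
  obtain I :: "'u set" and b' where I: "|I| <o \<kappa>" and b': "bij_betw b' J I" using small_copy[OF J] by blast
  define b where "b = inv_into J b'"
  have b: "bij_betw b I J" using b' by (simp add: b_def bij_betw_inv_into)
  have Co: "C \<in> Ob T" and So: "S \<in> Ob T" using C coprod_Ob[OF c] by (auto simp: compact_object_def)
  note c' = coprod_reindex[OF c b]
  have p': "arr (ShM T (-n) p) C (Sh T (-n) S)" using arr_ShM[OF p, of "-n"] by (simp add: Sh_inverse Co)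
  have unsh: "arr (ShM T n f) (Sh T n C) S" if "arr f C (Sh T (-n) S)" for f
    using arr_ShM[OF that, of n] by (simp add: Sh_inverse So)
  \<comment> \<open>Compactness concerns \<open>C\<close> itself, so everything is shifted by
    \<open>-n\<close> and the predicate is read through the inverse shift.\<close>
  have "P (ShM T n (ShM T (-n) p))"
  proof (rule compact_induct_small[OF C Sh_coprod[OF c', of "-n"] I p', of "\<lambda>f. P (ShM T n f)"])
    show "P (ShM T n (Null T C (Sh T (-n) S)))" using N by (simp add: ShM_Null Co So Sh_Ob Sh_inverse)
  next
    fix i q assume i: "i \<in> I" and q: "arr q C (Sh T (-n) (X (b i)))"
    have \<iota>: "arr (\<iota> (b i)) (X (b i)) S" using coprod_inj[OF c' i] .
    have "arr (ShM T n q) (Sh T n C) (X (b i))" using arr_ShM[OF q, of n] arrD[OF \<iota>] by (simp add: Sh_inverse)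
    moreover have "b i \<in> J" using b i by (auto simp: bij_betw_def)
    ultimately have "P (\<iota> (b i) \<cdot> ShM T n q)" using S by blast
    then show "P (ShM T n (ShM T (-n) (\<iota> (b i)) \<cdot> q))"
      using ShM_comp[OF q arr_ShM[OF \<iota>, of "-n"], of n] ShM_inverse(1)[OF \<iota>, of n] by simp
  next
    fix f g assume f: "arr f C (Sh T (-n) S)" and g: "arr g C (Sh T (-n) S)" and "P (ShM T n f)" "P (ShM T n g)"
    then show "P (ShM T n (Add T f g))" using A[OF unsh[OF f] unsh[OF g]] ShM_add[OF f g, of n] by simp
  qed
  then show ?thesis using ShM_inverse(1)[OF p, of n] by simp
qed

end

section \<open>The silting t-structure\<close>

locale silting_generator = compactly_generated_tricat \<kappa> T
  for \<kappa> :: "'u rel" and T :: "('o, 'm, 'z) tricat_scheme" (structure) +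
  fixes M :: 'o
  assumes compact_gen: "compact_generator \<kappa> T M" and silting_M: "silting T M"
begin

abbreviation LE :: "int \<Rightarrow> 'o set" where "LE \<equiv> T_le T M"
abbreviation GE :: "int \<Rightarrow> 'o set" where "GE \<equiv> T_ge T M"

lemma M_Ob: "M \<in> Ob T" using silting_M by (simp add: silting_def)

lemma M_compact: "compact_object \<kappa> T M" using compact_gen by (simp add: compact_generator_def)

lemma zero_if_all_van: "\<lbrakk>X \<in> Ob T; \<And>i. van M (Sh T i X)\<rbrakk> \<Longrightarrow> is_zero T X"
  using compact_gen by (auto simp: compact_generator_def generates_def)

lemma LE_iff: "X \<in> LE n \<longleftrightarrow> X \<in> Ob T \<and> (\<forall>i>n. van M (Sh T i X))"
  by (auto simp: T_le_def perp_gt_def)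

lemma GE_iff: "X \<in> GE n \<longleftrightarrow> X \<in> Ob T \<and> (\<forall>i<n. van M (Sh T i X))"
  by (auto simp: T_ge_def perp_le_def)

lemma LE_Ob: "X \<in> LE n \<Longrightarrow> X \<in> Ob T" and GE_Ob: "X \<in> GE n \<Longrightarrow> X \<in> Ob T"
  by (simp_all add: LE_iff GE_iff)

lemma LE_mono: "\<lbrakk>X \<in> LE n; n \<le> m\<rbrakk> \<Longrightarrow> X \<in> LE m" and GE_mono: "\<lbrakk>X \<in> GE n; m \<le> n\<rbrakk> \<Longrightarrow> X \<in> GE m"
  by (auto simp: LE_iff GE_iff)

lemma LE_Sh: assumes "X \<in> Ob T" shows "Sh T k X \<in> LE n \<longleftrightarrow> X \<in> LE (n + k)"
proof
  assume a: "Sh T k X \<in> LE n"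
  have "van M (Sh T i X)" if "i > n + k" for i
  proof -
    have "van M (Sh T (i - k) (Sh T k X))" using a that by (simp add: LE_iff)
    then show ?thesis using assms by (simp add: Sh_Sh)
  qed
  then show "X \<in> LE (n + k)" using assms by (simp add: LE_iff)
qed (use assms in \<open>simp add: LE_iff Sh_Sh Sh_Ob\<close>)

lemma GE_Sh: assumes "X \<in> Ob T" shows "Sh T k X \<in> GE n \<longleftrightarrow> X \<in> GE (n + k)"
proof
  assume a: "Sh T k X \<in> GE n"
  have "van M (Sh T i X)" if "i < n + k" for i
  proof -
    have "van M (Sh T (i - k) (Sh T k X))" using a that by (simp add: GE_iff)
    then show ?thesis using assms by (simp add: Sh_Sh)
  qed
  then show "X \<in> GE (n + k)" using assms by (simp add: GE_iff)
qed (use assms in \<open>simp add: GE_iff Sh_Sh Sh_Ob\<close>)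

lemma t_struct: "t_structure T (LE 0) (GE 1)"
  using silting_M by (simp add: silting_def T_le_def T_ge_def)

lemma van_LE_GE: assumes "X \<in> LE n" "Y \<in> GE m" "n < m" shows "van X Y"
proof -
  have o: "X \<in> Ob T" "Y \<in> Ob T" using assms LE_Ob GE_Ob by auto
  have "Sh T n X \<in> LE 0" "Sh T n Y \<in> GE 1"
    using assms o GE_mono[OF assms(2), of "1 + n"] by (simp_all add: LE_Sh GE_Sh)
  then have "van (Sh T n X) (Sh T n Y)" using t_struct unfolding t_structure_def by blast
  then show ?thesis using van_Sh o by blast
qed

text \<open>The aisle is the full left orthogonal of the coaisle. Its closure under extensions,
  coproducts and retracts is obtained from this side, where it becomes a statement about Hom(-,
  Y).\<close>

lemma LE_if_van: assumes "X \<in> Ob T" "\<And>Y. Y \<in> GE (n + 1) \<Longrightarrow> van X Y" shows "X \<in> LE n"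
proof -
  have "van (Sh T n X) Y" if Y: "Y \<in> GE 1" for Y
  proof -
    have "Sh T (-n) Y \<in> GE (n + 1)" using GE_Sh[OF GE_Ob[OF Y], of "-n" "n+1"] Y by simp
    then show ?thesis using assms van_Sh_left[OF assms(1) GE_Ob[OF Y]] by blast
  qed
  then have "Sh T n X \<in> LE 0" using t_struct Sh_Ob[OF assms(1)] unfolding t_structure_def by blast
  then show ?thesis using LE_Sh[OF assms(1), of n 0] by simp
qed

lemma trunc: assumes "X \<in> Ob T" shows "\<exists>A\<in>LE n. \<exists>B\<in>GE (n + 1). \<exists>f g h. Tri T A X B f g h"
proof -
  obtain A B f g h where AB: "A \<in> LE 0" "B \<in> GE 1" and t: "Tri T A (Sh T n X) B f g h"
    using t_struct Sh_Ob[OF assms] unfolding t_structure_def by meson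
  have "Sh T (-n) A \<in> LE n" "Sh T (-n) B \<in> GE (n + 1)"
    using AB LE_Sh[OF LE_Ob[OF AB(1)], of "-n" n] GE_Sh[OF GE_Ob[OF AB(2)], of "-n" "n+1"] by simp_all
  moreover have "\<exists>f g h. Tri T (Sh T (-n) A) X (Sh T (-n) B) f g h"
    using Tri_Sh[OF t, of "-n"] by (simp add: Sh_inverse assms)
  ultimately show ?thesis by blast
qed

lemma LE_ext: assumes t: "Tri T X Y Z f g h" and "X \<in> LE n" "Z \<in> LE n" shows "Y \<in> LE n"
  by (rule LE_if_van[OF Tri_Ob(2)[OF t]]) (use Tri_nav_mid[OF t] assms van_LE_GE GE_Ob in force)

lemma LE_right: assumes t: "Tri T X Y Z f g h" and "Y \<in> LE n" "X \<in> LE (n + 1)" shows "Z \<in> LE n"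
  by (rule LE_ext[OF Tri_rot[OF t]]) (use assms LE_Sh[OF Tri_Ob(1)[OF t]] in simp_all)

lemma LE_left: assumes t: "Tri T X Y Z f g h" and "Y \<in> LE n" "Z \<in> LE (n - 1)" shows "X \<in> LE n"
  by (rule LE_ext[OF Tri_rot_back[OF t]]) (use assms LE_Sh[OF Tri_Ob(3)[OF t]] in simp_all)

lemma GE_ext: assumes t: "Tri T X Y Z f g h" and "X \<in> GE n" "Z \<in> GE n" shows "Y \<in> GE n"
proof -
  have "van M (Sh T i Y)" if "i < n" for i
  proof -
    obtain f' g' h' where "Tri T (Sh T i X) (Sh T i Y) (Sh T i Z) f' g' h'" using Tri_Sh[OF t] by blast
    then show ?thesis using Tri_van_mid M_Ob assms that GE_iff by blast
  qed
  then show ?thesis using GE_iff Tri_Ob[OF t] by blast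
qed

lemma GE_right: assumes t: "Tri T X Y Z f g h" and "Y \<in> GE n" "X \<in> GE (n + 1)" shows "Z \<in> GE n"
  by (rule GE_ext[OF Tri_rot[OF t]]) (use assms GE_Sh[OF Tri_Ob(1)[OF t]] in simp_all)

lemma GE_left: assumes t: "Tri T X Y Z f g h" and "Y \<in> GE n" "Z \<in> GE (n - 1)" shows "X \<in> GE n"
  by (rule GE_ext[OF Tri_rot_back[OF t]]) (use assms GE_Sh[OF Tri_Ob(3)[OF t]] in simp_all)

lemma LE_coprod: assumes c: "is_coproduct T I X S \<iota>" and "\<And>i. i \<in> I \<Longrightarrow> X i \<in> LE n" shows "S \<in> LE n"
  by (rule LE_if_van[OF coprod_Ob[OF c]], rule coprod_van[OF c]) (use assms van_LE_GE GE_Ob in force)+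

lemma LE_retract: assumes "retract X Y" "Y \<in> LE n" shows "X \<in> LE n"
  by (rule LE_if_van[OF retract_Ob(1)[OF assms(1)]]) (use retract_van1[OF assms(1)] van_LE_GE[OF assms(2)] GE_Ob in force)

lemma zero_LE: "is_zero T X \<Longrightarrow> X \<in> LE n" and zero_GE: "is_zero T X \<Longrightarrow> X \<in> GE n"
  using zero_Sh is_zero_Ob zero_van(2) M_Ob by (auto simp: LE_iff GE_iff)

lemma LE_GE_zero: "\<lbrakk>X \<in> LE n; X \<in> GE m; n < m\<rbrakk> \<Longrightarrow> is_zero T X"
  using van_LE_GE zero_if_van LE_Ob by blast

text \<open>\<open>GE 1\<close> is defined by vanishing of Hom(M, Y[i]) for i \<le> 0, and the case
  i = 0 makes \<open>M\<close> left orthogonal to it. In particular Hom(M, M[i]) = 0 for i >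
  0.\<close>

lemma M_LE: "M \<in> LE 0"
  by (rule LE_if_van[OF M_Ob]) (auto simp: GE_iff Sh_zero dest: spec[of _ 0])

section \<open>Truncations and cohomological detection of aisle and coaisle\<close>

lemma tau_le_spec: assumes "X \<in> Ob T"
  shows "tau_le T M n X \<in> LE n" "\<exists>B\<in>GE (n + 1). \<exists>f g h. Tri T (tau_le T M n X) X B f g h"
proof -
  have "\<exists>A. A \<in> LE n \<and> (\<exists>B\<in>GE (n + 1). \<exists>f g h. Tri T A X B f g h)" using trunc[OF assms] by blast
  from someI_ex[OF this] show "tau_le T M n X \<in> LE n" "\<exists>B\<in>GE (n + 1). \<exists>f g h. Tri T (tau_le T M n X) X B f g h"
    unfolding tau_le_def by blast+
qed

lemma tau_ge_spec: assumes "X \<in> Ob T"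
  shows "tau_ge T M n X \<in> GE n" "\<exists>A\<in>LE (n - 1). \<exists>f g h. Tri T A X (tau_ge T M n X) f g h"
proof -
  have "\<exists>B. B \<in> GE n \<and> (\<exists>A\<in>LE (n - 1). \<exists>f g h. Tri T A X B f g h)" using trunc[OF assms, of "n - 1"] by force
  from someI_ex[OF this] show "tau_ge T M n X \<in> GE n" "\<exists>A\<in>LE (n - 1). \<exists>f g h. Tri T A X (tau_ge T M n X) f g h"
    unfolding tau_ge_def by blast+
qed

lemma tau_ge_zero_iff: assumes "X \<in> Ob T" shows "is_zero T (tau_ge T M n X) \<longleftrightarrow> X \<in> LE (n - 1)"
proof -
  obtain A f g h where A: "A \<in> LE (n - 1)" and t: "Tri T A X (tau_ge T M n X) f g h" using tau_ge_spec(2)[OF assms] by blast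
  show ?thesis
  proof
    assume "is_zero T (tau_ge T M n X)"
    then show "X \<in> LE (n - 1)" using LE_ext[OF t A] zero_LE by blast
  next
    assume "X \<in> LE (n - 1)"
    then have "tau_ge T M n X \<in> LE (n - 1)" using LE_right[OF t, of "n - 1"] LE_mono[OF A, of n] by simp
    then show "is_zero T (tau_ge T M n X)" using LE_GE_zero tau_ge_spec(1)[OF assms] by force
  qed
qed

lemma coh_zero_iff: "X \<in> Ob T \<Longrightarrow> is_zero T (coh T M l X) \<longleftrightarrow> tau_le T M 0 (Sh T l X) \<in> LE (-1)"
  unfolding coh_def using tau_ge_zero_iff[of "tau_le T M 0 (Sh T l X)" 0] LE_Ob[OF tau_le_spec(1)] Sh_Ob by simp

text \<open>For such \<open>X\<close> the truncation of X[l] at 0 changes nothing: the third term of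
  its triangle lies in both \<open>LE 0\<close> and \<open>GE 1\<close>.\<close>

lemma coh_zero_iff_LE: assumes "X \<in> LE l" shows "is_zero T (coh T M l X) \<longleftrightarrow> X \<in> LE (l - 1)"
proof -
  have X: "X \<in> Ob T" using LE_Ob[OF assms] .
  have Xl: "Sh T l X \<in> LE 0" using LE_Sh[OF X, of l 0] assms by simp
  let ?A = "tau_le T M 0 (Sh T l X)"
  obtain B f g h where B: "B \<in> GE 1" and t: "Tri T ?A (Sh T l X) B f g h" using tau_le_spec(2)[OF Sh_Ob[OF X, of l], of 0] by auto
  have "B \<in> LE 0" using LE_right[OF t Xl] LE_mono[OF tau_le_spec(1)[OF Sh_Ob[OF X]]] by simp
  then have B0: "is_zero T B" using LE_GE_zero B by force
  have "?A \<in> LE (-1) \<longleftrightarrow> Sh T l X \<in> LE (-1)" using LE_ext[OF t] LE_left[OF t] zero_LE[OF B0] by blast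
  then show ?thesis using coh_zero_iff[OF X] LE_Sh[OF X, of l "-1"] by simp
qed

text \<open>\<open>T_minus\<close> supplies some upper bound, and each vanishing cohomology object
  lowers the bound by one.\<close>

lemma LE_iff_coh: assumes "X \<in> T_minus T M" shows "X \<in> LE n \<longleftrightarrow> (\<forall>l>n. is_zero T (coh T M l X))"
proof
  show "\<forall>l>n. is_zero T (coh T M l X)" if "X \<in> LE n"
    using coh_zero_iff_LE LE_mono[OF that] by (metis less_imp_le zle_diff1_eq)
next
  assume a: "\<forall>l>n. is_zero T (coh T M l X)"
  obtain m where m: "X \<in> LE m" using assms by (auto simp: T_minus_def)
  have "X \<in> LE (n + int k) \<Longrightarrow> X \<in> LE n" for k
  proof (induction k)
    case (Suc k)
    then show ?case using coh_zero_iff_LE[of X "n + int (Suc k)"] a by simp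
  qed simp
  from this[of "nat (m - n)"] show "X \<in> LE n" using LE_mono[OF m] by simp
qed

text \<open>Truncations are chosen by \<open>SOME\<close>, and a comparison up to retracts suffices.
  Both \<open>s\<close> and \<open>a\<close> lie over \<open>X\<close>, so \<open>f\<close> kills
  the difference of \<open>a \<cdot> s\<close> and the identity; the difference then factors through
  an arrow A -> B[-1], which is zero.\<close>

lemma trunc_retract:
  assumes t: "Tri T A X B f g h" and t': "Tri T A' X B' f' g' h'"
    and v: "van A B'" "van A' B" "van A (Sh T (-1) B)"
  shows "retract A A'"
proof -
  note ar = Tri_arr[OF t] and ar' = Tri_arr[OF t'] and A = Tri_Ob(1)[OF t]
  obtain s where s: "arr s A A'" "f' \<cdot> s = f" using Tri_lift[OF t' ar(1) vanD[OF v(1) arr_Comp[OF ar(1) ar'(2)]]] by blast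
  obtain a where a: "arr a A' A" "f \<cdot> a = f'" using Tri_lift[OF t ar'(1) vanD[OF v(2) arr_Comp[OF ar'(1) ar(2)]]] by blast
  have as: "arr (a \<cdot> s) A A" using arr_Comp[OF s(1) a(1)] .
  let ?d = "diff A A (a \<cdot> s) (Id T A)"
  have d: "arr ?d A A" using arr_diff[OF as arr_Id[OF A]] .
  have "f \<cdot> (a \<cdot> s) = f" using comp_assoc[OF s(1) a(1) ar(1)] s a by simp
  then have "f \<cdot> ?d = Null T A X"
    using comp_diff[OF as arr_Id[OF A] ar(1)] comp_Id[OF ar(1)] diff_eq_Null[OF ar(1) ar(1)] by simp
  then obtain r where r: "arr r A (Sh T (-1) B)" "Neg T (Sh T (-1) B) A (ShM T (-1) h) \<cdot> r = ?d"
    using Tri_lift[OF Tri_rot_back[OF t] d] by blast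
  have "?d = Null T A A" using vanD[OF v(3) r(1)] r(2) comp_Null[OF Tri_arr(1)[OF Tri_rot_back[OF t]] A] by simp
  then have "a \<cdot> s = Id T A" using diff_eq_Null[OF as arr_Id[OF A]] by simp
  then show ?thesis using retractI s(1) a(1) by blast
qed

text \<open>In the converse direction the truncation \<open>A\<close> below \<open>n\<close> sinks
  through every degree, so Hom(M, A[i]) = 0 for all i, and \<open>A\<close> is zero because
  \<open>M\<close> generates.\<close>

lemma GE_iff_coh: assumes X: "X \<in> Ob T" shows "X \<in> GE n \<longleftrightarrow> (\<forall>l<n. is_zero T (coh T M l X))"
proof (intro iffI allI impI)
  fix l assume "X \<in> GE n" "l < n"
  then have Xl: "Sh T l X \<in> GE 1" using GE_Sh[OF X, of l 1] GE_mono[of X n "1 + l"] by simp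
  let ?A = "tau_le T M 0 (Sh T l X)"
  obtain B f g h where B: "B \<in> GE 1" and t: "Tri T ?A (Sh T l X) B f g h" using tau_le_spec(2)[OF Sh_Ob[OF X, of l], of 0] by auto
  have "?A \<in> GE 1" using GE_left[OF t Xl] GE_mono[OF B] by simp
  then have "is_zero T ?A" using LE_GE_zero[OF tau_le_spec(1)[OF Sh_Ob[OF X]]] by force
  then show "is_zero T (coh T M l X)" using coh_zero_iff[OF X] zero_LE by blast
next
  assume a: "\<forall>l<n. is_zero T (coh T M l X)"
  obtain A B f g h where A: "A \<in> LE (n - 1)" and B: "B \<in> GE n" and t: "Tri T A X B f g h"
    using trunc[OF X, of "n - 1"] by auto
  note Ao = LE_Ob[OF A] and Bo = GE_Ob[OF B]
  have LE: "A \<in> LE (n - 1 - int k)" for k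
  proof (induction k)
    case (Suc k)
    define l where "l = n - 1 - int k"
    let ?A = "tau_le T M 0 (Sh T l X)"
    obtain f1 g1 h1 where t1: "Tri T (Sh T l A) (Sh T l X) (Sh T l B) f1 g1 h1" using Tri_Sh[OF t] by blast
    obtain B' f2 g2 h2 where B': "B' \<in> GE 1" and t2: "Tri T ?A (Sh T l X) B' f2 g2 h2"
      using tau_le_spec(2)[OF Sh_Ob[OF X, of l], of 0] by auto
    have A1: "Sh T l A \<in> LE 0" using Suc LE_Sh[OF Ao] by (simp add: l_def)
    have B1: "Sh T l B \<in> GE 1" "Sh T (-1) (Sh T l B) \<in> GE 1"
      using GE_mono[OF B] GE_Sh[OF Bo] Bo by (simp_all add: l_def Sh_Sh)
    have A2: "?A \<in> LE 0" using tau_le_spec(1)[OF Sh_Ob[OF X]] .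
    have "van (Sh T l A) B'" "van ?A (Sh T l B)" "van (Sh T l A) (Sh T (-1) (Sh T l B))"
      using van_LE_GE A1 A2 B1 B' by force+
    \<comment> \<open>Both triangles truncate X[l] at 0, so A[l] is a retract of the chosen
      truncation, which vanishing cohomology places one degree lower.\<close>
    then have r: "retract (Sh T l A) ?A" by (rule trunc_retract[OF t1 t2])
    have "?A \<in> LE (-1)" using a coh_zero_iff[OF X, of l] by (simp add: l_def)
    then have "Sh T l A \<in> LE (-1)" using LE_retract[OF r] by blast
    then show ?case using LE_Sh[OF Ao, of l "-1"] by (simp add: l_def algebra_simps)
  qed (use A in simp)
  have "van M (Sh T i A)" for i
    using LE[of "nat (n - i)"] by (simp add: LE_iff)
  then have "is_zero T A" using zero_if_all_van[OF Ao] by blast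
  then show "X \<in> GE n" using GE_ext[OF t _ B] zero_GE by blast
qed

section \<open>Dimensions and approximation by coproducts of the silting object\<close>

definition pd_le :: "'o \<Rightarrow> int \<Rightarrow> bool" where
  "pd_le X n \<longleftrightarrow> (\<forall>U\<in>LE 0. \<forall>j>n. van X (Sh T j U))"

definition id_le :: "'o \<Rightarrow> int \<Rightarrow> bool" where
  "id_le Y n \<longleftrightarrow> (\<forall>V\<in>GE 0. \<forall>j>n. van V (Sh T j Y))"

lemma LE_T_minus: "X \<in> LE n \<Longrightarrow> X \<in> T_minus T M"
  unfolding T_minus_def using LE_mono[of X n "max 1 n"] by (auto intro!: bexI[of _ "max 1 n"])

lemma GE_T_plus: "X \<in> GE n \<Longrightarrow> X \<in> T_plus T M"
  unfolding T_plus_def using GE_mono[of X n "- max 1 (-n)"] by (auto intro!: bexI[of _ "max 1 (-n)"])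

lemma T_bd_GE_iff: "X \<in> T_bd T M \<inter> GE 0 \<longleftrightarrow> X \<in> GE 0 \<and> (\<exists>m. X \<in> LE m)"
  using LE_T_minus GE_T_plus by (auto simp: T_bd_def T_minus_def)

text \<open>Shifting normalises \<open>U\<close> to \<open>LE 0\<close>. For integers the strict
  inequality i > n + sup U says that the cohomology of \<open>U\<close> vanishes above i - n - 1,
  and this reading stays correct for sup U = -\<infinity>.\<close>

lemma projdim_condition: assumes X: "X \<in> Ob T"
  shows "(\<forall>U\<in>T_minus T M. \<forall>i :: int. ereal (of_int i) > ereal (of_int n) + coh_sup T M U \<longrightarrow>
      van X (Sh T i U)) \<longleftrightarrow> pd_le X n"
proof
  assume a: "\<forall>U\<in>T_minus T M. \<forall>i :: int. ereal (of_int i) > ereal (of_int n) + coh_sup T M U \<longrightarrow> van X (Sh T i U)"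
  show "pd_le X n" unfolding pd_le_def
  proof (intro ballI allI impI)
    fix U j assume U: "U \<in> LE 0" and j: "j > n"
    have "l \<le> 0" if "\<not> is_zero T (coh T M l U)" for l
      using U LE_iff_coh[OF LE_T_minus[OF U], of 0] that by (meson not_less)
    then have "coh_sup T M U \<le> 0" unfolding coh_sup_def by (intro Sup_least) auto
    then have "ereal (of_int n) + coh_sup T M U \<le> ereal (of_int n) + 0" by (rule add_left_mono)
    also have "\<dots> < ereal (of_int j)" using j by simp
    finally show "van X (Sh T j U)" using a LE_T_minus[OF U] by blast
  qed
next
  assume a: "pd_le X n"
  show "\<forall>U\<in>T_minus T M. \<forall>i :: int. ereal (of_int i) > ereal (of_int n) + coh_sup T M U \<longrightarrow> van X (Sh T i U)"
  proof (intro ballI allI impI)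
    fix U and i :: int assume U: "U \<in> T_minus T M" and i: "ereal (of_int i) > ereal (of_int n) + coh_sup T M U"
    have "is_zero T (coh T M l U)" if l: "l > i - n - 1" for l
    proof (rule ccontr)
      assume "\<not> is_zero T (coh T M l U)"
      then have "ereal (of_int l) \<le> coh_sup T M U" unfolding coh_sup_def by (intro Sup_upper) blast
      then have "ereal (of_int n) + ereal (of_int l) \<le> ereal (of_int n) + coh_sup T M U" by (rule add_left_mono)
      then have "ereal (of_int n) + ereal (of_int l) < ereal (of_int i)" using i by (rule le_less_trans)
      then show False using l by simp
    qed
    then have U1: "U \<in> LE (i - n - 1)" using LE_iff_coh[OF U] by blast
    then have "Sh T (i - n - 1) U \<in> LE 0" using LE_Sh[OF LE_Ob[OF U1], of "i-n-1" 0] by simp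
    \<comment> \<open>The remaining degree n + 1 is the first one to which \<open>pd_le X n\<close>
      applies.\<close>
    then have "van X (Sh T (n + 1) (Sh T (i - n - 1) U))" using a by (simp add: pd_le_def)
    then show "van X (Sh T i U)" using Sh_Sh[OF LE_Ob[OF U1]] by simp
  qed
qed

lemma injdim_condition: assumes Y: "Y \<in> Ob T"
  shows "(\<forall>V\<in>T_plus T M. \<forall>i :: int. ereal (of_int i) < - ereal (of_int n) + coh_inf T M V \<longrightarrow>
      van (Sh T i V) Y) \<longleftrightarrow> id_le Y n"
proof
  assume a: "\<forall>V\<in>T_plus T M. \<forall>i :: int. ereal (of_int i) < - ereal (of_int n) + coh_inf T M V \<longrightarrow> van (Sh T i V) Y"
  show "id_le Y n" unfolding id_le_def
  proof (intro ballI allI impI)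
    fix V j assume V: "V \<in> GE 0" and j: "j > n"
    have "0 \<le> l" if "\<not> is_zero T (coh T M l V)" for l
      using V GE_iff_coh[OF GE_Ob[OF V], of 0] that by (meson not_less)
    then have "0 \<le> coh_inf T M V" unfolding coh_inf_def by (intro Inf_greatest) auto
    then have "- ereal (of_int n) + 0 \<le> - ereal (of_int n) + coh_inf T M V" by (rule add_left_mono)
    moreover have "ereal (of_int (-j)) < - ereal (of_int n) + 0" using j by simp
    ultimately have "ereal (of_int (-j)) < - ereal (of_int n) + coh_inf T M V" by (rule less_le_trans[rotated])
    then have "van (Sh T (-j) V) Y" using a GE_T_plus[OF V] by blast
    then show "van V (Sh T j Y)" using van_Sh_left[OF GE_Ob[OF V] Y, of "-j"] by simp
  qed
next
  assume a: "id_le Y n"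
  show "\<forall>V\<in>T_plus T M. \<forall>i :: int. ereal (of_int i) < - ereal (of_int n) + coh_inf T M V \<longrightarrow> van (Sh T i V) Y"
  proof (intro ballI allI impI)
    fix V and i :: int assume V: "V \<in> T_plus T M" and i: "ereal (of_int i) < - ereal (of_int n) + coh_inf T M V"
    have Vo: "V \<in> Ob T" using V GE_Ob by (auto simp: T_plus_def)
    have "is_zero T (coh T M l V)" if l: "l < i + n + 1" for l
    proof (rule ccontr)
      assume "\<not> is_zero T (coh T M l V)"
      then have "coh_inf T M V \<le> ereal (of_int l)" unfolding coh_inf_def by (intro Inf_lower) blast
      then have "- ereal (of_int n) + coh_inf T M V \<le> - ereal (of_int n) + ereal (of_int l)" by (rule add_left_mono)
      with i have "ereal (of_int i) < - ereal (of_int n) + ereal (of_int l)" by (rule less_le_trans)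
      then show False using l by simp
    qed
    then have "V \<in> GE (i + n + 1)" using GE_iff_coh[OF Vo] by blast
    then have "Sh T (i + n + 1) V \<in> GE 0" using GE_Sh[OF Vo, of "i+n+1" 0] by simp
    then have "van (Sh T (i + n + 1) V) (Sh T (n + 1) Y)" using a by (simp add: id_le_def)
    then have "van (Sh T (n + 1) (Sh T i V)) (Sh T (n + 1) Y)" by (simp add: Sh_Sh[OF Vo] algebra_simps)
    then show "van (Sh T i V) Y" using van_Sh Sh_Ob Vo Y by blast
  qed
qed

lemma pd_le_mono: "\<lbrakk>pd_le X m; m \<le> n\<rbrakk> \<Longrightarrow> pd_le X n" and id_le_mono: "\<lbrakk>id_le X m; m \<le> n\<rbrakk> \<Longrightarrow> id_le X n"
  by (simp_all add: pd_le_def id_le_def)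

lemma projdim_le_iff: assumes "X \<in> Ob T" shows "projdim T M X \<le> ereal r \<longleftrightarrow> pd_le X \<lfloor>r\<rfloor>"
  unfolding projdim_def projdim_condition[OF assms] using pd_le_mono by (rule Inf_of_int_le_iff)

lemma injdim_le_iff: assumes "X \<in> Ob T" shows "injdim T M X \<le> ereal r \<longleftrightarrow> id_le X \<lfloor>r\<rfloor>"
  unfolding injdim_def injdim_condition[OF assms] using id_le_mono by (rule Inf_of_int_le_iff)

lemma projdim_finite_iff: assumes "X \<in> Ob T" shows "projdim T M X < \<infinity> \<longleftrightarrow> (\<exists>n. pd_le X n)"
  unfolding projdim_def projdim_condition[OF assms] Inf_less_iff by auto

lemma FPD_le_iff:
  "FPD T M \<le> ereal r \<longleftrightarrow> (\<forall>X\<in>T_bd T M \<inter> GE 0. (\<exists>k. pd_le X k) \<longrightarrow> pd_le X \<lfloor>r\<rfloor>)"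
  unfolding FPD_def Sup_le_iff using projdim_le_iff projdim_finite_iff GE_Ob by blast

lemma gpd_le_iff: "gpd T M \<le> ereal r \<longleftrightarrow> (\<forall>X\<in>T_bd T M \<inter> GE 0. pd_le X \<lfloor>r\<rfloor>)"
  unfolding gpd_def Sup_le_iff using projdim_le_iff GE_Ob by blast

lemma Add_Ob: "P \<in> Add_cls \<kappa> T M \<Longrightarrow> P \<in> Ob T" by (simp add: Add_cls_def)

lemma silp_le_iff: "silp \<kappa> T M \<le> ereal r \<longleftrightarrow> (\<forall>P\<in>Add_cls \<kappa> T M. id_le P \<lfloor>r\<rfloor>)"
  unfolding silp_def Sup_le_iff using injdim_le_iff Add_Ob by blast

lemma pd_le_ext: assumes t: "Tri T X Y Z f g h" and "pd_le X n" "pd_le Z n" shows "pd_le Y n"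
  using Tri_nav_mid[OF t] assms Sh_Ob LE_Ob unfolding pd_le_def by blast

lemma pd_le_Sh: assumes X: "X \<in> Ob T" shows "pd_le (Sh T k X) n \<longleftrightarrow> pd_le X (n - k)"
proof -
  have e: "van (Sh T k X) (Sh T j U) \<longleftrightarrow> van X (Sh T (j - k) U)" if "U \<in> LE 0" for U j
    using van_Sh_left[OF X Sh_Ob[OF LE_Ob[OF that]], of k j] Sh_Sh[OF LE_Ob[OF that], of "-k" j] by simp
  have "(\<forall>j>n. van X (Sh T (j - k) U)) \<longleftrightarrow> (\<forall>j>n-k. van X (Sh T j U))" for U
    by (metis add_diff_cancel_right' diff_add_cancel less_diff_eq)
  then show ?thesis using e by (simp add: pd_le_def)
qed

lemma pd_le_left: assumes t: "Tri T X Y Z f g h" and "pd_le Y n" "pd_le Z (n + 1)" shows "pd_le X n"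
  by (rule pd_le_ext[OF Tri_rot_back[OF t]]) (use assms pd_le_Sh[OF Tri_Ob(3)[OF t]] in simp_all)

lemma pd_le_right: assumes t: "Tri T X Y Z f g h" and "pd_le Y n" "pd_le X (n - 1)" shows "pd_le Z n"
  by (rule pd_le_ext[OF Tri_rot[OF t]]) (use assms pd_le_Sh[OF Tri_Ob(1)[OF t]] in simp_all)

lemma pd_le_coprod: assumes c: "is_coproduct T I X S \<iota>" and "\<And>i. i \<in> I \<Longrightarrow> pd_le (X i) n" shows "pd_le S n"
  using coprod_van[OF c] assms(2) Sh_Ob LE_Ob unfolding pd_le_def by blast

lemma pd_le_retract: assumes "retract X Y" "pd_le Y n" shows "pd_le X n"
  using retract_van1[OF assms(1)] assms(2) Sh_Ob LE_Ob unfolding pd_le_def by blast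

lemma pd_le_M: "pd_le M 0"
  by (simp add: pd_le_def LE_iff)

lemma pd_le_zero: "is_zero T X \<Longrightarrow> pd_le X n"
  using zero_van(1) Sh_Ob LE_Ob by (auto simp: pd_le_def)

section \<open>Covers by coproducts of copies of M, and the towers they build\<close>

definition M_coprod :: "'o \<Rightarrow> bool" where
  "M_coprod S \<longleftrightarrow> (\<exists>(I :: 'u set) \<iota>. |I| <o \<kappa> \<and> is_coproduct T I (\<lambda>_. M) S \<iota>)"

lemma M_coprod_LE: "M_coprod S \<Longrightarrow> S \<in> LE 0"
  unfolding M_coprod_def using LE_coprod M_LE by blast

lemma M_coprod_pd_le: "M_coprod S \<Longrightarrow> pd_le S 0"
  unfolding M_coprod_def using pd_le_coprod pd_le_M by blast

lemma Add_cls_iff: "P \<in> Add_cls \<kappa> T M \<longleftrightarrow> (\<exists>S. M_coprod S \<and> retract P S)"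
  unfolding Add_cls_def M_coprod_def direct_summand_iff using retract_Ob(1) by blast

lemma M_coprod_Add: "M_coprod S \<Longrightarrow> S \<in> Add_cls \<kappa> T M"
  using Add_cls_iff retract_refl LE_Ob[OF M_coprod_LE] by blast

text \<open>\<open>S\<close> has one copy of \<open>M\<close> for each arrow M -> X[m]; these form a
  small set because \<open>M\<close> is compact. So \<open>p\<close> is surjective on Hom(M, -), and
  the cone loses degree \<open>m\<close>.\<close>

lemma cover: assumes X: "X \<in> LE m"
  shows "\<exists>S. M_coprod S \<and> (\<exists>X1\<in>LE (m - 1). \<exists>f g h. Tri T (Sh T (-m) S) X X1 f g h)"
proof -
  have Xo: "X \<in> Ob T" using LE_Ob[OF X] .
  have Xm: "Sh T m X \<in> Ob T" using Sh_Ob[OF Xo] .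
  obtain I :: "'u set" and b' where I: "|I| <o \<kappa>" and b': "bij_betw b' (Hom T M (Sh T m X)) I"
    using small_copy[OF Hom_small[OF M_compact Xm]] by blast
  define b where "b = inv_into (Hom T M (Sh T m X)) b'"
  have b: "bij_betw b I (Hom T M (Sh T m X))" using b' by (simp add: b_def bij_betw_inv_into)
  obtain S \<iota> where c: "is_coproduct T I (\<lambda>_. M) S \<iota>" using small_coproduct[OF I, of "\<lambda>_. M"] M_Ob by blast
  have S: "M_coprod S" using I c M_coprod_def by blast
  have So: "S \<in> Ob T" using coprod_Ob[OF c] .
  have ba: "arr (b i) M (Sh T m X)" if "i \<in> I" for i
    using b that M_Ob Xm by (auto simp: arr_def bij_betw_def)
  obtain p where p: "arr p S (Sh T m X)" "\<forall>i\<in>I. p \<cdot> \<iota> i = b i" using coprod_desc[OF c Xm, of b] ba by blast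
  define q where "q = ShM T (-m) p"
  have q: "arr q (Sh T (-m) S) X" using arr_ShM[OF p(1), of "-m"] by (simp add: q_def Sh_inverse Xo)
  obtain X1 g h where t: "Tri T (Sh T (-m) S) X X1 q g h" using ex_cone[OF q] by blast
  note ob = Tri_Ob[OF t] and ar = Tri_arr[OF t]
  have Sv: "van M (Sh T i (Sh T 1 (Sh T (-m) S)))" if "i \<ge> m" for i
    using M_coprod_LE[OF S] that by (simp add: LE_iff Sh_Sh Sh_Ob So)
  have "van M (Sh T i X1)" if i: "i > m - 1" for i
  proof (cases "i = m")
    \<comment> \<open>Above degree \<open>m\<close> both neighbours of \<open>X1\<close> in the
      triangle receive only zero arrows from \<open>M\<close>.\<close>
    case False
    then have "van M (Sh T i X)" using X i by (simp add: LE_iff)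
    then have "van (Sh T (-i) M) X" using van_Sh_left[OF M_Ob Xo, of "-i"] by simp
    moreover have "van (Sh T (-i) M) (Sh T 1 (Sh T (-m) S))"
      using van_Sh_left[OF M_Ob, of _ "-i"] Sv[of i] i by (simp add: Sh_Ob So)
    ultimately have "van (Sh T (-i) M) X1" using Tri_van_right[OF t] Sh_Ob[OF M_Ob] by blast
    then show ?thesis using van_Sh_left[OF M_Ob ob(3), of "-i"] by simp
  next
    case True
    have v: "van (Sh T (-m) M) (Sh T 1 (Sh T (-m) S))"
      using van_Sh_left[OF M_Ob, of _ "-m"] Sv[of m] by (simp add: Sh_Ob So)
    \<comment> \<open>\<open>r\<close> lifts to \<open>X\<close> because Hom(M, S[1]) = 0. The lift
      is one of the arrows that index \<open>S\<close>, hence factors through \<open>q\<close>, and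
      \<open>g \<cdot> q\<close> = 0.\<close>
    have "r = Null T (Sh T (-m) M) X1" if r: "arr r (Sh T (-m) M) X1" for r
    proof -
      obtain y where y: "arr y (Sh T (-m) M) X" "g \<cdot> y = r"
        using Tri_lift2[OF t r vanD[OF v arr_Comp[OF r ar(3)]]] by blast
      have "arr (ShM T m y) M (Sh T m X)" using arr_ShM[OF y(1), of m] by (simp add: Sh_inverse M_Ob)
      then obtain i where i: "i \<in> I" "b i = ShM T m y" using b arrD(3) by (force simp: bij_betw_def)
      have \<iota>: "arr (\<iota> i) M S" using coprod_inj[OF c i(1)] by simp
      have "ShM T m y = p \<cdot> \<iota> i" using p(2) i by simp
      then have "y = q \<cdot> ShM T (-m) (\<iota> i)"
        using ShM_inverse(2)[OF y(1), of m] ShM_comp[OF \<iota> p(1), of "-m"] by (simp add: q_def)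
      then have "r = (g \<cdot> q) \<cdot> ShM T (-m) (\<iota> i)" using y(2) comp_assoc[OF arr_ShM[OF \<iota>] q ar(2)] by simp
      then show ?thesis using Tri_comp[OF t] Null_comp[OF arr_ShM[OF \<iota>] ob(3)] by simp
    qed
    then have "van (Sh T (-m) M) X1" using van_iff[OF Sh_Ob[OF M_Ob] ob(3)] by blast
    then show ?thesis using van_Sh_left[OF M_Ob ob(3), of "-m"] True by simp
  qed
  then have "X1 \<in> LE (m - 1)" using LE_iff ob(3) by blast
  then show ?thesis using S t by blast
qed

text \<open>Both bounds hold for M[-i] with s \<le> i \<le> t and are stable under coproducts and
  extensions.\<close>

lemma Coprod_bounds: assumes "Y \<in> Coprod \<kappa> T {Sh T (-i) M | i. s \<le> i \<and> i \<le> t}"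
  shows "pd_le Y (-s) \<and> Y \<in> LE t"
  using assms
proof induction
  case (base X)
  then obtain i where i: "X = Sh T (-i) M" "s \<le> i" "i \<le> t" by blast
  then show ?case using pd_le_Sh[OF M_Ob, of "-i" "-s"] pd_le_mono[OF pd_le_M] LE_Sh[OF M_Ob, of "-i" t] LE_mono[OF M_LE] by simp
next
  case (coproduct I X S \<iota>)
  then show ?case using pd_le_coprod LE_coprod by blast
next
  case (extension X Z Y f g h)
  then show ?case using pd_le_ext LE_ext by blast
qed

lemma gen_interval_bounds: "Y \<in> gen_interval \<kappa> T M s t \<Longrightarrow> pd_le Y (-s) \<and> Y \<in> LE t"
  unfolding gen_interval_def smd_def direct_summand_iff
  using Coprod_bounds pd_le_retract LE_retract by blast

text \<open>A zero object is the coproduct of the empty family; it is the bottom of every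
  tower.\<close>

lemma zero_Coprod: assumes "is_zero T Y" shows "Y \<in> Coprod \<kappa> T A"
proof (rule Coprod.coproduct)
  show "|{} :: 'u set| <o \<kappa>" by (rule finite_small) simp
  show "is_coproduct T {} (\<lambda>_. Y) Y (\<lambda>_. Id T Y)"
  proof (rule coproductI)
    show "\<exists>h. arr h Y W \<and> (\<forall>i\<in>{}. h \<cdot> Id T Y = f i)" if "W \<in> Ob T" for W f
      using arr_Null[OF is_zero_Ob[OF assms] that] by blast
    show "h = k" if "arr h Y W" "arr k Y W" for h k W
      using vanD[OF zero_van(1)[OF assms]] that arrD(2) by metis
  qed (use is_zero_Ob[OF assms] in auto)
qed auto

text \<open>The \<open>k\<close> covers use copies of M[-i] with t - k + 1 \<le> i \<le> t, which
  the side condition keeps inside the interval from \<open>s\<close> to \<open>t\<close>.\<close>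

lemma tower: assumes X: "X \<in> LE t"
  shows "s \<le> t - int k + 1 \<Longrightarrow> \<exists>Y\<in>Coprod \<kappa> T {Sh T (-i) M | i. s \<le> i \<and> i \<le> t}.
    \<exists>U\<in>LE (t - int k). \<exists>f g h. Tri T Y X U f g h"
proof (induction k)
  case 0
  obtain N where N: "is_zero T N" using ex_zero by blast
  have "is_zero T (Sh T (-1) N)" using N zero_Sh is_zero_Ob by blast
  moreover have "X \<in> LE (t - int 0)" using X by simp
  ultimately show ?case using Tri_rot_back[OF TR1_Id[OF LE_Ob[OF X] N]] zero_Coprod by blast
next
  case (Suc k)
  let ?A = "{Sh T (-i) M | i. s \<le> i \<and> i \<le> t}"
  let ?m = "t - int k"
  obtain Y U f g h where Y: "Y \<in> Coprod \<kappa> T ?A" and U: "U \<in> LE ?m" and t1: "Tri T Y X U f g h"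
    using Suc by force
  obtain S U' a b c where S: "M_coprod S" and U': "U' \<in> LE (?m - 1)" and t2: "Tri T (Sh T (-?m) S) U U' a b c"
    using cover[OF U] by blast
  note o1 = Tri_Ob[OF t1] and o2 = Tri_Ob[OF t2]
  \<comment> \<open>\<open>D\<close> is the cone of X -> U -> U'. The octahedral axiom places it
    between Y[1] and the shifted cover of \<open>U\<close>, so D[-1] is the next stage of the
    tower.\<close>
  obtain D w w' where t3: "Tri T X U' D (b \<cdot> g) w w'" using ex_cone[OF arr_Comp[OF Tri_arr(2)[OF t1] Tri_arr(2)[OF t2]]] by blast
  obtain a' b' where t4: "Tri T (Sh T 1 Y) D (Sh T 1 (Sh T (-?m) S)) a' b' (ShM T 1 h \<cdot> Neg T (Sh T 1 (Sh T (-?m) S)) (Sh T 1 U) (ShM T 1 a))"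
    using TR4[OF Tri_rot[OF t1] Tri_rot[OF t2] t3] by blast
  obtain a2 b2 c2 where t5: "Tri T Y (Sh T (-1) D) (Sh T (-?m) S) a2 b2 c2"
    using Tri_Sh[OF t4, of "-1"] unfolding Sh_inverse(2)[OF o1(1)] Sh_inverse(2)[OF o2(1)] by blast
  obtain I :: "'u set" and \<iota> where I: "|I| <o \<kappa>" "is_coproduct T I (\<lambda>_. M) S \<iota>" using S M_coprod_def by blast
  have "Sh T (-?m) S \<in> Coprod \<kappa> T ?A"
  proof (rule Coprod.coproduct[OF I(1) _ Sh_coprod[OF I(2)]])
    show "Sh T (-?m) M \<in> Coprod \<kappa> T ?A" using Suc.prems by (intro Coprod.base) force
  qed
  then have "Sh T (-1) D \<in> Coprod \<kappa> T ?A" using Coprod.extension[OF Y _ t5] by blast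
  then show ?case using Tri_rot_back[OF t3] U' by (force simp: algebra_simps)
qed

text \<open>Once the remainder \<open>U\<close> of the tower lies in \<open>LE (-n-1)\<close>, the
  bound \<open>pd_le X n\<close> kills X -> U, so the identity of \<open>X\<close> lifts to
  \<open>Y\<close>.\<close>

lemma in_gen_interval: assumes X: "X \<in> LE t" and p: "pd_le X n"
  shows "X \<in> gen_interval \<kappa> T M (-n) t"
proof -
  let ?A = "{Sh T (-i) M | i. -n \<le> i \<and> i \<le> t}"
  \<comment> \<open>\<open>k\<close> solves t - k = -n - 1. If t + n + 1 \<le> 0, no cover is taken,
    since \<open>X\<close> itself already lies that low and a zero \<open>Y\<close> serves.\<close>
  define k where "k = nat (t + n + 1)"
  have "\<exists>Y\<in>Coprod \<kappa> T ?A. \<exists>U\<in>LE (-n-1). \<exists>f g h. Tri T Y X U f g h"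
  proof (cases "t + n + 1 \<le> 0")
    case True
    obtain N where N: "is_zero T N" using ex_zero by blast
    have "is_zero T (Sh T (-1) N)" using N zero_Sh is_zero_Ob by blast
    moreover have "X \<in> LE (-n-1)" using LE_mono[OF X] True by simp
    ultimately show ?thesis using Tri_rot_back[OF TR1_Id[OF LE_Ob[OF X] N]] zero_Coprod by blast
  next
    case False
    then show ?thesis using tower[OF X, of "-n" k] by (simp add: k_def)
  qed
  then obtain Y U f g h where Y: "Y \<in> Coprod \<kappa> T ?A" and U: "U \<in> LE (-n-1)" and t: "Tri T Y X U f g h" by blast
  note ob = Tri_Ob[OF t]
  have "Sh T (-n-1) U \<in> LE 0" using LE_Sh[OF ob(3), of "-n-1" 0] U by simp
  then have "van X (Sh T (n + 1) (Sh T (-n-1) U))" using p by (simp add: pd_le_def)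
  then have "van X U" by (simp add: Sh_Sh Sh_zero ob)
  then have "g \<cdot> Id T X = Null T X U" using vanD arr_Comp[OF arr_Id[OF ob(2)] Tri_arr(2)[OF t]] by blast
  then obtain q where "arr q X Y" "f \<cdot> q = Id T X" using Tri_lift[OF t arr_Id[OF ob(2)]] by blast
  then have "retract X Y" using retractI Tri_arr(1)[OF t] by blast
  then show ?thesis using Y ob(2) unfolding gen_interval_def smd_def direct_summand_iff by blast
qed

section \<open>Comparison of FPD with Findim and with inf M\<close>

lemma FPD_le_Findim: "FPD T M \<le> Findim \<kappa> T M"
  unfolding Findim_def
proof (rule Inf_greatest, clarify)
  fix n :: nat assume a: "GE 0 \<inter> T_sb \<kappa> T M \<subseteq> (\<Union>m\<in>{0..}. Sh T (int n) ` gen_interval \<kappa> T M 0 m)"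
  show "FPD T M \<le> ereal (real n)" unfolding FPD_le_iff
  proof (intro ballI impI)
    fix X assume X: "X \<in> T_bd T M \<inter> GE 0" and "\<exists>k. pd_le X k"
    then obtain k m where k: "pd_le X k" and m: "X \<in> LE m" using T_bd_GE_iff by blast
    \<comment> \<open>A nonnegative common bound puts \<open>X\<close> into one of the symmetric
      intervals that define \<open>T_sb\<close>.\<close>
    define i where "i = max 0 (max k m)"
    have "X \<in> gen_interval \<kappa> T M (-i) i"
      using in_gen_interval[OF LE_mono[OF m] pd_le_mono[OF k]] by (simp add: i_def)
    then have "X \<in> T_sb \<kappa> T M" unfolding T_sb_def i_def by auto
    then obtain m Y where "Y \<in> gen_interval \<kappa> T M 0 m" "X = Sh T (int n) Y" using a X by blast
    then show "pd_le X \<lfloor>real n\<rfloor>" using gen_interval_bounds[of Y 0 m] pd_le_Sh[OF LE_Ob, of Y m "int n" "int n"] by simp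
  qed
qed

text \<open>\<open>Findim\<close> ranges over natural numbers while \<open>FPD\<close> may be
  negative. The hypothesis 0 \<le> r makes floor(r) an admissible \<open>n\<close>; it is the origin
  of the maximum with 0.\<close>

lemma Findim_le: assumes "FPD T M \<le> ereal r" "0 \<le> r" shows "Findim \<kappa> T M \<le> ereal r"
proof -
  define n where "n = nat \<lfloor>r\<rfloor>"
  have n: "int n = \<lfloor>r\<rfloor>" using assms(2) by (simp add: n_def)
  have "GE 0 \<inter> T_sb \<kappa> T M \<subseteq> (\<Union>m\<in>{0..}. Sh T (int n) ` gen_interval \<kappa> T M 0 m)"
  proof
    fix X assume X: "X \<in> GE 0 \<inter> T_sb \<kappa> T M"
    then obtain i where i: "i \<ge> 0" "X \<in> gen_interval \<kappa> T M (-i) i" by (auto simp: T_sb_def)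
    then have XL: "X \<in> LE i" and "pd_le X i" using gen_interval_bounds[OF i(2)] by auto
    then have "pd_le X (int n)" using assms(1) X unfolding FPD_le_iff n using T_bd_GE_iff by blast
    then have "pd_le (Sh T (- int n) X) 0" using pd_le_Sh[OF LE_Ob[OF XL]] by simp
    moreover have "Sh T (- int n) X \<in> LE (i + int n)" using LE_Sh[OF LE_Ob[OF XL]] XL by simp
    ultimately have "Sh T (- int n) X \<in> gen_interval \<kappa> T M 0 (i + int n)" using in_gen_interval by force
    moreover have "X = Sh T (int n) (Sh T (- int n) X)" using Sh_inverse(1)[OF LE_Ob[OF XL]] by simp
    moreover have "i + int n \<in> {0..}" using i by simp
    ultimately show "X \<in> (\<Union>m\<in>{0..}. Sh T (int n) ` gen_interval \<kappa> T M 0 m)" by blast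
  qed
  then have "Findim \<kappa> T M \<le> ereal (real n)" unfolding Findim_def by (intro Inf_lower) blast
  also have "\<dots> \<le> ereal r" using of_int_floor_le[of r] unfolding n[symmetric] by simp
  finally show ?thesis .
qed

lemma Findim_le_FPD: "Findim \<kappa> T M \<le> max 0 (FPD T M)"
  by (rule ereal_le_real) (use Findim_le in auto)

text \<open>M[l] is a test object for \<open>FPD\<close>: it lies in \<open>GE 0\<close>, and its
  projective dimension is exactly \<open>l\<close> because Hom(M, M) is nonzero.\<close>

lemma le_FPD: assumes "M \<in> GE l" "\<not> is_zero T M" shows "ereal (of_int l) \<le> FPD T M"
proof (rule ereal_le_real)
  fix r assume r: "FPD T M \<le> ereal r"
  have "Sh T l M \<in> GE 0" "Sh T l M \<in> LE (-l)" "pd_le (Sh T l M) l"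
    using GE_Sh[OF M_Ob, of l 0] LE_Sh[OF M_Ob, of l "-l"] M_LE pd_le_Sh[OF M_Ob, of l l] pd_le_M assms by simp_all
  then have "pd_le (Sh T l M) \<lfloor>r\<rfloor>" using r FPD_le_iff T_bd_GE_iff by blast
  then have "pd_le M (\<lfloor>r\<rfloor> - l)" using pd_le_Sh[OF M_Ob] by simp
  then have "\<lfloor>r\<rfloor> - l < 0 \<Longrightarrow> van M (Sh T 0 M)" using M_LE by (simp add: pd_le_def)
  then have "l \<le> \<lfloor>r\<rfloor>" using assms(2) zero_if_van[OF M_Ob] M_Ob by (force simp: Sh_zero)
  then show "ereal (of_int l) \<le> ereal r" by (simp add: le_floor_iff)
qed

lemma coh_inf_M_le: assumes "\<not> is_zero T M" shows "coh_inf T M M \<le> 0"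
proof -
  have "\<not> van M (Sh T 0 M)" using assms zero_if_van[OF M_Ob] M_Ob by (auto simp: Sh_zero)
  then have "M \<notin> LE (-1)" by (auto simp: LE_iff M_Ob intro!: exI[of _ 0])
  then have "\<not> is_zero T (coh T M 0 M)" using coh_zero_iff_LE[OF M_LE] by simp
  then have "coh_inf T M M \<le> ereal (of_int 0)" unfolding coh_inf_def by (intro Inf_lower) blast
  then show ?thesis by (simp add: zero_ereal_def)
qed

text \<open>FPD \<le> FPD - inf M follows from inf M \<le> 0, and 0 \<le> FPD - inf M from the test
  object M[l]. Cohomological degrees are integers, so a real value \<open>r\<close> of inf M allows
  l = ceiling(r).\<close>

lemma max_FPD_le: assumes "\<not> is_zero T M" shows "max 0 (FPD T M) \<le> FPD T M - coh_inf T M M"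
proof (cases "coh_inf T M M")
  case PInf
  then show ?thesis using coh_inf_M_le[OF assms] by simp
next
  case MInf
  then show ?thesis by (cases "FPD T M") auto
next
  case (real r)
  then have r: "r \<le> 0" using coh_inf_M_le[OF assms] by simp
  have "is_zero T (coh T M l M)" if "l < \<lceil>r\<rceil>" for l
  proof (rule ccontr)
    assume "\<not> ?thesis"
    then have "coh_inf T M M \<le> ereal (of_int l)" unfolding coh_inf_def by (intro Inf_lower) blast
    then show False using that real by (simp add: less_ceiling_iff)
  qed
  then have "M \<in> GE \<lceil>r\<rceil>" using GE_iff_coh[OF M_Ob] by blast
  then have "ereal (of_int \<lceil>r\<rceil>) \<le> FPD T M" using le_FPD assms by blast
  moreover have "ereal r \<le> ereal (of_int \<lceil>r\<rceil>)" by simp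
  ultimately have "ereal r \<le> FPD T M" by (rule order_trans[rotated])
  then show ?thesis using r real by (cases "FPD T M") auto
qed

section \<open>FPD against silp and gpd\<close>

lemma FPD_le_silp: "FPD T M \<le> silp \<kappa> T M"
proof (rule ereal_le_real)
  fix r assume r: "silp \<kappa> T M \<le> ereal r"
  define n where "n = \<lfloor>r\<rfloor>"
  show "FPD T M \<le> ereal r" unfolding FPD_le_iff n_def[symmetric]
  proof (intro ballI impI)
    fix X assume X: "X \<in> T_bd T M \<inter> GE 0" and "\<exists>k. pd_le X k"
    then obtain d where d: "pd_le X d" by blast
    have Xo: "X \<in> Ob T" using X GE_Ob by blast
    \<comment> \<open>\<open>k\<close> bounds the number of covers that push the degree above
      \<open>d\<close>. A cover replaces \<open>U\<close> by U1[-1] and raises \<open>j\<close> by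
      one; its term \<open>S\<close> contributes nothing above degree \<open>n\<close>, by the bound
      on injective dimensions and because \<open>X\<close> lies in \<open>GE 0\<close>.\<close>
    have v: "van X (Sh T j U)" if "U \<in> LE 0" "j > n" "j + int k > d" for U j k
      using that
    proof (induction k arbitrary: U j)
      case 0
      then show ?case using d by (simp add: pd_le_def)
    next
      case (Suc k)
      obtain S U1 f g h where S: "M_coprod S" and U1: "U1 \<in> LE (-1)" and t: "Tri T (Sh T 0 S) U U1 f g h"
        using cover[OF Suc.prems(1)] by auto
      have So: "S \<in> Ob T" using LE_Ob[OF M_coprod_LE[OF S]] .
      obtain f' g' h' where t': "Tri T (Sh T j S) (Sh T j U) (Sh T j U1) f' g' h'"
        using Tri_Sh[OF t, of j] by (auto simp: Sh_zero So)
      have "id_le S n" using r S M_coprod_Add unfolding silp_le_iff n_def by blast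
      then have v1: "van X (Sh T j S)" using X Suc.prems by (auto simp: id_le_def)
      have U1o: "U1 \<in> Ob T" using LE_Ob[OF U1] .
      have "Sh T (-1) U1 \<in> LE 0" using U1 LE_Sh[OF U1o] by simp
      then have "van X (Sh T (j + 1) (Sh T (-1) U1))" using Suc.IH Suc.prems by simp
      then have "van X (Sh T j U1)" by (simp add: Sh_Sh U1o)
      then show ?case using Tri_van_mid[OF t' v1] Xo by blast
    qed
    then show "pd_le X n" unfolding pd_le_def
    proof (intro ballI allI impI)
      fix U j assume "U \<in> LE 0" "j > n"
      then show "van X (Sh T j U)" using v[of U j "nat (d - j + 1)"] by simp
    qed
  qed
qed

lemma FPD_eq_gpd: assumes "gpd T M < \<infinity>" shows "FPD T M = gpd T M"
proof -
  have "projdim T M X < \<infinity>" if "X \<in> T_bd T M \<inter> GE 0" for X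
    using assms that by (intro le_less_trans[OF _ assms]) (auto simp: gpd_def intro!: Sup_upper)
  then have "{projdim T M X | X. X \<in> T_bd T M \<inter> GE 0 \<and> projdim T M X < \<infinity>} = {projdim T M X | X. X \<in> T_bd T M \<inter> GE 0}"
    by blast
  then show ?thesis by (simp add: FPD_def gpd_def)
qed

section \<open>Bounding injective dimensions by truncation\<close>

text \<open>Injectivity on Hom(M[i], -) for all i at once passes from \<open>f\<close> to f[1]. It
  is needed for connecting arrows of cones, which end in A[1].\<close>

lemma inj_on_M_shift:
  assumes f: "arr f A B"
    and inj: "\<And>i x. \<lbrakk>arr x (Sh T i M) A; f \<cdot> x = Null T (Sh T i M) B\<rbrakk> \<Longrightarrow> x = Null T (Sh T i M) A"
    and y: "arr y (Sh T i M) (Sh T 1 A)" "ShM T 1 f \<cdot> y = Null T (Sh T i M) (Sh T 1 B)"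
  shows "y = Null T (Sh T i M) (Sh T 1 A)"
proof -
  note Ao = arrD(1)[OF f] and Bo = arrD(2)[OF f]
  define x where "x = ShM T (-1) y"
  have Mi: "Sh T 1 (Sh T (i - 1) M) = Sh T i M" by (simp add: Sh_Sh M_Ob)
  have x: "arr x (Sh T (i - 1) M) A" using arr_ShM[OF y(1), of "-1"] by (simp add: x_def Sh_Sh Sh_zero M_Ob Ao)
  have xy: "ShM T 1 x = y" using ShM_inverse(1)[OF y(1), of 1] by (simp add: x_def)
  have "ShM T 1 (f \<cdot> x) = ShM T 1 (Null T (Sh T (i - 1) M) B)"
    using ShM_comp[OF x f, of 1] xy y(2) ShM_Null[OF Sh_Ob[OF M_Ob] Bo] Mi by simp
  then have "f \<cdot> x = Null T (Sh T (i - 1) M) B"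
    using ShM_eq_iff[OF arr_Comp[OF x f] arr_Null[OF Sh_Ob[OF M_Ob] Bo]] by blast
  then show ?thesis using inj[OF x] xy ShM_Null[OF Sh_Ob[OF M_Ob] Ao, of 1] Mi by simp
qed

text \<open>An arrow e from M[-i] to \<open>D\<close> has \<open>h \<cdot> e\<close> = 0 by
  injectivity one shift up, so it comes from \<open>B\<close>, hence from \<open>A\<close>, hence
  vanishes. Generation then makes \<open>D\<close> zero.\<close>

lemma zero_cone:
  assumes t: "Tri T A B D f g h"
    and inj: "\<And>i x. \<lbrakk>arr x (Sh T i M) A; f \<cdot> x = Null T (Sh T i M) B\<rbrakk> \<Longrightarrow> x = Null T (Sh T i M) A"
    and surj: "\<And>i y. arr y (Sh T i M) B \<Longrightarrow> \<exists>x. arr x (Sh T i M) A \<and> f \<cdot> x = y"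
  shows "is_zero T D"
proof (rule zero_if_all_van)
  note ob = Tri_Ob[OF t] and ar = Tri_arr[OF t]
  show "D \<in> Ob T" using ob(3) .
  fix i
  let ?N = "Sh T (-i) M"
  have N: "?N \<in> Ob T" using Sh_Ob[OF M_Ob] .
  have "e = Null T ?N D" if e: "arr e ?N D" for e
  proof -
    note he = arr_Comp[OF e ar(3)] and f1 = arr_ShM[OF ar(1), of 1]
    have "ShM T 1 f \<cdot> (h \<cdot> e) = Null T ?N (Sh T 1 B)"
      using comp_assoc[OF e ar(3) f1] Tri_comp3[OF t] Null_comp[OF e Sh_Ob[OF ob(2)]] by simp
    then have "h \<cdot> e = Null T ?N (Sh T 1 A)" using inj_on_M_shift[OF ar(1) inj he] by blast
    then obtain y where y: "arr y ?N B" "g \<cdot> y = e" using Tri_lift2[OF t e] by blast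
    then obtain x where x: "arr x ?N A" "f \<cdot> x = y" using surj by blast
    have "e = (g \<cdot> f) \<cdot> x" using y x comp_assoc[OF x(1) ar(1,2)] by simp
    then show ?thesis using Tri_comp[OF t] Null_comp[OF x(1) ob(3)] by simp
  qed
  then have "van ?N D" using van_iff[OF N ob(3)] by blast
  then show "van M (Sh T i D)" using van_Sh_left[OF M_Ob ob(3), of "-i"] by simp
qed

text \<open>
  \<open>V\<close> is the homotopy colimit of its truncations: the cone of \<open>1 - shift\<close> on their coproduct maps to
  \<open>V\<close> by an arrow with zero cone.
\<close>

lemma van_from_truncations:
  assumes V: "V \<in> Ob T" and W: "W \<in> Ob T"
    and t: "\<And>k :: nat. Tri T (X k) V (B k) (c k) (d k) (e k)"
    and X: "\<And>k. X k \<in> LE (int k)" and B: "\<And>k. B k \<in> GE (int k + 1)"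
    and v: "\<And>k. van (X k) W" "\<And>k. van (X k) (Sh T (-1) W)"
  shows "van V W"
proof -
  have Xo: "X k \<in> Ob T" for k using LE_Ob[OF X] .
  have ca: "arr (c k) (X k) V" and da: "arr (d k) V (B k)" for k using Tri_arr[OF t] by blast+
  \<comment> \<open>The transition arrows exist because X(k) lies in \<open>LE k\<close> and B(k+1)
    in \<open>GE (k + 2)\<close>.\<close>
  have "\<exists>\<tau>. arr \<tau> (X k) (X (Suc k)) \<and> c (Suc k) \<cdot> \<tau> = c k" for k
    by (rule Tri_lift[OF t ca vanD[OF _ arr_Comp[OF ca da]]]) (use van_LE_GE[OF X B] in simp)
  then obtain \<tau> where \<tau>: "\<And>k. arr (\<tau> k) (X k) (X (Suc k))" "\<And>k. c (Suc k) \<cdot> \<tau> k = c k" by metis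
  obtain S \<iota> where co: "is_coproduct T (UNIV :: nat set) X S \<iota>" using small_coproduct[OF nat_small] Xo by metis
  have So: "S \<in> Ob T" using coprod_Ob[OF co] .
  have \<iota>: "arr (\<iota> k) (X k) S" for k using coprod_inj[OF co] by simp
  have \<iota>\<tau>: "arr (\<iota> (Suc k) \<cdot> \<tau> k) (X k) S" for k using arr_Comp[OF \<tau>(1) \<iota>] .
  obtain p where p: "arr p S V" "\<And>k. p \<cdot> \<iota> k = c k" using coprod_desc[OF co V, of c] ca by blast
  \<comment> \<open>\<open>s\<close> is 1 - shift, the arrow whose cone is the telescope.\<close>
  obtain s where s: "arr s S S" "\<And>k. s \<cdot> \<iota> k = diff (X k) S (\<iota> k) (\<iota> (Suc k) \<cdot> \<tau> k)"
    using coprod_desc[OF co So, of "\<lambda>k. diff (X k) S (\<iota> k) (\<iota> (Suc k) \<cdot> \<tau> k)"] arr_diff[OF \<iota> \<iota>\<tau>] by blast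
  have ps: "p \<cdot> s = Null T S V"
  proof (rule coprod_eqI[OF co arr_Comp[OF s(1) p(1)] arr_Null[OF So V]])
    fix k
    have "p \<cdot> (\<iota> (Suc k) \<cdot> \<tau> k) = c k" using comp_assoc[OF \<tau>(1)[of k] \<iota> p(1)] p(2) \<tau>(2) by simp
    then have "p \<cdot> (s \<cdot> \<iota> k) = Null T (X k) V"
      using s(2) comp_diff[OF \<iota>[of k] \<iota>\<tau>[of k] p(1)] p(2) diff_eq_Null[OF ca ca] by simp
    then show "p \<cdot> s \<cdot> \<iota> k = Null T S V \<cdot> \<iota> k" using comp_assoc[OF \<iota> s(1) p(1)] Null_comp[OF \<iota> V] by simp
  qed
  have "\<forall>j. \<exists>q. arr q S (X j) \<and> (\<forall>k. q \<cdot> \<iota> k = (if k = j then Id T (X k) else Null T (X k) (X j)))"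
  proof
    fix j
    have "arr (if k = j then Id T (X k) else Null T (X k) (X j)) (X k) (X j)" for k
      using arr_Id[OF Xo] arr_Null[OF Xo Xo] by simp
    then show "\<exists>q. arr q S (X j) \<and> (\<forall>k. q \<cdot> \<iota> k = (if k = j then Id T (X k) else Null T (X k) (X j)))"
      using coprod_desc[OF co Xo[of j], of "\<lambda>k. if k = j then Id T (X k) else Null T (X k) (X j)"] by blast
  qed
  then obtain \<pi> where \<pi>: "\<And>j. arr (\<pi> j) S (X j)"
    and \<pi>\<iota>: "\<And>j k. \<pi> j \<cdot> \<iota> k = (if k = j then Id T (X k) else Null T (X k) (X j))" by metis
  have \<pi>s: "\<pi> j \<cdot> (s \<cdot> \<iota> k) = diff (X k) (X j) (\<pi> j \<cdot> \<iota> k) ((\<pi> j \<cdot> \<iota> (Suc k)) \<cdot> \<tau> k)" for j k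
    using s(2) comp_diff[OF \<iota>[of k] \<iota>\<tau>[of k] \<pi>] comp_assoc[OF \<tau>(1)[of k] \<iota> \<pi>] by simp
  have \<pi>0: "\<pi> 0 \<cdot> s = \<pi> 0"
  proof (rule coprod_eqI[OF co arr_Comp[OF s(1) \<pi>] \<pi>])
    fix k
    have "\<pi> 0 \<cdot> (s \<cdot> \<iota> k) = \<pi> 0 \<cdot> \<iota> k"
      unfolding \<pi>s \<pi>\<iota>[of 0 "Suc k"] using Null_comp[OF \<tau>(1)[of k] Xo] diff_Null[OF arr_Comp[OF \<iota> \<pi>]] by simp
    then show "\<pi> 0 \<cdot> s \<cdot> \<iota> k = \<pi> 0 \<cdot> \<iota> k" using comp_assoc[OF \<iota> s(1) \<pi>] by simp
  qed
  have \<pi>\<tau>: "arr (\<tau> j \<cdot> \<pi> j) S (X (Suc j))" for j using arr_Comp[OF \<pi> \<tau>(1)] .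
  have \<pi>Suc: "\<pi> (Suc j) \<cdot> s = diff S (X (Suc j)) (\<pi> (Suc j)) (\<tau> j \<cdot> \<pi> j)" for j
  proof (rule coprod_eqI[OF co arr_Comp[OF s(1) \<pi>] arr_diff[OF \<pi> \<pi>\<tau>]])
    fix k
    have "(\<pi> (Suc j) \<cdot> \<iota> (Suc k)) \<cdot> \<tau> k = \<tau> j \<cdot> (\<pi> j \<cdot> \<iota> k)"
      unfolding \<pi>\<iota> using Id_comp[OF \<tau>(1)] comp_Id[OF \<tau>(1)] Null_comp[OF \<tau>(1)[of k] Xo] comp_Null[OF \<tau>(1)[of j] Xo] by simp
    then have "\<pi> (Suc j) \<cdot> (s \<cdot> \<iota> k) = diff S (X (Suc j)) (\<pi> (Suc j)) (\<tau> j \<cdot> \<pi> j) \<cdot> \<iota> k"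
      using \<pi>s diff_comp[OF \<iota>[of k] \<pi> \<pi>\<tau>] comp_assoc[OF \<iota>[of k] \<pi> \<tau>(1)] by simp
    then show "\<pi> (Suc j) \<cdot> s \<cdot> \<iota> k = diff S (X (Suc j)) (\<pi> (Suc j)) (\<tau> j \<cdot> \<pi> j) \<cdot> \<iota> k"
      using comp_assoc[OF \<iota> s(1) \<pi>] by simp
  qed
  \<comment> \<open>\<open>E K\<close> is the projection of the coproduct onto its first \<open>K\<close> summands.\<close>
  define E where "E = rec_nat (Null T S S) (\<lambda>K u. Add T u (\<iota> K \<cdot> \<pi> K))"
  have E0: "E 0 = Null T S S" and ES: "E (Suc K) = Add T (E K) (\<iota> K \<cdot> \<pi> K)" for K by (simp_all add: E_def)
  have \<iota>\<pi>: "arr (\<iota> K \<cdot> \<pi> K) S S" for K using arr_Comp[OF \<pi> \<iota>] .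
  have Ea: "arr (E K) S S" for K
    by (induction K) (simp_all add: E0 ES arr_Null So arr_Add \<iota>\<pi>)
  have E\<iota>: "E K \<cdot> \<iota> k = (if k < K then \<iota> k else Null T (X k) S)" for K k
  proof (induction K)
    case 0
    then show ?case using Null_comp[OF \<iota>[of k] So] by (simp add: E0)
  next
    case (Suc K)
    have "(\<iota> K \<cdot> \<pi> K) \<cdot> \<iota> k = (if k = K then \<iota> k else Null T (X k) S)"
      using comp_assoc[OF \<iota>[of k] \<pi> \<iota>[of K]] \<pi>\<iota> comp_Id[OF \<iota>] comp_Null[OF \<iota>[of K] Xo] by simp
    then show ?case using Add_comp[OF \<iota>[of k] Ea \<iota>\<pi>] Suc Null_Add[OF \<iota>] Add_Null[OF \<iota>] Add_Null[OF arr_Null[OF Xo So]]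
      by (simp add: ES)
  qed
  \<comment> \<open>If \<open>s \<cdot> x\<close> = 0, the components of \<open>x\<close> vanish one
    after the other: \<open>\<pi> 0 \<cdot> s\<close> = \<open>\<pi> 0\<close>, and each further
    component is the image of the previous one under \<open>\<tau>\<close>. By compactness
    \<open>x\<close> = \<open>E K \<cdot> x\<close> for large \<open>K\<close>, and the latter is
    built from components.\<close>
  have inj_s: "x = Null T (Sh T i M) S" if x: "arr x (Sh T i M) S" and z: "s \<cdot> x = Null T (Sh T i M) S" for i x
  proof -
    let ?N = "Sh T i M"
    have N: "?N \<in> Ob T" using Sh_Ob[OF M_Ob] .
    have \<pi>x: "\<pi> j \<cdot> x = Null T ?N (X j)" for j
    proof (induction j)
      case 0
      show ?case using comp_assoc[OF x s(1) \<pi>[of 0]] \<pi>0 z comp_Null[OF \<pi> N] by simp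
    next
      case (Suc j)
      have "\<tau> j \<cdot> \<pi> j \<cdot> x = Null T ?N (X (Suc j))" using comp_assoc[OF x \<pi> \<tau>(1)] Suc comp_Null[OF \<tau>(1) N] by simp
      then have "(\<pi> (Suc j) \<cdot> s) \<cdot> x = \<pi> (Suc j) \<cdot> x"
        unfolding \<pi>Suc using diff_comp[OF x \<pi> \<pi>\<tau>] diff_Null[OF arr_Comp[OF x \<pi>]] by simp
      then show ?case using comp_assoc[OF x s(1) \<pi>] z comp_Null[OF \<pi> N] by simp
    qed
    have Ex: "E K \<cdot> x = Null T ?N S" for K
    proof (induction K)
      case 0
      show ?case using Null_comp[OF x So] by (simp add: E0)
    next
      case (Suc K)
      have "(\<iota> K \<cdot> \<pi> K) \<cdot> x = Null T ?N S" using comp_assoc[OF x \<pi> \<iota>] \<pi>x comp_Null[OF \<iota> N] by simp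
      then show ?case using Add_comp[OF x Ea \<iota>\<pi>] Suc Add_Null[OF arr_Null[OF N So]] by (simp add: ES)
    qed
    have "\<exists>K0. \<forall>K\<ge>K0. E K \<cdot> x = x"
    proof (rule compact_induct[OF M_compact co nat_small x, of "\<lambda>x. \<exists>K0. \<forall>K\<ge>K0. E K \<cdot> x = x"])
      show "\<exists>K0. \<forall>K\<ge>K0. E K \<cdot> Null T ?N S = Null T ?N S" using comp_Null[OF Ea N] by blast
    next
      fix k q assume q: "arr q ?N (X k)"
      have "E K \<cdot> (\<iota> k \<cdot> q) = \<iota> k \<cdot> q" if "K \<ge> Suc k" for K
        using comp_assoc[OF q \<iota> Ea, of K] E\<iota>[of K k] that by simp
      then show "\<exists>K0. \<forall>K\<ge>K0. E K \<cdot> (\<iota> k \<cdot> q) = \<iota> k \<cdot> q" by blast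
    next
      fix f g assume f: "arr f ?N S" and g: "arr g ?N S" and "\<exists>K0. \<forall>K\<ge>K0. E K \<cdot> f = f" "\<exists>K0. \<forall>K\<ge>K0. E K \<cdot> g = g"
      then obtain K0 K1 where K: "\<And>K. K \<ge> K0 \<Longrightarrow> E K \<cdot> f = f" "\<And>K. K \<ge> K1 \<Longrightarrow> E K \<cdot> g = g" by blast
      have "E K \<cdot> Add T f g = Add T f g" if "K \<ge> max K0 K1" for K
        using comp_Add[OF f g Ea, of K] K that by simp
      then show "\<exists>K0. \<forall>K\<ge>K0. E K \<cdot> Add T f g = Add T f g" by blast
    qed
    then show ?thesis using Ex by (metis order_refl)
  qed
  \<comment> \<open>Modulo the image of \<open>s\<close>, the arrows
    \<open>\<iota> K \<cdot> r\<close> and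
    \<open>\<iota> (Suc K) \<cdot> (\<tau> K \<cdot> r)\<close> agree. By compactness
    \<open>x\<close> is thus congruent to an arrow through a single X(K). Requiring this for all
    large \<open>K\<close> lets two summands meet at a common stage.\<close>
  have ker_p: "\<exists>y. arr y (Sh T i M) S \<and> s \<cdot> y = x" if x: "arr x (Sh T i M) S" and z: "p \<cdot> x = Null T (Sh T i M) V" for i x
  proof -
    let ?N = "Sh T i M"
    have N: "?N \<in> Ob T" using Sh_Ob[OF M_Ob] .
    let ?P = "\<lambda>x. \<exists>K0. \<forall>K\<ge>K0. \<exists>y q. arr y ?N S \<and> arr q ?N (X K) \<and> x = Add T (s \<cdot> y) (\<iota> K \<cdot> q)"
    have "?P x"
    proof (rule compact_induct[OF M_compact co nat_small x, of ?P])
      have "Null T ?N S = Add T (s \<cdot> Null T ?N S) (\<iota> K \<cdot> Null T ?N (X K))" for K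
        using comp_Null[OF s(1) N] comp_Null[OF \<iota> N] Add_Null[OF arr_Null[OF N So]] by simp
      then show "?P (Null T ?N S)" using arr_Null[OF N So] arr_Null[OF N Xo] by blast
    next
      fix k q assume q: "arr q ?N (X k)"
      have "\<exists>y r. arr y ?N S \<and> arr r ?N (X K) \<and> \<iota> k \<cdot> q = Add T (s \<cdot> y) (\<iota> K \<cdot> r)" if "K \<ge> k" for K
        using that
      proof (induction K rule: dec_induct)
        case base
        have "\<iota> k \<cdot> q = Add T (s \<cdot> Null T ?N S) (\<iota> k \<cdot> q)"
          using comp_Null[OF s(1) N] Null_Add[OF arr_Comp[OF q \<iota>]] by simp
        then show ?case using arr_Null[OF N So] q by blast
      next
        case (step K)
        then obtain y r where yr: "arr y ?N S" "arr r ?N (X K)" "\<iota> k \<cdot> q = Add T (s \<cdot> y) (\<iota> K \<cdot> r)" by blast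
        note \<iota>r = arr_Comp[OF yr(2) \<iota>] and \<tau>r = arr_Comp[OF yr(2) \<tau>(1)] and sy = arr_Comp[OF yr(1) s(1)]
        have "s \<cdot> (\<iota> K \<cdot> r) = diff ?N S (\<iota> K \<cdot> r) (\<iota> (Suc K) \<cdot> (\<tau> K \<cdot> r))"
          using comp_assoc[OF yr(2) \<iota> s(1)] s(2) diff_comp[OF yr(2) \<iota> \<iota>\<tau>] comp_assoc[OF yr(2) \<tau>(1) \<iota>] by simp
        then have "Add T (s \<cdot> (\<iota> K \<cdot> r)) (\<iota> (Suc K) \<cdot> (\<tau> K \<cdot> r)) = \<iota> K \<cdot> r"
          using diff_Add[OF \<iota>r arr_Comp[OF \<tau>r \<iota>]] by simp
        then have "\<iota> k \<cdot> q = Add T (s \<cdot> Add T y (\<iota> K \<cdot> r)) (\<iota> (Suc K) \<cdot> (\<tau> K \<cdot> r))"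
          using yr(3) comp_Add[OF yr(1) \<iota>r s(1)] Add_assoc[OF sy arr_Comp[OF \<iota>r s(1)] arr_Comp[OF \<tau>r \<iota>]] by simp
        then show ?case using arr_Add[OF yr(1) \<iota>r] \<tau>r by blast
      qed
      then show "?P (\<iota> k \<cdot> q)" by blast
    next
      fix f g assume f: "arr f ?N S" and g: "arr g ?N S" and "?P f" "?P g"
      then obtain K0 K1 where K0: "\<And>K. K \<ge> K0 \<Longrightarrow> \<exists>y q. arr y ?N S \<and> arr q ?N (X K) \<and> f = Add T (s \<cdot> y) (\<iota> K \<cdot> q)"
        and K1: "\<And>K. K \<ge> K1 \<Longrightarrow> \<exists>y q. arr y ?N S \<and> arr q ?N (X K) \<and> g = Add T (s \<cdot> y) (\<iota> K \<cdot> q)" by blast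
      have "\<exists>y q. arr y ?N S \<and> arr q ?N (X K) \<and> Add T f g = Add T (s \<cdot> y) (\<iota> K \<cdot> q)" if K: "K \<ge> max K0 K1" for K
      proof -
        obtain y q y' q' where *: "arr y ?N S" "arr q ?N (X K)" "f = Add T (s \<cdot> y) (\<iota> K \<cdot> q)"
          "arr y' ?N S" "arr q' ?N (X K)" "g = Add T (s \<cdot> y') (\<iota> K \<cdot> q')" using K0[of K] K1[of K] K by auto
        note a = arr_Comp[OF *(1) s(1)] and b = arr_Comp[OF *(2) \<iota>] and a' = arr_Comp[OF *(4) s(1)] and b' = arr_Comp[OF *(5) \<iota>]
        have "Add T f g = Add T (s \<cdot> y) (Add T (\<iota> K \<cdot> q) (Add T (s \<cdot> y') (\<iota> K \<cdot> q')))"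
          unfolding *(3,6) by (rule Add_assoc[OF a b arr_Add[OF a' b']])
        also have "Add T (\<iota> K \<cdot> q) (Add T (s \<cdot> y') (\<iota> K \<cdot> q')) = Add T (Add T (s \<cdot> y') (\<iota> K \<cdot> q)) (\<iota> K \<cdot> q')"
          by (simp only: Add_assoc[OF b a' b', symmetric] Add_commute[OF b a'])
        also have "\<dots> = Add T (s \<cdot> y') (Add T (\<iota> K \<cdot> q) (\<iota> K \<cdot> q'))" by (rule Add_assoc[OF a' b b'])
        also have "Add T (s \<cdot> y) \<dots> = Add T (Add T (s \<cdot> y) (s \<cdot> y')) (Add T (\<iota> K \<cdot> q) (\<iota> K \<cdot> q'))"
          by (rule Add_assoc[OF a a' arr_Add[OF b b'], symmetric])
        also have "\<dots> = Add T (s \<cdot> Add T y y') (\<iota> K \<cdot> Add T q q')"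
          using comp_Add[OF *(1,4) s(1)] comp_Add[OF *(2,5) \<iota>] by simp
        finally show ?thesis using arr_Add[OF *(1,4)] arr_Add[OF *(2,5)] by blast
      qed
      then show "?P (Add T f g)" by blast
    qed
    then obtain K0 where K0: "\<And>K. K \<ge> K0 \<Longrightarrow> \<exists>y q. arr y ?N S \<and> arr q ?N (X K) \<and> x = Add T (s \<cdot> y) (\<iota> K \<cdot> q)" by blast
    \<comment> \<open>For K \<ge> -i there are no nonzero arrows from M[i] to B(K)[-1], so
      \<open>c K\<close> is injective on arrows from M[i], and the part of \<open>x\<close> at stage
      \<open>K\<close> vanishes.\<close>
    define K where "K = max K0 (nat (-i))"
    obtain y q where y: "arr y ?N S" and q: "arr q ?N (X K)" and xe: "x = Add T (s \<cdot> y) (\<iota> K \<cdot> q)"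
      using K0[of K] by (auto simp: K_def)
    have "p \<cdot> (s \<cdot> y) = Null T ?N V" using comp_assoc[OF y s(1) p(1)] ps Null_comp[OF y V] by simp
    then have "p \<cdot> x = c K \<cdot> q"
      using xe comp_Add[OF arr_Comp[OF y s(1)] arr_Comp[OF q \<iota>] p(1)] comp_assoc[OF q \<iota> p(1)] p(2)
        Null_Add[OF arr_Comp[OF q ca]] by simp
    then have cq: "c K \<cdot> q = Null T ?N V" using z by simp
    note tb = Tri_rot_back[OF t[of K]]
    obtain r where r: "arr r ?N (Sh T (-1) (B K))" "Neg T (Sh T (-1) (B K)) (X K) (ShM T (-1) (e K)) \<cdot> r = q"
      using Tri_lift[OF tb q cq] by blast
    have "?N \<in> LE (-i)" using LE_Sh[OF M_Ob, of i "-i"] M_LE by simp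
    moreover have "Sh T (-1) (B K) \<in> GE (int K + 2)" using GE_Sh[OF GE_Ob[OF B[of K]], of "-1" "int K + 2"] B[of K] by (simp add: add.commute)
    moreover have "-i < int K + 2" by (simp add: K_def)
    ultimately have "van ?N (Sh T (-1) (B K))" by (rule van_LE_GE)
    then have "q = Null T ?N (X K)" using vanD r comp_Null[OF Tri_arr(1)[OF tb] N] by metis
    then have "x = s \<cdot> y" using xe comp_Null[OF \<iota> N] Add_Null[OF arr_Comp[OF y s(1)]] by simp
    then show ?thesis using y by blast
  qed
  obtain H a b where tH: "Tri T S S H s a b" using ex_cone[OF s(1)] by blast
  note ob = Tri_Ob[OF tH] and ar = Tri_arr[OF tH]
  obtain \<theta> where \<theta>: "arr \<theta> H V" "\<theta> \<cdot> a = p" using Tri_desc[OF tH p(1) ps] by blast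
  obtain D g h where tD: "Tri T H V D \<theta> g h" using ex_cone[OF \<theta>(1)] by blast
  have "is_zero T D"
  proof (rule zero_cone[OF tD])
    fix i x assume x: "arr x (Sh T i M) H" and z: "\<theta> \<cdot> x = Null T (Sh T i M) V"
    let ?N = "Sh T i M"
    have N: "?N \<in> Ob T" using Sh_Ob[OF M_Ob] .
    note s1 = arr_ShM[OF s(1), of 1] and bx = arr_Comp[OF x ar(3)]
    have "ShM T 1 s \<cdot> (b \<cdot> x) = Null T ?N (Sh T 1 S)"
      using comp_assoc[OF x ar(3) s1] Tri_comp3[OF tH] Null_comp[OF x Sh_Ob[OF So]] by simp
    then have "b \<cdot> x = Null T ?N (Sh T 1 S)" using inj_on_M_shift[OF s(1) inj_s bx] by blast
    then obtain y where y: "arr y ?N S" "a \<cdot> y = x" using Tri_lift2[OF tH x] by blast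
    have "p \<cdot> y = Null T ?N V" using comp_assoc[OF y(1) ar(2) \<theta>(1)] \<theta>(2) y(2) z by simp
    then obtain w where w: "arr w ?N S" "s \<cdot> w = y" using ker_p[OF y(1)] by blast
    have "x = (a \<cdot> s) \<cdot> w" using comp_assoc[OF w(1) ar(1,2)] w y by simp
    then show "x = Null T ?N H" using Tri_comp[OF tH] Null_comp[OF w(1) ob(3)] by simp
  next
    fix i y assume y: "arr y (Sh T i M) V"
    let ?N = "Sh T i M"
    \<comment> \<open>M[i] lies in \<open>LE (-i)\<close>, so its arrows to \<open>V\<close> factor
      through X(k) as soon as k \<ge> -i.\<close>
    define k where "k = nat (-i)"
    have "?N \<in> LE (-i)" using LE_Sh[OF M_Ob, of i "-i"] M_LE by simp
    then have "van ?N (B k)" using van_LE_GE[OF _ B] by (simp add: k_def)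
    then obtain x where x: "arr x ?N (X k)" "c k \<cdot> x = y" using Tri_lift[OF t y vanD[OF _ arr_Comp[OF y da]]] by blast
    note ix = arr_Comp[OF x(1) \<iota>]
    have "\<theta> \<cdot> (a \<cdot> (\<iota> k \<cdot> x)) = y"
      using comp_assoc[OF ix ar(2) \<theta>(1)] \<theta>(2) comp_assoc[OF x(1) \<iota> p(1)] p(2) x(2) by simp
    then show "\<exists>x. arr x ?N H \<and> \<theta> \<cdot> x = y" using arr_Comp[OF ix ar(2)] by blast
  qed
  then have "van (Sh T (-1) D) W" using zero_van(1)[OF _ W] zero_Sh Tri_Ob(3)[OF tD] by blast
  moreover have "van D W" using zero_van(1)[OF \<open>is_zero T D\<close> W] .
  \<comment> \<open>The triangle S -> S -> H -> S[1] involves S[1], which is where vanishing against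
    W[-1] enters.\<close>
  moreover have "van H W"
  proof (rule Tri_nav_right[OF tH _ _ W])
    show "van S W" using coprod_van[OF co W] v(1) by blast
    have "van S (Sh T (-1) W)" using coprod_van[OF co Sh_Ob[OF W]] v(2) by blast
    then show "van (Sh T 1 S) W" using van_Sh_left[OF So W] by simp
  qed
  ultimately show ?thesis using Tri_nav_mid[OF tD _ _ W] by blast
qed

text \<open>Bounded objects are covered by the hypothesis. For unbounded \<open>V\<close> the
  telescope loses one degree, because it also tests the truncations against P[j - 1].\<close>

lemma id_le_if_pd_le:
  assumes g: "\<And>X. X \<in> T_bd T M \<inter> GE 0 \<Longrightarrow> pd_le X n" and P: "P \<in> LE 0"
  shows "id_le P n"
proof -
  have Po: "P \<in> Ob T" using LE_Ob[OF P] .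
  have bd: "van X (Sh T j P)" if "X \<in> GE 0" "X \<in> LE m" "j > n" for X j m
    using g[of X] that P T_bd_GE_iff by (auto simp: pd_le_def)
  have far: "van V (Sh T j P)" if V: "V \<in> GE 0" and j: "j > n + 1" for V j
  proof -
    have "\<forall>k :: nat. \<exists>X B c d e. Tri T X V B c d e \<and> X \<in> LE (int k) \<and> B \<in> GE (int k + 1)"
      using trunc[OF GE_Ob[OF V]] by blast
    then obtain X B c d e where t: "\<And>k :: nat. Tri T (X k) V (B k) (c k) (d k) (e k)"
      and X: "\<And>k. X k \<in> LE (int k)" and B: "\<And>k. B k \<in> GE (int k + 1)" by metis
    have X0: "X k \<in> GE 0" for k using GE_left[OF t V] GE_mono[OF B] by simp
    show ?thesis
    proof (rule van_from_truncations[OF GE_Ob[OF V] Sh_Ob[OF Po] t X B])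
      show "van (X k) (Sh T j P)" for k using bd[OF X0 X] j by simp
      show "van (X k) (Sh T (-1) (Sh T j P))" for k using bd[OF X0 X, of "j - 1"] j by (simp add: Sh_Sh Po)
    qed
  qed
  show ?thesis unfolding id_le_def
  proof (intro ballI allI impI)
    fix V j assume V: "V \<in> GE 0" and j: "j > n"
    \<comment> \<open>Splitting \<open>V\<close> at 0 regains the lost degree: \<open>A\<close> is
      bounded, and B[1] still lies in \<open>GE 0\<close>, while the target becomes P[j + 1] with j
      + 1 > n + 1.\<close>
    obtain A B f g h where A: "A \<in> LE 0" and B: "B \<in> GE 1" and t: "Tri T A V B f g h"
      using trunc[OF GE_Ob[OF V], of 0] by auto
    have "A \<in> GE 0" using GE_left[OF t V] GE_mono[OF B] by simp
    then have v1: "van A (Sh T j P)" using bd[OF _ A j] by blast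
    have Bo: "B \<in> Ob T" using GE_Ob[OF B] .
    have "Sh T 1 B \<in> GE 0" using B GE_Sh[OF Bo] by simp
    then have "van (Sh T 1 B) (Sh T (j + 1) P)" using far j by simp
    then have "van (Sh T 1 B) (Sh T 1 (Sh T j P))" by (simp add: Sh_Sh Po add.commute)
    then have "van B (Sh T j P)" using van_Sh[OF Bo Sh_Ob[OF Po]] by simp
    then show "van V (Sh T j P)" using Tri_nav_mid[OF t v1 _ Sh_Ob[OF Po]] by blast
  qed
qed

lemma silp_le_gpd: "silp \<kappa> T M \<le> gpd T M"
proof (rule ereal_le_real)
  fix r assume "gpd T M \<le> ereal r"
  then have "id_le P \<lfloor>r\<rfloor>" if "P \<in> Add_cls \<kappa> T M" for P
    using id_le_if_pd_le[of "\<lfloor>r\<rfloor>" P] that LE_retract M_coprod_LE unfolding gpd_le_iff Add_cls_iff by blast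
  then show "silp \<kappa> T M \<le> ereal r" by (simp add: silp_le_iff)
qed

text \<open>An arrow from M[-j] to the coproduct is, by compactness, a finite sum of arrows through
  the \<open>X i\<close>, and all of these are zero.\<close>

lemma GE_coprod:
  fixes I :: "'i set"
  assumes c: "is_coproduct T I X S \<iota>" and I: "|I| <o \<kappa>" and X: "\<And>i. i \<in> I \<Longrightarrow> X i \<in> GE n"
  shows "S \<in> GE n"
proof -
  note So = coprod_Ob[OF c]
  have "van M (Sh T j S)" if j: "j < n" for j
  proof -
    let ?N = "Sh T (-j) M"
    have N: "?N \<in> Ob T" using Sh_Ob[OF M_Ob] .
    have "f = Null T ?N S" if f: "arr f ?N S" for f
    proof (rule compact_induct[OF M_compact c I f, of "\<lambda>f. f = Null T ?N S"])
      fix i q assume i: "i \<in> I" and q: "arr q ?N (X i)"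
      have "van ?N (X i)" using X[OF i] j van_Sh_left[OF M_Ob GE_Ob[OF X[OF i]], of "-j"] by (simp add: GE_iff)
      then have "q = Null T ?N (X i)" using vanD q by blast
      then show "\<iota> i \<cdot> q = Null T ?N S" using comp_Null[OF coprod_inj[OF c i] N] by simp
    qed (simp_all add: Add_Null[OF arr_Null[OF N So]])
    then have "van ?N S" using van_iff[OF N So] by blast
    then show ?thesis using van_Sh_left[OF M_Ob So, of "-j"] by simp
  qed
  then show ?thesis using GE_iff So by blast
qed

lemma M_Add: "M \<in> Add_cls \<kappa> T M"
proof -
  have "|{undefined :: 'u}| <o \<kappa>" by (rule finite_small) simp
  moreover have "is_coproduct T {undefined :: 'u} (\<lambda>_. M) M (\<lambda>_. Id T M)"
  proof (rule coproductI)
    show "\<exists>h. arr h M Y \<and> (\<forall>i\<in>{undefined :: 'u}. h \<cdot> Id T M = f i)"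
      if "\<And>i. i \<in> {undefined :: 'u} \<Longrightarrow> arr (f i) M Y" for Y f
      using that[of undefined] comp_Id by (intro exI[of _ "f undefined"]) auto
    show "h = k" if "arr h M Y" "arr k M Y" "\<And>i. i \<in> {undefined :: 'u} \<Longrightarrow> h \<cdot> Id T M = k \<cdot> Id T M" for h k Y
      using that comp_Id by simp
  qed (use M_Ob arr_Id in auto)
  ultimately have "M_coprod M" unfolding M_coprod_def by blast
  then show ?thesis by (rule M_coprod_Add)
qed

end

section \<open>The heart of a tilting object\<close>

locale tilting_generator = silting_generator +
  assumes tilting_M: "tilting \<kappa> T M"
begin

abbreviation \<H> :: "('b, 'c, 'd) tricat_scheme" where "\<H> \<equiv> heart T M"

lemma heart_simps [simp]: "Hom \<H> = Hom T" "Id \<H> = Id T" "Comp \<H> = Comp T" "Null \<H> = Null T"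
  by (simp_all add: heart_def)

lemma heart_iff: "X \<in> Ob \<H> \<longleftrightarrow> X \<in> LE 0 \<and> X \<in> GE 0"
  by (simp add: heart_def)

lemma heart_Ob: "X \<in> Ob \<H> \<Longrightarrow> X \<in> Ob T"
  using heart_iff LE_Ob by blast

text \<open>The tilting condition gives Hom(M, P[i]) = 0 for i < 0, the half of membership in the
  heart that silting alone does not provide.\<close>

lemma Add_heart: assumes "P \<in> Add_cls \<kappa> T M" shows "P \<in> Ob \<H>"
proof -
  have "van M (Sh T i P)" if "i < 0" for i
    using tilting_M M_Add assms that unfolding tilting_def by auto
  then have "P \<in> GE 0" using GE_iff Add_Ob[OF assms] by blast
  moreover have "P \<in> LE 0" using assms Add_cls_iff LE_retract M_coprod_LE by blast
  ultimately show ?thesis using heart_iff by blast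
qed

lemma van_heart: assumes "X \<in> Ob \<H>" "Y \<in> Ob \<H>" shows "van X (Sh T (-1) Y)" "van (Sh T 1 X) Y"
proof -
  have "Sh T (-1) Y \<in> GE 1" using assms(2) GE_Sh[OF heart_Ob[OF assms(2)]] by (simp add: heart_iff)
  then show "van X (Sh T (-1) Y)" using van_LE_GE[of X 0] assms by (simp add: heart_iff)
  have "Sh T 1 X \<in> LE (-1)" using assms(1) LE_Sh[OF heart_Ob[OF assms(1)]] by (simp add: heart_iff)
  then show "van (Sh T 1 X) Y" using van_LE_GE[of _ "-1" Y 0] assms by (simp add: heart_iff)
qed

lemma zero_heart_iff: "is_zero \<H> N \<longleftrightarrow> is_zero T N"
proof
  assume N: "is_zero \<H> N"
  then have No: "N \<in> Ob \<H>" "N \<in> Ob T" using heart_Ob by (auto simp: is_zero_def)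
  then have "\<exists>!f. f \<in> Hom T N N" using N by (auto simp: is_zero_def)
  then have "Id T N = Null T N N" using arrD(3)[OF arr_Id[OF No(2)]] arrD(3)[OF arr_Null[OF No(2,2)]] by blast
  then show "is_zero T N" using zero_iff_Id No by blast
next
  assume N: "is_zero T N"
  then have "N \<in> Ob \<H>" using zero_LE zero_GE heart_iff by blast
  then show "is_zero \<H> N" using N heart_Ob by (simp add: is_zero_def)
qed

section \<open>Short exact sequences in the heart as triangles\<close>

lemma epiD: "\<lbrakk>epi \<H> X Y e; X \<in> Ob \<H>; Y \<in> Ob \<H>\<rbrakk> \<Longrightarrow> arr e X Y"
  using heart_Ob by (simp add: epi_def arr_def)

lemma epi_cancel: "\<lbrakk>epi \<H> X Y e; Z \<in> Ob \<H>; arr u Y Z; arr v Y Z; u \<cdot> e = v \<cdot> e\<rbrakk> \<Longrightarrow> u = v"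
  by (simp add: epi_def arr_def)

lemma epiI: assumes "arr e X Y" "\<And>Z u v. \<lbrakk>Z \<in> Ob \<H>; arr u Y Z; arr v Y Z; u \<cdot> e = v \<cdot> e\<rbrakk> \<Longrightarrow> u = v"
  shows "epi \<H> X Y e"
  unfolding epi_def heart_simps
proof (intro conjI ballI impI)
  fix Z u v assume Z: "Z \<in> Ob \<H>" and "u \<in> Hom T Y Z" "v \<in> Hom T Y Z" and uv: "u \<cdot> e = v \<cdot> e"
  then have "arr u Y Z" "arr v Y Z" using arrD(2)[OF assms(1)] heart_Ob[OF Z] by (simp_all add: arr_def)
  then show "u = v" using assms(2)[OF Z _ _ uv] by simp
qed (rule arrD(3)[OF assms(1)])

lemma is_kernelI:
  assumes "K \<in> Ob \<H>" "arr k K X" "g \<cdot> k = Null T K Y"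
    and ex: "\<And>Z t. \<lbrakk>Z \<in> Ob \<H>; arr t Z X; g \<cdot> t = Null T Z Y\<rbrakk> \<Longrightarrow> \<exists>s. arr s Z K \<and> k \<cdot> s = t"
    and un: "\<And>Z s s'. \<lbrakk>Z \<in> Ob \<H>; arr s Z K; arr s' Z K; k \<cdot> s = k \<cdot> s'\<rbrakk> \<Longrightarrow> s = s'"
  shows "is_kernel \<H> K X Y k g"
  unfolding is_kernel_def heart_simps
proof (intro conjI ballI impI)
  fix Z t assume Z: "Z \<in> Ob \<H>" and t: "t \<in> Hom T Z X" "g \<cdot> t = Null T Z Y"
  note Zo = heart_Ob[OF Z] and Ko = arrD(1)[OF assms(2)] and Xo = arrD(2)[OF assms(2)]
  obtain s where s: "arr s Z K" "k \<cdot> s = t" using ex[OF Z arrI[OF Zo Xo t(1)] t(2)] by blast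
  show "\<exists>!s. s \<in> Hom T Z K \<and> k \<cdot> s = t"
  proof (rule ex1I[of _ s])
    show "s \<in> Hom T Z K \<and> k \<cdot> s = t" using s arrD(3) by blast
    show "s' = s" if "s' \<in> Hom T Z K \<and> k \<cdot> s' = t" for s'
      by (rule un[OF Z arrI[OF Zo Ko] s(1)]) (use that s(2) in simp_all)
  qed
qed (rule assms(1) arrD(3)[OF assms(2)] assms(3))+

lemma kernelD:
  assumes "is_kernel \<H> K X Y k g" "X \<in> Ob T"
  shows "K \<in> Ob \<H>" "arr k K X" "g \<cdot> k = Null T K Y"
    "\<And>Z t. \<lbrakk>Z \<in> Ob \<H>; arr t Z X; g \<cdot> t = Null T Z Y\<rbrakk> \<Longrightarrow> \<exists>s. arr s Z K \<and> k \<cdot> s = t"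
    "\<And>Z s s'. \<lbrakk>Z \<in> Ob \<H>; arr s Z K; arr s' Z K; k \<cdot> s = k \<cdot> s'; g \<cdot> (k \<cdot> s) = Null T Z Y\<rbrakk> \<Longrightarrow> s = s'"
proof -
  show K: "K \<in> Ob \<H>" and k: "arr k K X" and "g \<cdot> k = Null T K Y"
    using assms heart_Ob by (auto simp: is_kernel_def arr_def)
  have u: "\<exists>!s. s \<in> Hom T Z K \<and> k \<cdot> s = t" if "Z \<in> Ob \<H>" "arr t Z X" "g \<cdot> t = Null T Z Y" for Z t
    using assms that by (simp add: is_kernel_def arr_def)
  show "\<exists>s. arr s Z K \<and> k \<cdot> s = t" if "Z \<in> Ob \<H>" "arr t Z X" "g \<cdot> t = Null T Z Y" for Z t
    using u[OF that] that heart_Ob[OF K] heart_Ob arrI by blast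
  show "s = s'" if z: "Z \<in> Ob \<H>" "arr s Z K" "arr s' Z K" "k \<cdot> s = k \<cdot> s'" "g \<cdot> (k \<cdot> s) = Null T Z Y" for Z s s'
    using u[OF z(1) arr_Comp[OF z(2) k] z(5)] z(2-4) arrD(3) by metis
qed

text \<open>The quotient \<open>B\<close> of the cone \<open>C\<close> in degree 0 is the cokernel
  of \<open>e\<close> in the heart. For an epimorphism it is zero, so \<open>C\<close> lies in
  \<open>LE (-1)\<close>, and C[-1] is the kernel.\<close>

lemma epi_triangle:
  assumes e: "epi \<H> X Y e" and X: "X \<in> Ob \<H>" and Y: "Y \<in> Ob \<H>"
  shows "\<exists>K k h. K \<in> Ob \<H> \<and> Tri T K X Y k e h"
proof -
  obtain C g h where t: "Tri T X Y C e g h" using ex_cone[OF epiD[OF assms]] by blast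
  note ob = Tri_Ob[OF t] and ar = Tri_arr[OF t]
  have C: "C \<in> LE 0" using LE_right[OF t] X Y LE_mono[of X 0 1] by (simp add: heart_iff)
  obtain A B a b c where A: "A \<in> LE (-1)" and B: "B \<in> GE 0" and tC: "Tri T A C B a b c"
    using trunc[OF ob(3), of "-1"] by auto
  note obC = Tri_Ob[OF tC] and arC = Tri_arr[OF tC]
  have "B \<in> LE 0" using LE_right[OF tC C] LE_mono[OF A] by simp
  then have BH: "B \<in> Ob \<H>" using B heart_iff by blast
  have bg: "arr (b \<cdot> g) Y B" using arr_Comp[OF ar(2) arC(2)] .
  have "(b \<cdot> g) \<cdot> e = Null T Y B \<cdot> e"
    using comp_assoc[OF ar(1,2) arC(2)] Tri_comp[OF t] comp_Null[OF arC(2) ob(1)] Null_comp[OF ar(1) obC(3)] by simp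
  then have bg0: "b \<cdot> g = Null T Y B" using epi_cancel[OF e BH bg arr_Null[OF ob(2) obC(3)]] by blast
  \<comment> \<open>Arrows C -> B are determined by their composite with \<open>g\<close>, as
    Hom(X[1], B) = 0. The identity of \<open>B\<close> then vanishes in the same way, as Hom(A[1],
    B) = 0.\<close>
  have "b = Null T C B"
  proof (rule Tri_eq_right[OF Tri_rot[OF t] arC(2) arr_Null[OF ob(3) obC(3)]])
    show "b \<cdot> g = Null T C B \<cdot> g" using bg0 Null_comp[OF ar(2) obC(3)] by simp
    show "van (Sh T 1 X) B" using van_heart(2)[OF X BH] .
  qed
  then have "Id T B \<cdot> b = Null T B B \<cdot> b" using Id_comp[OF arC(2)] Null_comp[OF arC(2) obC(3)] by simp
  then have "Id T B = Null T B B"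
  proof (rule Tri_eq_right[OF Tri_rot[OF tC] arr_Id[OF obC(3)] arr_Null[OF obC(3,3)]])
    have "Sh T 1 A \<in> LE (-1)" using LE_Sh[OF LE_Ob[OF A]] LE_mono[OF A] by simp
    then show "van (Sh T 1 A) B" using van_LE_GE[OF _ B] by simp
  qed
  then have "is_zero T B" using zero_iff_Id obC(3) by blast
  then have C1: "C \<in> LE (-1)" using LE_ext[OF tC A] zero_LE by blast
  note tK = Tri_rot_back[OF t]
  have "Sh T (-1) C \<in> LE 0" using LE_Sh[OF ob(3)] C1 by simp
  moreover have "Sh T (-1) C \<in> GE 0" using GE_left[OF tK] X Y GE_mono[of Y 0] by (simp add: heart_iff)
  ultimately show ?thesis using tK heart_iff by blast
qed

text \<open>Factorizations exist by exactness of Hom on the triangle. Uniqueness and cancellation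
  come from the vanishing of negative Hom between objects of the heart.\<close>

lemma triangle_exact:
  assumes t: "Tri T K X Y k e h" and K: "K \<in> Ob \<H>" and Y: "Y \<in> Ob \<H>"
  shows "is_kernel \<H> K X Y k e" "epi \<H> X Y e"
proof -
  note ar = Tri_arr[OF t]
  show "is_kernel \<H> K X Y k e"
  proof (rule is_kernelI[OF K ar(1) Tri_comp[OF t]])
    show "\<exists>s. arr s Z K \<and> k \<cdot> s = u" if "arr u Z X" "e \<cdot> u = Null T Z Y" for Z u
      using Tri_lift[OF t that] .
    show "s = s'" if "Z \<in> Ob \<H>" "arr s Z K" "arr s' Z K" "k \<cdot> s = k \<cdot> s'" for Z s s'
      using Tri_eq_left[OF t that(2-4) van_heart(1)[OF that(1) Y]] .
  qed
  show "epi \<H> X Y e"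
  proof (rule epiI[OF ar(2)])
    show "u = v" if "Z \<in> Ob \<H>" "arr u Y Z" "arr v Y Z" "u \<cdot> e = v \<cdot> e" for Z u v
      using Tri_eq_right[OF Tri_rot[OF t] that(2-4) van_heart(2)[OF K that(1)]] .
  qed
qed

text \<open>Exactness in a resolution supplies an arbitrary kernel of \<open>e\<close>, not the
  cocone. The two are isomorphic, and \<open>TR1_iso\<close> transports the triangle.\<close>

lemma kernel_triangle:
  assumes e: "epi \<H> X Y e" and X: "X \<in> Ob \<H>" and Y: "Y \<in> Ob \<H>" and K: "is_kernel \<H> K X Y k e"
  shows "\<exists>h. Tri T K X Y k e h"
proof -
  obtain K' k' h' where K'o: "K' \<in> Ob \<H>" and t: "Tri T K' X Y k' e h'" using epi_triangle[OF e X Y] by blast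
  have Xo: "X \<in> Ob T" and Yo: "Y \<in> Ob T" using X Y heart_Ob by auto
  note kD = kernelD[OF K Xo] and K' = triangle_exact(1)[OF t K'o Y]
  note kD' = kernelD[OF K' Xo]
  obtain \<alpha> where \<alpha>: "arr \<alpha> K' K" "k \<cdot> \<alpha> = k'" using kD(4)[OF kD'(1-3)] by blast
  obtain \<beta> where \<beta>: "arr \<beta> K K'" "k' \<cdot> \<beta> = k" using kD'(4)[OF kD(1-3)] by blast
  have K'T: "K' \<in> Ob T" and KT: "K \<in> Ob T" using kD(1) K'o heart_Ob by auto
  have "k' \<cdot> (\<beta> \<cdot> \<alpha>) = k'" using comp_assoc[OF \<alpha>(1) \<beta>(1) kD'(2)] \<alpha> \<beta> by simp
  then have 1: "\<beta> \<cdot> \<alpha> = Id T K'"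
    using kD'(5)[OF K'o arr_Comp[OF \<alpha>(1) \<beta>(1)] arr_Id[OF K'T]] comp_Id[OF kD'(2)] kD'(3) by simp
  have "k \<cdot> (\<alpha> \<cdot> \<beta>) = k" using comp_assoc[OF \<beta>(1) \<alpha>(1) kD(2)] \<alpha> \<beta> by simp
  then have 2: "\<alpha> \<cdot> \<beta> = Id T K"
    using kD(5)[OF kD(1) arr_Comp[OF \<beta>(1) \<alpha>(1)] arr_Id[OF KT]] comp_Id[OF kD(2)] kD(3) by simp
  have iso: "iso_arrow T K' K \<alpha>" using 1 2 arrD(3)[OF \<alpha>(1)] arrD(3)[OF \<beta>(1)] by (auto simp: iso_arrow_def)
  have idX: "iso_arrow T Z Z (Id T Z)" if "Z \<in> Ob T" for Z
    using arrD(3)[OF arr_Id[OF that]] comp_Id[OF arr_Id[OF that]] by (auto simp: iso_arrow_def)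
  note ar = Tri_arr[OF t]
  have h: "arr (ShM T 1 \<alpha> \<cdot> h') Y (Sh T 1 K)" using arr_Comp[OF ar(3) arr_ShM[OF \<alpha>(1)]] .
  have "Tri T K X Y k e (ShM T 1 \<alpha> \<cdot> h')"
    by (rule TR1_iso[OF t KT Xo Yo arrD(3)[OF kD(2)] arrD(3)[OF ar(2)] arrD(3)[OF h] iso idX[OF Xo] idX[OF Yo]])
      (use Id_comp[OF ar(1)] Id_comp[OF ar(2)] comp_Id[OF ar(2)] comp_Id[OF h] \<alpha>(2) in simp_all)
  then show ?thesis by blast
qed

text \<open>The obstruction to lifting P -> Y along an epimorphism with kernel \<open>K\<close> lies
  in Hom(P, K[1]). Conversely the cover S -> P has cone in \<open>LE (-1)\<close>, so it is an
  epimorphism in the heart; projectivity splits it, and \<open>P\<close> inherits the bound of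
  \<open>S\<close>.\<close>

lemma projective_heart_iff: assumes P: "P \<in> Ob \<H>" shows "projective \<H> P \<longleftrightarrow> pd_le P 0"
proof
  assume p: "pd_le P 0"
  show "projective \<H> P" unfolding projective_def heart_simps
  proof (intro conjI ballI allI impI P)
    fix X Y e f assume X: "X \<in> Ob \<H>" and Y: "Y \<in> Ob \<H>" and ef: "epi \<H> X Y e \<and> f \<in> Hom T P Y"
    obtain K k h where K: "K \<in> Ob \<H>" and t: "Tri T K X Y k e h" using epi_triangle[OF _ X Y] ef by blast
    have f: "arr f P Y" using ef P Y heart_Ob by (simp add: arr_def)
    have "van P (Sh T 1 K)" using p K by (simp add: pd_le_def heart_iff)
    then obtain g where "arr g P X" "e \<cdot> g = f" using Tri_lift2[OF t f vanD[OF _ arr_Comp[OF f Tri_arr(3)[OF t]]]] by blast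
    then show "\<exists>g\<in>Hom T P X. e \<cdot> g = f" using arrD(3) by blast
  qed
next
  assume p: "projective \<H> P"
  obtain S U f g h where S: "M_coprod S" and U: "U \<in> LE (-1)" and t: "Tri T (Sh T 0 S) P U f g h"
    using cover[of P 0] P by (auto simp: heart_iff)
  have S0: "Sh T 0 S = S" using Sh_zero LE_Ob[OF M_coprod_LE[OF S]] by blast
  note t = t[unfolded S0]
  note ar = Tri_arr[OF t]
  have SH: "S \<in> Ob \<H>" using Add_heart M_coprod_Add S by blast
  have "epi \<H> S P f"
  proof (rule epiI[OF ar(1)])
    show "u = v" if "Z \<in> Ob \<H>" "arr u P Z" "arr v P Z" "u \<cdot> f = v \<cdot> f" for Z u v
      by (rule Tri_eq_right[OF t that(2-4)]) (use van_LE_GE[OF U, of Z 0] that(1) in \<open>simp add: heart_iff\<close>)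
  qed
  moreover have "Id T P \<in> Hom T P P" using arrD(3)[OF arr_Id[OF heart_Ob[OF P]]] .
  ultimately obtain s where s: "s \<in> Hom T P S" "f \<cdot> s = Id T P"
    using p SH P unfolding projective_def heart_simps by blast
  have "retract P S" by (rule retractI[OF arrI[OF _ _ s(1)] ar(1) s(2)]) (use heart_Ob P SH in auto)
  then show "pd_le P 0" using pd_le_retract M_coprod_pd_le[OF S] by blast
qed

lemma heart_cover: assumes H: "H \<in> Ob \<H>"
  shows "\<exists>S K k e h. M_coprod S \<and> K \<in> Ob \<H> \<and> Tri T K S H k e h"
proof -
  obtain S U f g h where S: "M_coprod S" and U: "U \<in> LE (-1)" and t: "Tri T (Sh T 0 S) H U f g h"
    using cover[of H 0] H by (auto simp: heart_iff)
  have S0: "Sh T 0 S = S" using Sh_zero LE_Ob[OF M_coprod_LE[OF S]] by blast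
  note tb = Tri_rot_back[OF t[unfolded S0]]
  have SH: "S \<in> Ob \<H>" using Add_heart M_coprod_Add S by blast
  have "Sh T (-1) U \<in> LE 0" using LE_Sh[OF LE_Ob[OF U]] U by simp
  moreover have "Sh T (-1) U \<in> GE 0" using GE_left[OF tb] SH H GE_mono[of H 0] by (simp add: heart_iff)
  ultimately show ?thesis using S tb heart_iff by blast
qed

text \<open>\<open>k\<close> is a monomorphism in the heart, so composing with it does not change
  kernels. This allows resolutions to be cut and spliced at a syzygy.\<close>

lemma kernel_mono_comp:
  assumes t: "Tri T K X Y k e h" and Y: "Y \<in> Ob \<H>" and f: "arr f W K" 
  shows "is_kernel \<H> L W X l (k \<cdot> f) \<longleftrightarrow> is_kernel \<H> L W K l f"
proof -
  note ar = Tri_arr[OF t] and ob = Tri_Ob[OF t]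
  have *: "(k \<cdot> f) \<cdot> u = Null T Z X \<longleftrightarrow> f \<cdot> u = Null T Z K" if Z: "Z \<in> Ob \<H>" and u: "u \<in> Hom T Z W" for Z u
  proof -
    have ua: "arr u Z W" using u Z arrD(1)[OF f] heart_Ob by (simp add: arr_def)
    have "k \<cdot> (f \<cdot> u) = k \<cdot> Null T Z K \<Longrightarrow> f \<cdot> u = Null T Z K"
      using Tri_eq_left[OF t arr_Comp[OF ua f] arr_Null[OF heart_Ob[OF Z] ob(1)] _ van_heart(1)[OF Z Y]] .
    then show ?thesis using comp_assoc[OF ua f ar(1)] comp_Null[OF ar(1) heart_Ob[OF Z]] by auto
  qed
  show ?thesis unfolding is_kernel_def heart_simps using * by auto
qed

lemma exact_mono_comp:
  assumes t: "Tri T K X Y k e h" and Y: "Y \<in> Ob \<H>" and f: "arr f W K"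
  shows "exact_at \<H> V W X u (k \<cdot> f) \<longleftrightarrow> exact_at \<H> V W K u f"
  unfolding exact_at_def kernel_mono_comp[OF assms] heart_simps
  using arrD(3)[OF f] arrD(3)[OF arr_Comp[OF f Tri_arr(1)[OF t]]] by simp

lemma projective_Ob: "projective \<H> P \<Longrightarrow> P \<in> Ob \<H>"
  by (simp add: projective_def)

text \<open>The first syzygy \<open>K\<close> is resolved by the complex with indices moved by one,
  and the triangle K -> P(0) -> H raises the bound by one.\<close>

lemma resolution_pd_le:
  assumes "H \<in> Ob \<H>" "proj_resolution \<H> H P d \<epsilon>" "\<forall>i>n. is_zero \<H> (P i)"
  shows "pd_le H (int n)"
  using assms
proof (induction n arbitrary: H P d \<epsilon>)
  case (0 H P d \<epsilon>)
  note r = 0(2)[unfolded proj_resolution_def]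
  have pr: "\<And>i. projective \<H> (P i)" using r by blast
  note Po = projective_Ob[OF pr]
  obtain K k e where k: "is_kernel \<H> K (P 0) H k \<epsilon>" and e: "epi \<H> (P 1) K e"
    using r unfolding exact_at_def by blast
  have \<epsilon>: "epi \<H> (P 0) H \<epsilon>" using r by blast
  obtain h where t: "Tri T K (P 0) H k \<epsilon> h" using kernel_triangle[OF \<epsilon> Po 0(1) k] by blast
  note Ko = kernelD(1)[OF k heart_Ob[OF Po]]
  have ea: "arr e (P 1) K" using epiD[OF e Po Ko] .
  \<comment> \<open>\<open>e\<close> is an epimorphism out of a zero object, so \<open>K\<close> is
    zero and \<open>H\<close> inherits the bound of P(0).\<close>
  have "van (P 1) K" using 0(3) zero_heart_iff zero_van(1) heart_Ob[OF Ko] by simp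
  then have "e = Null T (P 1) K" using vanD ea by blast
  then have "Id T K \<cdot> e = Null T K K \<cdot> e" using Id_comp[OF ea] Null_comp[OF ea heart_Ob[OF Ko]] by simp
  then have "Id T K = Null T K K"
    using epi_cancel[OF e Ko arr_Id[OF heart_Ob[OF Ko]] arr_Null[OF heart_Ob[OF Ko] heart_Ob[OF Ko]]] by blast
  then have "is_zero T K" using zero_iff_Id heart_Ob[OF Ko] by blast
  then show ?case using pd_le_right[OF t _ pd_le_zero] projective_heart_iff[OF Po] pr by simp
next
  case (Suc n H P d \<epsilon>)
  note r = Suc.prems(2)[unfolded proj_resolution_def]
  have pr: "\<And>i. projective \<H> (P i)" using r by blast
  note Po = projective_Ob[OF pr]
  obtain K k e where k: "is_kernel \<H> K (P 0) H k \<epsilon>" and e: "epi \<H> (P 1) K e" and d: "d 0 = k \<cdot> e"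
    using r unfolding exact_at_def heart_simps by blast
  have \<epsilon>: "epi \<H> (P 0) H \<epsilon>" using r by blast
  obtain h where t: "Tri T K (P 0) H k \<epsilon> h" using kernel_triangle[OF \<epsilon> Po Suc.prems(1) k] by blast
  note Ko = kernelD(1)[OF k heart_Ob[OF Po]]
  have ea: "arr e (P 1) K" using epiD[OF e Po Ko] .
  have ex: "exact_at \<H> (P (i + 2)) (P (i + 1)) (P i) (d (i + 1)) (d i)" for i using r by blast
  have "exact_at \<H> (P 2) (P 1) (P 0) (d 1) (k \<cdot> e)" using ex[of 0] d by (simp add: numeral_2_eq_2)
  then have "exact_at \<H> (P 2) (P 1) K (d 1) e" using exact_mono_comp[OF t Suc.prems(1) ea] by blast
  then have "proj_resolution \<H> K (\<lambda>i. P (i + 1)) (\<lambda>i. d (i + 1)) e"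
    unfolding proj_resolution_def using pr e ex[of "Suc _"] by (simp add: numeral_2_eq_2)
  then have "pd_le K (int n)" using Suc.IH[OF Ko] Suc.prems(3) by simp
  moreover have "pd_le (P 0) (int (Suc n))" using pd_le_mono projective_heart_iff[OF Po] pr by (meson of_nat_0_le_iff)
  ultimately show ?case using pd_le_right[OF t] by simp
qed

text \<open>With bound 0 the object \<open>H\<close> is itself projective; otherwise the kernel of a
  cover has a bound smaller by one.\<close>

lemma pd_le_resolution:
  assumes "H \<in> Ob \<H>" "pd_le H (int n)"
  shows "\<exists>P d \<epsilon>. proj_resolution \<H> H P d \<epsilon> \<and> (\<forall>i>n. is_zero \<H> (P i))"
  using assms
proof (induction n arbitrary: H)
  case (0 H)
  obtain N where N: "is_zero T N" using ex_zero by blast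
  have NH: "N \<in> Ob \<H>" and No: "N \<in> Ob T" and Ho: "H \<in> Ob T" using N zero_heart_iff is_zero_def heart_Ob 0 by metis+
  let ?P = "\<lambda>i :: nat. if i = 0 then H else N"
  have pr: "projective \<H> (?P i)" for i
    using projective_heart_iff[OF 0(1)] projective_heart_iff[OF NH] 0(2) pd_le_zero[OF N] by simp
  obtain h where t: "Tri T N H H (Null T N H) (Id T H) h" using Tri_zero_left[OF N Ho] by blast
  note te = triangle_exact[OF t NH 0(1)]
  have IdN: "Id T N = Null T N N" using zero_iff_Id N No by blast
  have eN: "epi \<H> N N (Null T N N)"
    by (rule epiI[OF arr_Null[OF No No]]) (metis vanD zero_van(1)[OF N] arrD(2))
  have nn: "Null T N N \<cdot> Null T N N = Null T N N" using comp_Null[OF arr_Null[OF No No] No] .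
  have kN: "is_kernel \<H> N N Y (Null T N N) (Null T N Y)" if "Y \<in> Ob T" for Y
  proof (rule is_kernelI[OF NH arr_Null[OF No No]])
    show "Null T N Y \<cdot> Null T N N = Null T N Y" using comp_Null[OF arr_Null[OF No that] No] .
    show "\<exists>s. arr s Z N \<and> Null T N N \<cdot> s = u" if "arr u Z N" for Z u
      using Id_comp[OF that] that IdN by auto
    show "s = s'" if "arr s Z N" "arr s' Z N" for Z s s'
      using vanD[OF zero_van(2)[OF N arrD(1)[OF that(1)]]] that by metis
  qed
  have "exact_at \<H> N H H (Null T N H) (Id T H)" unfolding exact_at_def heart_simps
    using te eN comp_Null[OF arr_Null[OF No Ho] No] arrD(3)[OF arr_Null[OF No Ho]] arrD(3)[OF arr_Id[OF Ho]] by metis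
  moreover have "exact_at \<H> N N Y (Null T N N) (Null T N Y)" if "Y \<in> Ob T" for Y unfolding exact_at_def heart_simps
    using kN[OF that] eN nn arrD(3)[OF arr_Null[OF No No]] arrD(3)[OF arr_Null[OF No that]] by metis
  ultimately have "proj_resolution \<H> H ?P (\<lambda>i. Null T N (?P i)) (Id T H)"
    unfolding proj_resolution_def using pr te(2) Ho No by simp
  moreover have "\<forall>i>0. is_zero \<H> (?P i)" using N zero_heart_iff by simp
  ultimately show ?case by blast
next
  case (Suc n H)
  obtain S K k e h where S: "M_coprod S" and K: "K \<in> Ob \<H>" and t: "Tri T K S H k e h" using heart_cover[OF Suc.prems(1)] by blast
  have SH: "S \<in> Ob \<H>" using Add_heart M_coprod_Add S by blast
  have Sp: "projective \<H> S" using projective_heart_iff[OF SH] M_coprod_pd_le[OF S] by blast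
  have "pd_le K (int n)" by (rule pd_le_left[OF t pd_le_mono[OF M_coprod_pd_le[OF S]]]) (use Suc.prems(2) in \<open>simp_all add: add.commute\<close>)
  from Suc.IH[OF K this] obtain P d \<epsilon> where r: "proj_resolution \<H> K P d \<epsilon>" and z: "\<forall>i>n. is_zero \<H> (P i)" by blast
  note r' = r[unfolded proj_resolution_def]
  have pr: "projective \<H> (P i)" for i using r' by blast
  have \<epsilon>: "epi \<H> (P 0) K \<epsilon>" using r' by blast
  have \<epsilon>a: "arr \<epsilon> (P 0) K" using epiD[OF \<epsilon> projective_Ob[OF pr] K] .
  have 1: "exact_at \<H> (P 0) S H (k \<cdot> \<epsilon>) e" unfolding exact_at_def heart_simps
    using triangle_exact(1)[OF t K Suc.prems(1)] \<epsilon> arrD(3)[OF arr_Comp[OF \<epsilon>a Tri_arr(1)[OF t]]] arrD(3)[OF Tri_arr(2)[OF t]] by blast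
  have 2: "exact_at \<H> (P 1) (P 0) S (d 0) (k \<cdot> \<epsilon>)" using exact_mono_comp[OF t Suc.prems(1) \<epsilon>a] r' by blast
  have 3: "exact_at \<H> (P (Suc (Suc i))) (P (Suc i)) (P i) (d (Suc i)) (d i)" for i using r' by (simp add: numeral_2_eq_2)
  \<comment> \<open>The cover is put in front, and the augmentation of the syzygy followed by its
    inclusion becomes the first differential.\<close>
  let ?P = "case_nat S P" and ?d = "case_nat (k \<cdot> \<epsilon>) d"
  have "projective \<H> (?P i)" for i using Sp pr by (cases i) auto
  moreover have "exact_at \<H> (?P (i + 2)) (?P (i + 1)) (?P i) (?d (i + 1)) (?d i)" for i
    using 2 3 by (cases i) (simp_all add: numeral_2_eq_2)
  ultimately have "proj_resolution \<H> H ?P ?d e"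
    unfolding proj_resolution_def using 1 triangle_exact(2)[OF t K Suc.prems(1)] by simp
  moreover have "\<forall>i>Suc n. is_zero \<H> (?P i)"
  proof (intro allI impI)
    show "is_zero \<H> (?P i)" if "i > Suc n" for i using that z by (cases i) auto
  qed
  ultimately show ?case by blast
qed

section \<open>Finitistic dimension of the heart\<close>

lemma projdim_ab_eq: assumes "H \<in> Ob \<H>"
  shows "projdim_ab \<H> H = Inf {ereal (real n) | n :: nat. pd_le H (int n)}"
proof -
  have "(\<exists>P d \<epsilon>. proj_resolution \<H> H P d \<epsilon> \<and> (\<forall>i>n. is_zero \<H> (P i))) \<longleftrightarrow> pd_le H (int n)" for n
    using resolution_pd_le[OF assms] pd_le_resolution[OF assms] by blast
  then show ?thesis unfolding projdim_ab_def by presburger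
qed

lemma projdim_ab_finite_iff: assumes "H \<in> Ob \<H>"
  shows "projdim_ab \<H> H < \<infinity> \<longleftrightarrow> (\<exists>n. pd_le H n)"
proof
  show "projdim_ab \<H> H < \<infinity> \<Longrightarrow> \<exists>n. pd_le H n"
    unfolding projdim_ab_eq[OF assms] Inf_less_iff by blast
  assume "\<exists>n. pd_le H n"
  then obtain n where "pd_le H n" by blast
  then have "pd_le H (int (nat n))" by (rule pd_le_mono) simp
  then have "ereal (real (nat n)) \<in> {ereal (real n) | n :: nat. pd_le H (int n)}" by blast
  then show "projdim_ab \<H> H < \<infinity>" unfolding projdim_ab_eq[OF assms] Inf_less_iff
    by (rule bexI[rotated]) simp
qed

lemma M_heart: "M \<in> Ob \<H>" using Add_heart M_Add by blast

text \<open>Dimensions in the heart are infima over natural numbers, so floor(r) must be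
  nonnegative; the nonzero object \<open>M\<close> of the heart ensures this through
  \<open>le_FPD\<close>.\<close>

lemma FPD_ab_le_FPD: assumes "\<not> is_zero T M" shows "FPD_ab \<H> \<le> FPD T M"
proof (rule ereal_le_real)
  fix r assume r: "FPD T M \<le> ereal r"
  have "ereal (of_int 0) \<le> FPD T M" using le_FPD[of 0] M_heart assms heart_iff by blast
  then have "ereal (of_int 0) \<le> ereal r" using r by (rule order_trans)
  then have r0: "0 \<le> r" by simp
  show "FPD_ab \<H> \<le> ereal r" unfolding FPD_ab_def
  proof (rule Sup_least, clarify)
    fix H assume H: "H \<in> Ob \<H>" and "projdim_ab \<H> H < \<infinity>"
    then have "\<exists>n. pd_le H n" using projdim_ab_finite_iff[OF H] by blast
    then have "pd_le H \<lfloor>r\<rfloor>" using r H T_bd_GE_iff unfolding FPD_le_iff heart_iff by blast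
    moreover have "int (nat \<lfloor>r\<rfloor>) = \<lfloor>r\<rfloor>" using r0 by simp
    ultimately have "projdim_ab \<H> H \<le> ereal (real (nat \<lfloor>r\<rfloor>))"
      unfolding projdim_ab_eq[OF H] by (intro Inf_lower) auto
    also have "\<dots> \<le> ereal r" using r0 by simp
    finally show "projdim_ab \<H> H \<le> ereal r" .
  qed
qed

lemma FPD_le_FPD_ab: "FPD T M \<le> FPD_ab \<H>"
proof (rule ereal_le_real)
  fix r assume r: "FPD_ab \<H> \<le> ereal r"
  have fin: "projdim_ab \<H> H \<le> ereal r" if "H \<in> Ob \<H>" "\<exists>n. pd_le H n" for H
    using r that projdim_ab_finite_iff[OF that(1)] unfolding FPD_ab_def Sup_le_iff by blast
  \<comment> \<open>\<open>M\<close> in the heart makes \<open>r\<close> nonnegative, which later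
    absorbs the piece \<open>Y\<close> of dimension at most -1.\<close>
  have "0 \<le> projdim_ab \<H> M" unfolding projdim_ab_def by (rule Inf_greatest) auto
  then have "0 \<le> ereal r" using fin[OF M_heart] pd_le_M order_trans by blast
  then have r0: "0 \<le> \<lfloor>r\<rfloor>" by simp
  have hr: "pd_le H \<lfloor>r\<rfloor>" if "H \<in> Ob \<H>" "\<exists>n. pd_le H n" for H
  proof -
    have "Inf {ereal (real n) | n :: nat. pd_le H (int n)} < ereal (of_int (\<lfloor>r\<rfloor> + 1))"
      using fin[OF that] unfolding projdim_ab_eq[OF that(1)] by (rule le_less_trans) simp
    then obtain n where "pd_le H (int n)" "real n < of_int (\<lfloor>r\<rfloor> + 1)" unfolding Inf_less_iff by auto
    moreover have "int n \<le> \<lfloor>r\<rfloor>" using calculation(2) by linarith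
    ultimately show ?thesis using pd_le_mono by blast
  qed
  show "FPD T M \<le> ereal r" unfolding FPD_le_iff
  proof (intro ballI impI)
    fix X assume X: "X \<in> T_bd T M \<inter> GE 0" and "\<exists>k. pd_le X k"
    then obtain d m' where d: "pd_le X d" and m': "X \<in> LE m'" using T_bd_GE_iff by blast
    define m where "m = max 0 m'"
    have m: "X \<in> LE m" "m \<ge> 0" using LE_mono[OF m'] by (simp_all add: m_def)
    \<comment> \<open>Stopping the tower at \<open>LE 0\<close> uses only M[-i] with i \<ge> 1. As
      \<open>M\<close> is in the heart, \<open>Y\<close> lies in \<open>GE 1\<close>, and this puts
      the remainder \<open>U\<close> into \<open>GE 0\<close>.\<close>
    obtain Y U f g h where Y: "Y \<in> Coprod \<kappa> T {Sh T (-i) M | i. 1 \<le> i \<and> i \<le> m}" and U: "U \<in> LE 0"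
      and t: "Tri T Y X U f g h" using tower[OF m(1), of 1 "nat m"] m(2) by auto
    have Y1: "Y \<in> GE 1" using Y
    proof induction
      case (base Z)
      then obtain i where i: "Z = Sh T (-i) M" "1 \<le> i" by blast
      have "M \<in> GE (1 - i)" using M_heart GE_mono[of M 0 "1 - i"] i(2) by (simp add: heart_iff)
      then show ?case using i(1) GE_Sh[OF M_Ob, of "-i" 1] by simp
    next
      case (coproduct I Z S \<iota>)
      then show ?case using GE_coprod by blast
    next
      case (extension Z1 Z2 Z f g h)
      then show ?case using GE_ext by blast
    qed
    have "U \<in> GE 0" using GE_right[OF t] X Y1 by simp
    then have UH: "U \<in> Ob \<H>" using U heart_iff by blast
    have Yp: "pd_le Y (-1)" using Coprod_bounds[OF Y] by blast
    \<comment> \<open>\<open>d\<close> may be negative, but the bound for \<open>U\<close> must be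
      at least one more than the bound -1 for \<open>Y\<close>.\<close>
    have "pd_le U (max 0 d)" by (rule pd_le_right[OF t pd_le_mono[OF d] pd_le_mono[OF Yp]]) simp_all
    then have "pd_le U \<lfloor>r\<rfloor>" using hr[OF UH] by blast
    moreover have "pd_le Y \<lfloor>r\<rfloor>" by (rule pd_le_mono[OF Yp]) (use r0 in linarith)
    ultimately show "pd_le X \<lfloor>r\<rfloor>" using pd_le_ext[OF t] by blast
  qed
qed

end

text \<open>A zero \<open>M\<close> is excluded where the conventions would break the claim: every
  object is then zero, \<open>FPD\<close> and FPD - inf M are -\<infinity>, while
  \<open>Findim\<close> and the finitistic dimension of the heart are 0.\<close>

theorem theorem4p1:
  fixes \<kappa> :: "'u rel" and T :: "('o, 'm) tricat" and M :: 'o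
  assumes "compactly_generated_tricat \<kappa> T"
    and "compact_generator \<kappa> T M"
    and "silting T M"
  shows
    "(FPD T M \<le> silp \<kappa> T M \<and> silp \<kappa> T M \<le> gpd T M \<and>
        (gpd T M < \<infinity> \<longrightarrow> FPD T M = gpd T M)) \<and>
     (FPD T M \<le> Findim \<kappa> T M \<and> Findim \<kappa> T M \<le> max 0 (FPD T M) \<and>
        (\<not> is_zero T M \<longrightarrow> max 0 (FPD T M) \<le> FPD T M - coh_inf T M M)) \<and>
     (tilting \<kappa> T M \<and> \<not> is_zero T M \<longrightarrow>
        Findim \<kappa> T M = FPD T M \<and> FPD T M = FPD_ab (heart T M) \<and>
        FPD_ab (heart T M) =
          Sup {projdim_ab (heart T M) H | H. H \<in> Ob (heart T M) \<and>
                 projdim_ab (heart T M) H < \<infinity>})"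
proof -
  interpret silting_generator \<kappa> T M
    using assms by (simp add: silting_generator_def silting_generator_axioms_def)
  have "Findim \<kappa> T M = FPD T M \<and> FPD T M = FPD_ab (heart T M)" if "tilting \<kappa> T M" "\<not> is_zero T M"
  proof -
    interpret tilting_generator \<kappa> T M by unfold_locales (rule that(1))
    \<comment> \<open>\<open>M\<close> itself bounds \<open>FPD\<close> below by 0, which absorbs
      the maximum in the bound for \<open>Findim\<close>.\<close>
    have "0 \<le> FPD T M" using le_FPD[of 0] M_heart heart_iff that(2) by (simp add: zero_ereal_def)
    then have "Findim \<kappa> T M \<le> FPD T M" using Findim_le_FPD by (simp add: max_absorb2)
    then show ?thesis using FPD_le_Findim FPD_le_FPD_ab FPD_ab_le_FPD[OF that(2)] by (simp add: antisym)
  qed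
  then show ?thesis
    using FPD_le_silp silp_le_gpd FPD_eq_gpd FPD_le_Findim Findim_le_FPD max_FPD_le
    by (simp add: FPD_ab_def)
qed

end
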